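(* Let $\pi$ be a permutation of $[n]$ with $\rho$ runs, and let $\mathcal{R}=\langle r_1,\ldots,r_\rho\rangle$ be the sequence of the lengths of its runs (listed left to right). There is an encoding scheme (data structure) representing $\pi$ in at most $n(2+H(\mathcal{R}))(1+o(1))+O(\rho\log n)$ bits which supports the computation of $\pi(i)$ and of $\pi^{-1}(i)$ in time $O(1+\log\rho)$ for any $i\in[n]$. Moreover, if $i$ is chosen uniformly at random in $[n]$, the average time of these operations is $O(1+H(\mathcal{R}))$.
   Context: Notation: $[x]=\{1,\ldots,x\}$, $\lg x=\log_2 x$. The model is the word RAM with words of $\Theta(\log n)$ bits; all $o(\cdot)$ terms are asymptotic in $n$. For a sequence of positive integers $X=\langle n_1,\ldots,n_r\rangle$ summing to $n$, its entropy is $H(X)=\sum_{i=1}^r \frac{n_i}{n}\lg\frac{n}{n_i}$. A down step of a permutation $\pi$ of $[n]$ is a position $i$ with $\pi(i+1)<\pi(i)$. A run is a maximal range of consecutive positions $\{i,\ldots,j\}$ containing no down step. If $d_1<\cdots<d_k$ are the down steps, the number of runs is $\rho=k+1$ and the sequence of run lengths is $\langle d_1,d_2-d_1,\ldots,d_k-d_{k-1},n-d_k\rangle$ (the run lengths sum to $n$). *)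

theory Defs
  imports
    "HOL-Probability.Probability"
    "HOL-Combinatorics.Permutations"
    "HOL-Library.Landau_Symbols"
begin

section \<open>Entropy, down steps and runs\<close>

definition seq_entropy :: "nat list \<Rightarrow> real" where
  "seq_entropy X = (let n = real (sum_list X) in \<Sum>x\<leftarrow>X. real x / n * log 2 (n / real x))"

definition down_steps :: "nat \<Rightarrow> (nat \<Rightarrow> nat) \<Rightarrow> nat set" where
  "down_steps n \<pi> = {i. 1 \<le> i \<and> i < n \<and> \<pi> (i + 1) < \<pi> i}"

definition num_runs :: "nat \<Rightarrow> (nat \<Rightarrow> nat) \<Rightarrow> nat" where
  "num_runs n \<pi> = card (down_steps n \<pi>) + 1"

text \<open>If \<open>d\<^sub>1 < \<dots> < d\<^sub>k\<close> are the down steps, this is the list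
  \<open>[d\<^sub>1 - 0, d\<^sub>2 - d\<^sub>1, \<dots>, d\<^sub>k - d\<^sub>k\<^sub>-\<^sub>1, n - d\<^sub>k]\<close>; for \<open>k = 0\<close> it is \<open>[n]\<close>.\<close>

definition run_lengths :: "nat \<Rightarrow> (nat \<Rightarrow> nat) \<Rightarrow> nat list" where
  "run_lengths n \<pi> =
     (let ds = sorted_list_of_set (down_steps n \<pi>) in map2 (-) (ds @ [n]) (0 # ds))"

lemma finite_down_steps [simp]: "finite (down_steps n \<pi>)"
  by (rule finite_subset[of _ "{..<n}"]) (auto simp: down_steps_def)

lemma length_run_lengths: "length (run_lengths n \<pi>) = num_runs n \<pi>"
  by (simp add: run_lengths_def num_runs_def Let_def)

lemma sum_list_differences:
  fixes ds :: "nat list"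
  assumes "sorted (a # ds @ [n])"
  shows "sum_list (map2 (-) (ds @ [n]) (a # ds)) = n - a"
  using assms
proof (induction ds arbitrary: a)
  case (Cons d ds)
  have "sorted (d # ds @ [n])" "a \<le> d" "d \<le> n"
    using Cons.prems by auto
  with Cons.IH[of d] show ?case by simp
qed simp

lemma sum_list_run_lengths: "sum_list (run_lengths n \<pi>) = n"
proof -
  have "sorted (0 # sorted_list_of_set (down_steps n \<pi>) @ [n])"
    by (auto simp: sorted_append) (auto simp: down_steps_def)
  from sum_list_differences[OF this] show ?thesis
    by (simp add: run_lengths_def Let_def)
qed

section \<open>The word RAM\<close>

text \<open>
  Structured programs for a word RAM with words of \<open>w\<close> bits, a word being a natural number below
  \<open>2 ^ w\<close>.  The word length is a parameter of the semantics, so that one and the same program can be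
  run for all \<open>n\<close>.  A query program sees the data structure as a read-only array \<open>D\<close> of words; it
  has registers and a writable, word-addressed working memory (initially zero) of its own.
  Every arithmetic operation, comparison, bitwise operation, shift, memory access and control
  transfer takes unit time.
\<close>

datatype binop = Add | Sub | Mul | Div | Mod | And | Or | Xor | Shl | Shr | Less | Equal

datatype expr =
    Const nat
  | Reg nat
  | Mem expr
  | Data expr
  | Bin binop expr expr

datatype prog =
    Skip
  | Assign nat expr
  | Store expr expr
  | Seq prog prog
  | Cond expr prog prog
  | While expr prog

text \<open>Registers and working memory.\<close>

type_synonym state = "(nat \<Rightarrow> nat) \<times> (nat \<Rightarrow> nat)"

text \<open>Arithmetic is modulo \<open>2 ^ w\<close>; the arguments are words. Division by zero gives zero.\<close>

fun apply_binop :: "nat \<Rightarrow> binop \<Rightarrow> nat \<Rightarrow> nat \<Rightarrow> nat" where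
  "apply_binop w Add x y = take_bit w (x + y)"
| "apply_binop w Sub x y = take_bit w (x + 2 ^ w - y)"
| "apply_binop w Mul x y = take_bit w (x * y)"
| "apply_binop w Div x y = take_bit w (x div y)"
| "apply_binop w Mod x y = take_bit w (x mod y)"
| "apply_binop w And x y = take_bit w (semiring_bit_operations_class.and x y)"
| "apply_binop w Or x y = take_bit w (semiring_bit_operations_class.or x y)"
| "apply_binop w Xor x y = take_bit w (semiring_bit_operations_class.xor x y)"
| "apply_binop w Shl x y = take_bit w (push_bit y x)"
| "apply_binop w Shr x y = take_bit w (drop_bit y x)"
| "apply_binop w Less x y = take_bit w (of_bool (x < y))"
| "apply_binop w Equal x y = take_bit w (of_bool (x = y))"

fun eval_expr :: "nat \<Rightarrow> nat list \<Rightarrow> state \<Rightarrow> expr \<Rightarrow> nat" where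
  "eval_expr w D s (Const k) = take_bit w k"
| "eval_expr w D s (Reg r) = fst s r"
| "eval_expr w D s (Mem e) = snd s (eval_expr w D s e)"
| "eval_expr w D s (Data e) =
     (let a = eval_expr w D s e in if a < length D then D ! a else 0)"
| "eval_expr w D s (Bin f e1 e2) =
     apply_binop w f (eval_expr w D s e1) (eval_expr w D s e2)"

fun expr_cost :: "expr \<Rightarrow> nat" where
  "expr_cost (Const k) = 1"
| "expr_cost (Reg r) = 1"
| "expr_cost (Mem e) = expr_cost e + 1"
| "expr_cost (Data e) = expr_cost e + 1"
| "expr_cost (Bin f e1 e2) = expr_cost e1 + expr_cost e2 + 1"

text \<open>\<open>exec w D p s t s'\<close>: started in state \<open>s\<close>, program \<open>p\<close> halts in state \<open>s'\<close> after exactly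
  \<open>t\<close> time units.\<close>

inductive exec :: "nat \<Rightarrow> nat list \<Rightarrow> prog \<Rightarrow> state \<Rightarrow> nat \<Rightarrow> state \<Rightarrow> bool"
  for w :: nat and D :: "nat list" where
  Skip: "exec w D Skip s 1 s"
| Assign: "exec w D (Assign r e) s (expr_cost e + 1)
             ((fst s)(r := eval_expr w D s e), snd s)"
| Store: "exec w D (Store a e) s (expr_cost a + expr_cost e + 1)
             (fst s, (snd s)(eval_expr w D s a := eval_expr w D s e))"
| Seq: "exec w D p s t s' \<Longrightarrow> exec w D q s' u s'' \<Longrightarrow> exec w D (Seq p q) s (t + u) s''"
| CondTrue: "eval_expr w D s b \<noteq> 0 \<Longrightarrow> exec w D p s t s' \<Longrightarrow>
             exec w D (Cond b p q) s (expr_cost b + 1 + t) s'"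
| CondFalse: "eval_expr w D s b = 0 \<Longrightarrow> exec w D q s t s' \<Longrightarrow>
             exec w D (Cond b p q) s (expr_cost b + 1 + t) s'"
| WhileFalse: "eval_expr w D s b = 0 \<Longrightarrow> exec w D (While b p) s (expr_cost b + 1) s"
| WhileTrue: "eval_expr w D s b \<noteq> 0 \<Longrightarrow> exec w D p s t s' \<Longrightarrow>
             exec w D (While b p) s' u s'' \<Longrightarrow>
             exec w D (While b p) s (expr_cost b + 1 + t + u) s''"

inductive_cases SkipE: "exec w D Skip s t s'"
inductive_cases AssignE: "exec w D (Assign r e) s t s'"
inductive_cases StoreE: "exec w D (Store a e) s t s'"
inductive_cases SeqE: "exec w D (Seq p q) s t s'"
inductive_cases CondE: "exec w D (Cond b p q) s t s'"
inductive_cases WhileE: "exec w D (While b p) s t s'"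

lemma exec_deterministic:
  "exec w D p s t s' \<Longrightarrow> exec w D p s u s'' \<Longrightarrow> t = u \<and> s' = s''"
proof (induction arbitrary: u s'' rule: exec.induct)
  case Skip
  then show ?case by (elim SkipE) simp
next
  case Assign
  then show ?case by (elim AssignE) simp
next
  case Store
  then show ?case by (elim StoreE) simp
next
  case Seq
  from Seq.prems show ?case by (elim SeqE) (use Seq.IH in blast)
next
  case CondTrue
  from CondTrue.prems CondTrue.hyps(1) show ?case
    by (elim CondE) (use CondTrue.IH in auto)
next
  case CondFalse
  from CondFalse.prems CondFalse.hyps(1) show ?case
    by (elim CondE) (use CondFalse.IH in auto)
next
  case WhileFalse
  from WhileFalse.prems show ?case by (rule WhileE) (use WhileFalse.hyps in auto)
next
  case (WhileTrue s b p t s' u\<^sub>0 s\<^sub>0)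
  from WhileTrue.prems show ?case
  proof (rule WhileE)
    fix t\<^sub>1 s\<^sub>1 u\<^sub>1
    assume u: "u = Suc (expr_cost b + t\<^sub>1 + u\<^sub>1)"
      and body: "exec w D p s t\<^sub>1 s\<^sub>1" and loop: "exec w D (While b p) s\<^sub>1 u\<^sub>1 s''"
    from WhileTrue.IH(1)[OF body] have "t = t\<^sub>1" "s' = s\<^sub>1" by auto
    with WhileTrue.IH(2)[of u\<^sub>1 s''] loop u show ?thesis by simp
  qed (use WhileTrue.hyps(1) in auto)
qed

text \<open>The argument is passed, and the result returned, in register 0; all other registers and the
  working memory are initially zero.\<close>

definition computes :: "nat \<Rightarrow> nat list \<Rightarrow> prog \<Rightarrow> nat \<Rightarrow> nat \<Rightarrow> nat \<Rightarrow> bool" where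
  "computes w D p x y t \<longleftrightarrow>
     (\<exists>s. exec w D p ((\<lambda>_. 0)(0 := take_bit w x), \<lambda>_. 0) t s \<and> fst s 0 = y)"

definition words :: "nat \<Rightarrow> nat list \<Rightarrow> bool" where
  "words w D \<longleftrightarrow> (\<forall>x \<in> set D. x < 2 ^ w)"

definition size_in_bits :: "nat \<Rightarrow> nat list \<Rightarrow> nat" where
  "size_in_bits w D = w * length D"

text \<open>
  Word lengths \<open>w n = \<Theta>(log n)\<close>. The explicit factor \<open>c\<close> is the constant hidden in the lower
  bound, required from \<open>n = 1\<close> on: if it is too small, a data structure of the sizes considered
  here cannot be addressed by a single word.
\<close>

definition word_length :: "real \<Rightarrow> (nat \<Rightarrow> nat) \<Rightarrow> bool" where
  "word_length c w \<longleftrightarrow>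
     (\<lambda>n. real (w n)) \<in> \<Theta>(\<lambda>n. log 2 (real n)) \<and>
     (\<forall>n\<ge>1. real (w n) \<ge> c * (1 + log 2 (real n)))"

end

theory Submission
  imports Defs "HOL-Library.Tree" "HOL-Library.Discrete_Functions" "HOL-Real_Asymp.Real_Asymp"
begin

text \<open>
  The value of each \<open>j\<close> is routed through a binary tree whose leaves are the runs; a node
  stores one bit for every value in its subtree, telling into which child it goes.  The tree need
  not be alphabetic, since the leaf of each run may be stored in \<open>O(\<rho> log n)\<close> bits.  Hence a
  Shannon code suffices, and the bit it saves against an alphabetic code pays for mixing the weights
  \<open>r\<^sub>a/n\<close> with \<open>1/\<rho>\<close>: every run has depth at most \<open>log (n/r\<^sub>a) + 2\<close> and
  \<open>log \<rho> + 2\<close>, so that the bits add up to at most \<open>n (2 + H)\<close>.  The inverse descends by rank,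
  \<open>\<pi>\<close> climbs by select from the leaf of the run containing the position, and that run is found in
  a search tree balanced by the same weights.  Rank and select take constant time with lower-order
  space by two-level directories and tables indexed by windows of \<open>b \<le> (log n)/4\<close> bits.
  For the finitely many lengths at which these parameters degenerate both permutations are
  tabulated.
\<close>

section \<open>Straight-line programs and arrays\<close>

text \<open>One pair of programs has to serve every \<open>n\<close>, while \<open>w\<close> is
  known only up to the constants in Theta. So nothing that depends on \<open>n\<close> occurs in a
  program: all parameters are read from the header of \<open>D\<close>. They are
  \<open>b = 2 ^ e\<close>, between \<open>w/(8k)\<close> and \<open>w/(4k)\<close> where
  \<open>w <= k log n\<close>, and \<open>f = 3e\<close>, \<open>K2 = f^2\<close>,
  \<open>K1 = b f^2\<close>. Three relations drive this choice. \<open>b^3 = 2 ^ f\<close> lets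
  offsets inside a superblock, or inside a group of \<open>K1\<close> elements spanning less than
  \<open>K1^2\<close> positions, fit into \<open>f\<close> bits. \<open>K2^2 <= b\<close> puts a
  group of \<open>K2\<close> elements either inside one window of \<open>b\<close> bits or far
  enough apart to be listed explicitly. \<open>2 ^ b <= n^(1/4)\<close> makes the tables negligible.
  Every directory then costs a fraction O(1/f) of the stored bits, with f about 3 log log n. This
  loss is relative to a length of at most n(2 + H), so the factor 1 + o(1) covers it. Whatever is
  proportional to the number of tree nodes takes O(rho) words and goes into the additive term. Only
  size and query time are claimed, so the encoding is obtained by choice and never computed.\<close>

fun while_free :: "prog \<Rightarrow> bool" where
  "while_free (Seq p q) = (while_free p \<and> while_free q)"
| "while_free (Cond b p q) = (while_free p \<and> while_free q)"
| "while_free (While b p) = False"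
| "while_free _ = True"

text \<open>Only three loops occur in the programs; their bodies and everything around them are
  loop-free. There a total state function and a constant cost bound replace reasoning about
  \<open>exec\<close>. The equation for \<open>While\<close> is a default outside the scope of
  \<open>while_free\<close>.\<close>

fun sem :: "nat \<Rightarrow> nat list \<Rightarrow> prog \<Rightarrow> state \<Rightarrow> state" where
  "sem w D Skip s = s"
| "sem w D (Assign r e) s = ((fst s)(r := eval_expr w D s e), snd s)"
| "sem w D (Store a e) s = (fst s, (snd s)(eval_expr w D s a := eval_expr w D s e))"
| "sem w D (Seq p q) s = sem w D q (sem w D p s)"
| "sem w D (Cond b p q) s = (if eval_expr w D s b \<noteq> 0 then sem w D p s else sem w D q s)"
| "sem w D (While b p) s = s"

text \<open>Adding the costs of both branches of a \<open>Cond\<close> is cruder than taking their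
  maximum, but any constant bound will do.\<close>

fun max_cost :: "prog \<Rightarrow> nat" where
  "max_cost Skip = 1"
| "max_cost (Assign r e) = expr_cost e + 1"
| "max_cost (Store a e) = expr_cost a + expr_cost e + 1"
| "max_cost (Seq p q) = max_cost p + max_cost q"
| "max_cost (Cond b p q) = expr_cost b + 1 + max_cost p + max_cost q"
| "max_cost (While b p) = 0"

lemma exec_sem: "while_free p \<Longrightarrow> \<exists>t\<le>max_cost p. exec w D p s t (sem w D p s)"
proof (induction p arbitrary: s)
  case (Seq p q)
  obtain t where t: "t \<le> max_cost p" "exec w D p s t (sem w D p s)"
    using Seq.IH(1)[of s] Seq.prems by auto
  obtain u where u: "u \<le> max_cost q" "exec w D q (sem w D p s) u (sem w D q (sem w D p s))"
    using Seq.IH(2)[of "sem w D p s"] Seq.prems by auto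
  show ?case using exec.Seq[OF t(2) u(2)] t u by (intro exI[of _ "t + u"]) auto
next
  case (Cond b p q)
  show ?case
  proof (cases "eval_expr w D s b = 0")
    case True
    obtain t where t: "t \<le> max_cost q" "exec w D q s t (sem w D q s)"
      using Cond.IH(2)[of s] Cond.prems by auto
    show ?thesis using exec.CondFalse[OF True t(2), of p] t True
      by (intro exI[of _ "expr_cost b + 1 + t"]) auto
  next
    case False
    obtain t where t: "t \<le> max_cost p" "exec w D p s t (sem w D p s)"
      using Cond.IH(1)[of s] Cond.prems by auto
    show ?thesis using exec.CondTrue[OF False t(2), of q] t False
      by (intro exI[of _ "expr_cost b + 1 + t"]) auto
  qed
next
  case Skip then show ?case using exec.Skip[of w D s] by fastforce
next
  case (Assign r e) then show ?case using exec.Assign[of w D r e s] by fastforce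
next
  case (Store a e) then show ?case using exec.Store[of w D a e s] by fastforce
qed auto

section \<open>Bit fields laid across words\<close>

definition bits_at :: "(nat \<Rightarrow> bool) \<Rightarrow> nat \<Rightarrow> nat \<Rightarrow> nat" where
  "bits_at \<beta> p k = horner_sum of_bool 2 (map (\<lambda>t. \<beta> (p + t)) [0..<k])"

lemma bit_bits_at: "bit (bits_at \<beta> p k) t \<longleftrightarrow> t < k \<and> \<beta> (p + t)"
  unfolding bits_at_def by (auto simp: bit_horner_sum_bit_iff)

lemma nat_less_exp_if_bits:
  assumes "\<And>t. bit (x::nat) t \<Longrightarrow> t < k"
  shows "x < 2 ^ k"
proof -
  have "take_bit k x = x"
    by (rule bit_eqI) (use assms in \<open>auto simp: bit_take_bit_iff\<close>)
  then show ?thesis by (metis take_bit_nat_less_exp)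
qed

lemma bits_at_less: "bits_at \<beta> p k < 2 ^ k"
  by (rule nat_less_exp_if_bits) (simp add: bit_bits_at)

text \<open>The final extra word lets a read that straddles two words stay inside the array.\<close>

definition pack :: "nat \<Rightarrow> nat \<Rightarrow> (nat \<Rightarrow> bool) \<Rightarrow> nat list" where
  "pack w len \<beta> = map (\<lambda>i. bits_at \<beta> (i * w) w) [0..<len div w + 2]"

definition field_bits :: "nat \<Rightarrow> nat list \<Rightarrow> nat \<Rightarrow> bool" where
  "field_bits k xs p \<longleftrightarrow> p div k < length xs \<and> bit (xs ! (p div k)) (p mod k)"

lemma bits_at_field_bits:
  assumes "i < length xs" "xs ! i < 2 ^ k" 
  shows "bits_at (field_bits k xs) (i * k) k = xs ! i"
proof (rule bit_eqI)
  fix t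
  have "bit (xs ! i) t \<Longrightarrow> t < k"
    using assms(2) by (metis bit_take_bit_iff take_bit_nat_eq_self)
  moreover have "t < k \<Longrightarrow> (i * k + t) div k = i" "t < k \<Longrightarrow> (i * k + t) mod k = t"
    by auto
  ultimately show "bit (bits_at (field_bits k xs) (i * k) k) t = bit (xs ! i) t"
    using assms by (auto simp: bit_bits_at field_bits_def)
qed

text \<open>Word \<open>h\<close> of the data structure holds the address of the array \<open>h\<close>; word 0 holds the word length.\<close>

definition arr :: "nat \<Rightarrow> expr \<Rightarrow> expr" where
  "arr h e = Data (Bin Add (Data (Const h)) e)"

text \<open>The field may straddle two words: the high part of the word containing \<open>p\<close>
  is joined with the low part of its successor, and the remainder modulo \<open>2 ^ k\<close> masks
  the result. If \<open>p\<close> is aligned, the successor is shifted by \<open>w\<close> and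
  truncated away.\<close>

definition read_bits :: "nat \<Rightarrow> expr \<Rightarrow> expr \<Rightarrow> expr" where
  "read_bits h p k = Bin Mod
     (Bin Or (Bin Shr (arr h (Bin Div p (Data (Const 0)))) (Bin Mod p (Data (Const 0))))
             (Bin Shl (arr h (Bin Add (Bin Div p (Data (Const 0))) (Const 1)))
                      (Bin Sub (Data (Const 0)) (Bin Mod p (Data (Const 0))))))
     (Bin Shl (Const 1) k)"

section \<open>Evaluation of expressions whose values stay below the word bound\<close>

locale ram =
  fixes w :: nat and D :: "nat list"
  assumes words_D: "words w D"
    and len_D: "length D < 2 ^ w"
    and D0: "D \<noteq> []" "D ! 0 = w"
    and w_ge: "8 \<le> w"
begin

abbreviation "val \<equiv> eval_expr w D"

definition stored :: "nat \<Rightarrow> nat list \<Rightarrow> bool" where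
  "stored h A \<longleftrightarrow> h < length D \<and> D ! h + length A \<le> length D \<and>
     (\<forall>i<length A. D ! (D ! h + i) = A ! i)"

lemma D_less: "i < length D \<Longrightarrow> D ! i < 2 ^ w"
  using words_D by (auto simp: words_def)

lemma w_less: "w < 2 ^ w" by (rule less_exp)

lemma one_less: "(1::nat) < 2 ^ w"
  using w_ge by (metis less_exp less_one linorder_neqE_nat nat_less_le not_numeral_le_zero one_less_power one_less_numeral_iff semiring_norm(76) le_zero_eq zero_less_iff_neq_zero)

lemma val_const: "k < 2 ^ w \<Longrightarrow> val s (Const k) = k"
  by (simp add: take_bit_nat_eq_self)

lemma val_data_const: "k < length D \<Longrightarrow> val s (Data (Const k)) = D ! k"
  using len_D by (simp add: take_bit_nat_eq_self)

lemma val_word_length: "val s (Data (Const 0)) = w"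
  using val_data_const[of 0 s] D0 by simp

lemma val_add: "val s a = x \<Longrightarrow> val s b = y \<Longrightarrow> x + y < 2 ^ w \<Longrightarrow> val s (Bin Add a b) = x + y"
  by (simp add: take_bit_nat_eq_self)

lemma val_sub:
  assumes "val s a = x" "val s b = y" "x < 2 ^ w" "y \<le> x"
  shows "val s (Bin Sub a b) = x - y"
proof -
  have *: "x + 2 ^ w - y = (x - y) + 2 ^ w" using assms by simp
  have "((x - y) + 2 ^ w) mod 2 ^ w = x - y"
    unfolding mod_add_self2 using assms by simp
  then show ?thesis unfolding eval_expr.simps assms(1,2) apply_binop.simps *
    by (simp only: take_bit_eq_mod)
qed

lemma val_mul: "val s a = x \<Longrightarrow> val s b = y \<Longrightarrow> x * y < 2 ^ w \<Longrightarrow> val s (Bin Mul a b) = x * y"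
  by (simp add: take_bit_nat_eq_self)

lemma val_div:
  assumes "val s a = x" "val s b = y" "x < 2 ^ w" shows "val s (Bin Div a b) = x div y"
proof -
  have "x div y < 2 ^ w" using assms(3) div_le_dividend le_less_trans by blast
  then show ?thesis using assms by (simp add: take_bit_nat_eq_self)
qed

lemma val_mod:
  assumes "val s a = x" "val s b = y" "x < 2 ^ w" shows "val s (Bin Mod a b) = x mod y"
proof -
  have "x mod y < 2 ^ w" using assms(3) mod_less_eq_dividend le_less_trans by blast
  then show ?thesis using assms by (simp add: take_bit_nat_eq_self)
qed

lemma val_less: "val s a = x \<Longrightarrow> val s b = y \<Longrightarrow> val s (Bin Less a b) = of_bool (x < y)"
  using one_less by (simp add: take_bit_nat_eq_self of_bool_def)

lemma val_equal: "val s a = x \<Longrightarrow> val s b = y \<Longrightarrow> val s (Bin Equal a b) = of_bool (x = y)"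
  using one_less by (simp add: take_bit_nat_eq_self of_bool_def)

lemma stored_length: "stored h A \<Longrightarrow> length A < 2 ^ w"
  unfolding stored_def using len_D by linarith

lemma val_arr:
  assumes "stored h A" "val s e = i" "i < length A"
  shows "val s (arr h e) = A ! i"
proof -
  have h: "h < length D" "D ! h + length A \<le> length D" "D ! (D ! h + i) = A ! i"
    using assms by (auto simp: stored_def)
  have "val s (Bin Add (Data (Const h)) e) = D ! h + i"
    by (rule val_add) (use h assms len_D val_data_const in \<open>auto simp del: eval_expr.simps\<close>)
  then show ?thesis using h assms unfolding arr_def by (simp add: Let_def del: apply_binop.simps)
qed

lemma val_read_bits:
  assumes st: "stored h (pack w len \<beta>)" and p: "val s pe = p" and k: "val s ke = k"
    and "p + k \<le> len" "k < w" "p < 2 ^ w"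
  shows "val s (read_bits h pe ke) = bits_at \<beta> p k"
proof -
  define q o' where "q = p div w" and "o' = p mod w"
  have w0: "0 < w" using w_ge by simp
  have pq: "p = q * w + o'" "o' < w" using w0 by (auto simp: q_def o'_def)
  have "q \<le> len div w" unfolding q_def using assms by (intro div_le_mono) simp
  then have ql: "q + 1 < length (pack w len \<beta>)" by (simp add: pack_def)
  have d: "val s (Bin Div pe (Data (Const 0))) = q"
    unfolding q_def by (rule val_div[OF p val_word_length]) fact
  have m: "val s (Bin Mod pe (Data (Const 0))) = o'"
    unfolding o'_def by (rule val_mod[OF p val_word_length]) fact
  have lo: "val s (arr h (Bin Div pe (Data (Const 0)))) = bits_at \<beta> (q * w) w"
    using val_arr[OF st d] ql by (simp add: pack_def del: upt_Suc)
  have d1: "val s (Bin Add (Bin Div pe (Data (Const 0))) (Const 1)) = q + 1"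
    by (rule val_add[OF d val_const]) (use one_less ql stored_length[OF st] in auto)
  have hi: "val s (arr h (Bin Add (Bin Div pe (Data (Const 0))) (Const 1))) = bits_at \<beta> ((q + 1) * w) w"
    using val_arr[OF st d1] ql by (simp add: pack_def del: upt_Suc)
  have sb: "val s (Bin Sub (Data (Const 0)) (Bin Mod pe (Data (Const 0)))) = w - o'"
    by (rule val_sub[OF val_word_length m]) (use w_less pq in auto)
  let ?x = "take_bit w (semiring_bit_operations_class.or (take_bit w (drop_bit o' (bits_at \<beta> (q * w) w))) (take_bit w (push_bit (w - o') (bits_at \<beta> ((q + 1) * w) w))))"
  have e1: "val s (Bin Shl (Const 1) ke) = 2 ^ k"
    using \<open>k < w\<close> one_less by (simp add: k take_bit_nat_eq_self push_bit_eq_mult)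
  have "val s (read_bits h pe ke) = take_bit w (?x mod 2 ^ k)"
    unfolding read_bits_def using lo hi m sb e1
    by (metis eval_expr.simps(5) apply_binop.simps(5,7,9,10))
  also have "\<dots> = bits_at \<beta> p k"
  proof (rule bit_eqI)
    fix t
    show "bit (take_bit w (?x mod 2 ^ k)) t = bit (bits_at \<beta> p k) t"
    proof (cases "t < k")
      case True
      then have "t < w" using \<open>k < w\<close> by simp
      have a: "q * w + (o' + t) = p + t" using pq by simp
      have b: "(q + 1) * w + (t - (w - o')) = p + t" if "\<not> o' + t < w"
        using that pq by (simp add: algebra_simps)
      \<comment> \<open>Bit \<open>t\<close> of the field comes from word \<open>q\<close> if
        \<open>o' + t < w\<close>, and from word \<open>q + 1\<close> otherwise.\<close>
      show ?thesis using True \<open>t < w\<close> pq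
        by (cases "o' + t < w")
          (auto simp: take_bit_eq_mod[symmetric] bit_take_bit_iff bit_or_iff bit_drop_bit_eq
             bit_push_bit_iff bit_bits_at a b[simplified] add.commute[of t])
    qed (auto simp: take_bit_eq_mod[symmetric] bit_take_bit_iff bit_or_iff bit_bits_at)
  qed
  finally show ?thesis .
qed

lemma val_field:
  assumes "stored h (pack w (length xs * k) (field_bits k xs))" "val s pe = i * k" "val s ke = k"
    and "i < length xs" "xs ! i < 2 ^ k" "k < w" "i * k < 2 ^ w"
  shows "val s (read_bits h pe ke) = xs ! i"
proof -
  have "(i + 1) * k \<le> length xs * k" using assms by (intro mult_right_mono) auto
  then have "val s (read_bits h pe ke) = bits_at (field_bits k xs) (i * k) k"
    using assms by (intro val_read_bits[OF assms(1-3)]) (auto simp: algebra_simps)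
  then show ?thesis using bits_at_field_bits[of i xs k] assms by simp
qed

end

section \<open>Rank and select\<close>

definition bit_rank :: "bool \<Rightarrow> bool list \<Rightarrow> nat \<Rightarrow> nat" where
  "bit_rank c B p = length (filter (\<lambda>x. x = c) (take p B))"

lemma bit_rank_0 [simp]: "bit_rank c B 0 = 0"
  by (simp add: bit_rank_def)

lemma bit_rank_Suc: "p < length B \<Longrightarrow> bit_rank c B (Suc p) = bit_rank c B p + of_bool (B ! p = c)"
  by (simp add: bit_rank_def take_Suc_conv_app_nth)

lemma bit_rank_beyond: "length B \<le> p \<Longrightarrow> bit_rank c B p = bit_rank c B (length B)"
  by (simp add: bit_rank_def)

text \<open>This splits a rank at a block boundary into a directory entry and a count inside a
  window. The guard \<open>p + t < length B\<close> admits windows that run past the end of the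
  list.\<close>

lemma bit_rank_add:
  "bit_rank c B (p + r) = bit_rank c B p + card {t. t < r \<and> p + t < length B \<and> B ! (p + t) = c}"
proof (induction r)
  case (Suc r)
  have "{t. t < Suc r \<and> p + t < length B \<and> B ! (p + t) = c} =
     {t. t < r \<and> p + t < length B \<and> B ! (p + t) = c} \<union> 
     (if p + r < length B \<and> B ! (p + r) = c then {r} else {})"
    by (auto simp: less_Suc_eq)
  then have "card {t. t < Suc r \<and> p + t < length B \<and> B ! (p + t) = c} =
     card {t. t < r \<and> p + t < length B \<and> B ! (p + t) = c} + 
     of_bool (p + r < length B \<and> B ! (p + r) = c)"
    by (auto simp: card_Un_disjoint)
  moreover have "bit_rank c B (p + Suc r) = bit_rank c B (p + r) + of_bool (p + r < length B \<and> B ! (p + r) = c)"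
    using bit_rank_Suc[of "p + r" B c] bit_rank_beyond[of B "p + r" c] bit_rank_beyond[of B "Suc (p + r)" c]
    by (cases "p + r < length B") auto
  ultimately show ?case using Suc by simp
qed simp

lemma bit_rank_mono: "p \<le> q \<Longrightarrow> bit_rank c B p \<le> bit_rank c B q"
  using bit_rank_add[of c B p "q - p"] by simp

lemma bit_rank_add_le: "bit_rank c B (p + r) \<le> bit_rank c B p + r"
proof -
  have "card {t. t < r \<and> p + t < length B \<and> B ! (p + t) = c} \<le> card {..<r}"
    by (rule card_mono) auto
  then show ?thesis by (simp add: bit_rank_add)
qed

lemma bit_rank_le: "bit_rank c B p \<le> p"
  using bit_rank_add_le[of c B 0 p] by simp

lemma bit_rank_le_length: "bit_rank c B p \<le> length B"
  using bit_rank_le[of c B p] bit_rank_le[of c B "length B"] bit_rank_beyond[of B p c] by (cases "p \<le> length B") auto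

text \<open>The disjunct \<open>length B \<le> p\<close> makes selection total, with value
  \<open>length B\<close> once the elements are exhausted, and hence monotone in \<open>k\<close>.
  Directory entries for groups past the end thus require no special treatment.\<close>

definition bit_select :: "bool \<Rightarrow> bool list \<Rightarrow> nat \<Rightarrow> nat" where
  "bit_select c B k = (LEAST p. length B \<le> p \<or> k < bit_rank c B (Suc p))"

lemma bit_select_le: "bit_select c B k \<le> length B"
  unfolding bit_select_def by (rule Least_le) simp

lemma bit_select_mono: "mono (bit_select c B)"
proof (rule monoI)
  fix k k' :: nat assume "k \<le> k'"
  have "length B \<le> bit_select c B k' \<or> k' < bit_rank c B (Suc (bit_select c B k'))"
    unfolding bit_select_def by (rule LeastI[of _ "length B"]) simp
  then show "bit_select c B k \<le> bit_select c B k'"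
    unfolding bit_select_def[of c B k] using \<open>k \<le> k'\<close> by (intro Least_le) auto
qed

lemma bit_select_bit_rank:
  assumes "p < length B" "B ! p = c"
  shows "bit_select c B (bit_rank c B p) = p"
  unfolding bit_select_def
proof (rule Least_equality)
  show "length B \<le> p \<or> bit_rank c B p < bit_rank c B (Suc p)" using assms by (simp add: bit_rank_Suc)
next
  fix y assume y: "length B \<le> y \<or> bit_rank c B p < bit_rank c B (Suc y)"
  show "p \<le> y"
  proof (rule ccontr)
    assume "\<not> p \<le> y"
    then have "bit_rank c B (Suc y) \<le> bit_rank c B p" "\<not> length B \<le> y" using assms by (auto intro: bit_rank_mono)
    with y show False by simp
  qed
qed

lemma bit_rank_bit_select:
  assumes "k < bit_rank c B (length B)"
  shows "bit_rank c B (bit_select c B k) = k"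
proof -
  define p where "p = bit_select c B k"
  have len: "length B > 0" using assms by (cases B) auto
  have "length B \<le> p \<or> k < bit_rank c B (Suc p)"
    unfolding p_def bit_select_def by (rule LeastI[of _ "length B"]) simp
  moreover have "p \<le> length B - 1"
    unfolding p_def bit_select_def using len assms by (intro Least_le) simp
  ultimately have p: "p < length B" "k < bit_rank c B (Suc p)" using len by linarith+
  then have "k \<le> bit_rank c B p" by (simp add: bit_rank_Suc of_bool_def split: if_splits)
  moreover have "bit_rank c B p \<le> k"
  proof (cases p)
    case (Suc p')
    then have "\<not> (length B \<le> p' \<or> k < bit_rank c B (Suc p'))"
      using not_less_Least[of p' "\<lambda>p. length B \<le> p \<or> k < bit_rank c B (Suc p)"]
      unfolding p_def bit_select_def by simp
    then show ?thesis using Suc by simp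
  qed simp
  ultimately show ?thesis by (simp add: p_def)
qed

text \<open>
  The elements are sampled in groups of \<open>K\<close>.  A group whose positions span at least \<open>d * K\<close>
  is stored explicitly, starting at slot \<open>s (g * K) div d\<close>, where \<open>s (g * K)\<close> is the
  position of its first element: the slots of distinct wide groups are disjoint,
  so that no pointers to them are needed.
\<close>

definition wide :: "(nat \<Rightarrow> nat) \<Rightarrow> nat \<Rightarrow> nat \<Rightarrow> nat \<Rightarrow> bool" where
  "wide s K d g \<longleftrightarrow> s (g * K) + d * K \<le> s ((g + 1) * K)"

definition slot :: "(nat \<Rightarrow> nat) \<Rightarrow> nat \<Rightarrow> nat \<Rightarrow> nat \<Rightarrow> nat" where
  "slot s K d k = s (k div K * K) div d + k mod K"

text \<open>A wide group covers at least \<open>d * K\<close> positions, so every later group starts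
  at a position whose quotient by \<open>d\<close> is larger by at least \<open>K\<close>; the
  \<open>K\<close> slots of the wide group fit into this gap.\<close>

lemma slot_less:
  assumes "mono s" "wide s K d (k div K)" "k div K < k' div K" "0 < K" "0 < d"
  shows "slot s K d k < slot s K d k'"
proof -
  have "s ((k div K + 1) * K) \<le> s (k' div K * K)"
    using assms by (intro monoD[OF \<open>mono s\<close>] mult_right_mono) auto
  then have "s (k div K * K) + d * K \<le> s (k' div K * K)"
    using assms by (simp add: wide_def)
  then have "(s (k div K * K) + d * K) div d \<le> s (k' div K * K) div d"
    by (rule div_le_mono)
  then have "s (k div K * K) div d + K \<le> s (k' div K * K) div d"
    using assms by (simp add: div_mult_self2)
  moreover have "k mod K < K" using assms by simp
  ultimately show ?thesis unfolding slot_def by linarith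
qed

lemma slot_inject:
  assumes "mono s" "wide s K d (k div K)" "wide s K d (k' div K)" "0 < K" "0 < d"
    and "slot s K d k = slot s K d k'"
  shows "k = k'"
proof -
  have "k div K = k' div K"
    using assms slot_less[of s K d k k'] slot_less[of s K d k' k] by (metis less_irrefl linorder_neqE_nat)
  moreover from this have "k mod K = k' mod K" using assms by (simp add: slot_def)
  ultimately show ?thesis by (metis div_mult_mod_eq)
qed

text \<open>The array inverts \<open>slot\<close>. A slot that belongs to no element of a wide group
  holds an unspecified value of \<open>v\<close>, so a bound on the entries has to hold for
  \<open>v\<close> everywhere.\<close>

definition explicit_slots :: "(nat \<Rightarrow> nat) \<Rightarrow> nat \<Rightarrow> nat \<Rightarrow> (nat \<Rightarrow> nat) \<Rightarrow> nat \<Rightarrow> nat" where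
  "explicit_slots s K d v i = v (THE k. wide s K d (k div K) \<and> slot s K d k = i)"

lemma explicit_slots_slot:
  assumes "mono s" "wide s K d (k div K)" "0 < K" "0 < d"
  shows "explicit_slots s K d v (slot s K d k) = v k"
proof -
  have "(THE k'. wide s K d (k' div K) \<and> slot s K d k' = slot s K d k) = k"
    using assms slot_inject[OF assms(1)] by (intro the_equality) auto
  then show ?thesis by (simp add: explicit_slots_def)
qed

section \<open>Window tables and sampled directories\<close>

definition rank_table :: "nat \<Rightarrow> nat list" where
  "rank_table b = map (\<lambda>i. card {t. t < i mod b \<and> bit (i div b) t}) [0..<2 ^ b * b]"

text \<open>As in the table for ranks, a window of \<open>b\<close> bits and an argument below
  \<open>b\<close> are combined into the single index \<open>window * b + argument\<close>.\<close>

definition select_table :: "bool \<Rightarrow> nat \<Rightarrow> nat list" where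
  "select_table c b =
     map (\<lambda>i. LEAST t. b \<le> t \<or> i mod b < card {u. u \<le> t \<and> bit (i div b) u = c}) [0..<2 ^ b * b]"

definition bit_fun :: "bool list \<Rightarrow> nat \<Rightarrow> bool" where
  "bit_fun B p \<longleftrightarrow> p < length B \<and> B ! p"

definition rank_super :: "nat \<Rightarrow> bool list \<Rightarrow> nat list" where
  "rank_super b B = map (\<lambda>i. bit_rank True B (i * (b * b))) [0..<length B div (b * b) + 1]"

text \<open>A superblock consists of \<open>b\<close> blocks of \<open>b\<close> bits, so counts
  relative to its start stay below \<open>b * b\<close> and fit into \<open>f\<close> bits.\<close>

definition rank_block :: "nat \<Rightarrow> nat \<Rightarrow> bool list \<Rightarrow> nat list" where
  "rank_block f b B = map (\<lambda>i. take_bit f (bit_rank True B (i * b) - bit_rank True B (i div b * (b * b))))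
     [0..<length B div b + 1]"

text \<open>The width of group \<open>g\<close> is read off entries \<open>g\<close> and
  \<open>g + 1\<close>; the two extra entries keep \<open>g + 1\<close> in range for every
  element.\<close>

definition select_super :: "nat \<Rightarrow> bool \<Rightarrow> bool list \<Rightarrow> nat list" where
  "select_super K1 c B = map (\<lambda>g. bit_select c B (g * K1)) [0..<length B div K1 + 2]"

definition select_super_explicit :: "nat \<Rightarrow> bool \<Rightarrow> bool list \<Rightarrow> nat list" where
  "select_super_explicit K1 c B =
     map (explicit_slots (bit_select c B) K1 K1 (bit_select c B)) [0..<length B div K1 + K1 + 1]"

text \<open>Offsets from the start of the enclosing group of \<open>K1\<close> elements exceed
  \<open>f\<close> bits only if that group is wide; they are then truncated, and the query takes the
  explicit list instead.\<close>

definition select_block :: "nat \<Rightarrow> nat \<Rightarrow> nat \<Rightarrow> bool \<Rightarrow> bool list \<Rightarrow> nat list" where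
  "select_block f K1 K2 c B = map (\<lambda>q. take_bit f (bit_select c B (q * K2) - bit_select c B (q * K2 div K1 * K1)))
     [0..<length B div K2 + 1]"

definition select_block_explicit :: "nat \<Rightarrow> nat \<Rightarrow> nat \<Rightarrow> bool \<Rightarrow> bool list \<Rightarrow> nat list" where
  "select_block_explicit f K1 K2 c B =
     map (explicit_slots (bit_select c B) K2 K2 (\<lambda>k. take_bit f (bit_select c B k - bit_select c B (k div K1 * K1))))
       [0..<length B div K2 + K2 + 1]"

definition pack_fields :: "nat \<Rightarrow> nat \<Rightarrow> nat list \<Rightarrow> nat list" where
  "pack_fields w k xs = pack w (length xs * k) (field_bits k xs)"

text \<open>Words 1 to 6 hold the parameters, word 7 the root of the search tree.  Words 8 to 34 hold the
  addresses of the bit vector and the rank directory (8--11), the directories for selecting zeros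
  (12--16) and ones (17--21), the node arrays (22--30) and the run arrays (31--34).\<close>

abbreviation "word_b \<equiv> Data (Const 1)"
abbreviation "word_K2 \<equiv> Data (Const 2)"
abbreviation "word_K1 \<equiv> Data (Const 3)"
abbreviation "word_f \<equiv> Data (Const 4)"
abbreviation "word_bb \<equiv> Data (Const 5)"
abbreviation "word_KK \<equiv> Data (Const 6)"

section \<open>Query expressions for rank and select, and their values\<close>

definition rank_expr :: "expr \<Rightarrow> expr" where
  "rank_expr p = Bin Add
     (Bin Add (arr 9 (Bin Div p word_bb)) (read_bits 10 (Bin Mul (Bin Div p word_b) word_f) word_f))
     (arr 11 (Bin Add (Bin Mul (read_bits 8 (Bin Mul (Bin Div p word_b) word_b) word_b) word_b)
                      (Bin Mod p word_b)))"

definition select_start :: "nat \<Rightarrow> expr \<Rightarrow> expr" where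
  "select_start h k = Bin Add (arr h (Bin Div k word_K1))
      (read_bits (h + 2) (Bin Mul (Bin Div k word_K2) word_f) word_f)"

definition select_offset :: "nat \<Rightarrow> expr \<Rightarrow> expr" where
  "select_offset h k = arr (h + 4)
      (Bin Add (Bin Mul (read_bits 8 (select_start h k) word_b) word_b) (Bin Mod k word_K2))"

text \<open>A group of \<open>K1\<close> elements spanning at least \<open>K1 * K1\<close> bits is listed explicitly.  Otherwise
  the window at the start of the smaller group of \<open>K2\<close> elements is searched; the table entry
  \<open>b\<close> says that the element lies beyond the window, and then this group is listed explicitly.\<close>

definition select_prog :: "nat \<Rightarrow> nat \<Rightarrow> expr \<Rightarrow> prog" where
  "select_prog h r k =
     Cond (Bin Less (Bin Sub (arr h (Bin Add (Bin Div k word_K1) (Const 1))) (arr h (Bin Div k word_K1)))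
             word_KK)
       (Cond (Bin Less (select_offset h k) word_b)
         (Assign r (Bin Add (select_start h k) (select_offset h k)))
         (Assign r (Bin Add (arr h (Bin Div k word_K1))
            (read_bits (h + 3)
              (Bin Mul (Bin Add (Bin Div (select_start h k) word_K2) (Bin Mod k word_K2)) word_f) word_f))))
       (Assign r (arr (h + 1) (Bin Add (Bin Div (arr h (Bin Div k word_K1)) word_K1) (Bin Mod k word_K1))))"

definition select_base :: "bool \<Rightarrow> nat" where
  "select_base c = (if c then 17 else 12)"

locale rank_select = ram +
  fixes b f K1 K2 :: nat and B :: "bool list"
  assumes D_scalars: "7 \<le> length D" "D ! 1 = b" "D ! 2 = K2" "D ! 3 = K1" "D ! 4 = f" "D ! 5 = b * b"
      "D ! 6 = K1 * K1"
    and K2: "K2 = f * f" and K1: "K1 = b * K2" and K2_le: "K2 * K2 \<le> b"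
    and b3: "b * b * b \<le> 2 ^ f" and f_pos: "1 \<le> f" and b_less: "b < w"
    and addr: "2 * (length B + b) < 2 ^ w"
    and stored_bits: "stored 8 (pack w (length B + b) (bit_fun B))"
    and stored_rank: "stored 9 (rank_super b B)" "stored 10 (pack_fields w f (rank_block f b B))"
      "stored 11 (rank_table b)"
    and stored_select: "\<And>c. stored (select_base c) (select_super K1 c B)"
      "\<And>c. stored (select_base c + 1) (select_super_explicit K1 c B)"
      "\<And>c. stored (select_base c + 2) (pack_fields w f (select_block f K1 K2 c B))"
      "\<And>c. stored (select_base c + 3) (pack_fields w f (select_block_explicit f K1 K2 c B))"
      "\<And>c. stored (select_base c + 4) (select_table c b)"
begin

abbreviation "m \<equiv> length B"

lemma pos: "0 < f" "0 < K2" "0 < b" "0 < K1" "f \<le> K2" "K2 \<le> b" "f \<le> b" "f < w" "f * K2 \<le> b"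
proof -
  show "0 < f" using f_pos by simp
  then show k: "0 < K2" "f \<le> K2" using K2 by auto
  have "K2 \<le> K2 * K2" using k by simp
  then show "0 < b" "K2 \<le> b" using k K2_le by linarith+
  then show "0 < K1" "f \<le> b" using K1 k by auto
  then show "f < w" using b_less by simp
  have "f * K2 \<le> K2 * K2" using k by (intro mult_right_mono) auto
  from order_trans[OF this K2_le] show "f * K2 \<le> b" .
qed

lemma addr': "m + b < 2 ^ w"
  using addr by simp

lemma val_scalars:
  "val s word_b = b" "val s word_K2 = K2" "val s word_K1 = K1" "val s word_f = f"
  "val s word_bb = b * b" "val s word_KK = K1 * K1"
  using D_scalars val_data_const[of _ s] by (auto simp del: eval_expr.simps)

lemma KK_le: "K1 * K1 \<le> 2 ^ f"
proof -
  have "K1 * K1 = b * b * (K2 * K2)" by (simp add: K1)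
  also have "\<dots> \<le> b * b * b" using K2_le by (intro mult_left_mono) auto
  finally show ?thesis using b3 by simp
qed

lemma val_fields:
  assumes "stored h (pack_fields w f xs)" "val s ie = i" "i < length xs" "xs ! i < 2 ^ f" "i * f < 2 ^ w"
  shows "val s (read_bits h (Bin Mul ie word_f) word_f) = xs ! i"
  using assms pos val_field[of h xs f s "Bin Mul ie word_f" i word_f] val_scalars val_mul[OF assms(2) val_scalars(4)]
  by (simp add: pack_fields_def del: eval_expr.simps)

text \<open>\<open>B\<close> is stored with \<open>b\<close> padding zeros, so a window may start at
  any position up to the end of \<open>B\<close>.\<close>

lemma val_window_entry:
  assumes "stored h (map g [0..<2 ^ b * b])" "val s pe = p" "p \<le> m" "val s je = j" "j < b"
  shows "val s (arr h (Bin Add (Bin Mul (read_bits 8 pe word_b) word_b) je)) =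
    g (bits_at (bit_fun B) p b * b + j)"
proof -
  let ?W = "bits_at (bit_fun B) p b"
  have W: "val s (read_bits 8 pe word_b) = ?W"
    using assms b_less addr by (intro val_read_bits[OF stored_bits _ val_scalars(1)]) auto
  have "?W + 1 \<le> 2 ^ b" using bits_at_less[of "bit_fun B" p b] by simp
  then have "(?W + 1) * b \<le> 2 ^ b * b" by (rule mult_right_mono) simp
  then have i: "?W * b + j < 2 ^ b * b" using assms(5) by (simp add: algebra_simps)
  moreover have "2 ^ b * b < 2 ^ w" using stored_length[OF assms(1)] by simp
  ultimately have lt: "?W * b + j < 2 ^ w" by simp
  have "val s (Bin Add (Bin Mul (read_bits 8 pe word_b) word_b) je) = ?W * b + j"
    by (rule val_add[OF val_mul[OF W val_scalars(1)] assms(4)]) (use lt in auto)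
  from val_arr[OF assms(1) this] i show ?thesis by simp
qed

lemma val_rank:
  assumes p: "val s pe = p" "p < m"
  shows "val s (rank_expr pe) = bit_rank True B p"
proof -
  have lim: "p < 2 ^ w" using p addr by simp
  define p0 where "p0 = p div b * b"
  have p0: "p0 + p mod b = p" "p0 \<le> p" unfolding p0_def by (auto simp: div_mult_mod_eq)
  have r: "p mod b < b" using pos by simp
  have d: "val s (Bin Div pe word_b) = p div b" by (rule val_div[OF p(1) val_scalars(1) lim])
  have "val s (arr 9 (Bin Div pe word_bb)) = rank_super b B ! (p div (b * b))"
    using p div_le_mono[of p m "b * b"]
    by (intro val_arr[OF stored_rank(1) val_div[OF p(1) val_scalars(5) lim]]) (auto simp: rank_super_def)
  also have "\<dots> = bit_rank True B (p div (b * b) * (b * b))"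
    using p div_le_mono[of p m "b * b"] by (subst rank_super_def, subst nth_map) (auto simp del: upt_Suc)
  finally have 1: "val s (arr 9 (Bin Div pe word_bb)) = bit_rank True B (p div (b * b) * (b * b))" .
  have i: "p div b < m div b + 1" using p div_le_mono[of p m b] by simp
  have rb: "rank_block f b B ! (p div b) =
    take_bit f (bit_rank True B p0 - bit_rank True B (p div (b * b) * (b * b)))"
    using i by (subst rank_block_def, subst nth_map) (auto simp: div_mult2_eq p0_def simp del: upt_Suc)
  have "p div b * f \<le> p div b * b" using pos by (intro mult_left_mono) auto
  also have "\<dots> \<le> p" by simp
  finally have "p div b * f < 2 ^ w" using lim by simp
  then have 2: "val s (read_bits 10 (Bin Mul (Bin Div pe word_b) word_f) word_f) = rank_block f b B ! (p div b)"
    using i rb by (intro val_fields[OF stored_rank(2) d]) (auto simp: rank_block_def)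
  have sup: "p div (b * b) * (b * b) \<le> p0"
  proof -
    have "p div (b * b) * (b * b) = p div b div b * b * b" by (simp add: div_mult2_eq)
    also have "\<dots> \<le> p div b * b" by (intro mult_right_mono) auto
    finally show ?thesis by (simp add: p0_def)
  qed
  \<comment> \<open>The block boundary \<open>p0\<close> lies less than \<open>b * b\<close> after
    the start of the superblock, so truncation to \<open>f\<close> bits has not changed the stored
    count.\<close>
  have "p0 < p div (b * b) * (b * b) + b * b"
    using p0 div_mult_mod_eq[of p "b * b"] mod_less_divisor[of "b * b" p] pos(3)
    by (simp del: mod_less_divisor)
  moreover have "bit_rank True B p0 \<le> bit_rank True B (p div (b * b) * (b * b)) + (p0 - p div (b * b) * (b * b))"
    using bit_rank_add_le[of True B "p div (b * b) * (b * b)" "p0 - p div (b * b) * (b * b)"] sup by simp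
  moreover have "b * b \<le> 2 ^ f"
    using order_trans[OF _ b3, of "b * b"] pos(3) by simp
  ultimately have "bit_rank True B p0 - bit_rank True B (p div (b * b) * (b * b)) < 2 ^ f"
    using sup by linarith
  then have rb': "rank_block f b B ! (p div b) + bit_rank True B (p div (b * b) * (b * b)) = bit_rank True B p0"
    using rb bit_rank_mono[OF sup] by (simp add: take_bit_nat_eq_self)
  have pm: "val s (Bin Mod pe word_b) = p mod b" by (rule val_mod[OF p(1) val_scalars(1) lim])
  have p0m: "val s (Bin Mul (Bin Div pe word_b) word_b) = p0"
    unfolding p0_def by (rule val_mul[OF d val_scalars(1)]) (use lim p0 in \<open>auto simp: p0_def[symmetric]\<close>)
  have st: "val s (arr 11 (Bin Add (Bin Mul (read_bits 8 (Bin Mul (Bin Div pe word_b) word_b) word_b) word_b)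
       (Bin Mod pe word_b))) = card {t. t < p mod b \<and> bit (bits_at (bit_fun B) p0 b) t}"
    by (subst val_window_entry[OF stored_rank(3)[unfolded rank_table_def] p0m _ pm r])
      (use r p p0 in auto)
  have "card {t. t < p mod b \<and> bit (bits_at (bit_fun B) p0 b) t} + bit_rank True B p0 = bit_rank True B (p0 + p mod b)"
    unfolding bit_rank_add using r by (auto simp: bit_bits_at bit_fun_def intro!: arg_cong[where f = card])
  with p0(1) have w: "card {t. t < p mod b \<and> bit (bits_at (bit_fun B) p0 b) t} + bit_rank True B p0 = bit_rank True B p"
    by simp
  have lim2: "bit_rank True B p < 2 ^ w" using bit_rank_le_length[of True B p] addr' by linarith
  have "val s (Bin Add (arr 9 (Bin Div pe word_bb)) (read_bits 10 (Bin Mul (Bin Div pe word_b) word_f) word_f)) = bit_rank True B p0"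
    using val_add[OF 1 2] rb' w lim2 by simp
  from val_add[OF this st] show ?thesis unfolding rank_expr_def using w lim2 by simp
qed

lemma val_bit:
  assumes p: "val s pe = p" "p < m"
  shows "val s (read_bits 8 pe (Const 1)) = of_bool (B ! p)"
proof -
  have "val s (read_bits 8 pe (Const 1)) = bits_at (bit_fun B) p 1"
    using p addr pos w_ge one_less by (intro val_read_bits[OF stored_bits p(1) val_const]) auto
  also have "\<dots> = of_bool (B ! p)" using p by (simp add: bits_at_def bit_fun_def)
  finally show ?thesis .
qed

text \<open>The argument is given as the rank of a known position \<open>p\<close> with bit
  \<open>c\<close>, since the climb always asks for an element that exists. A stored width decides
  between the explicit list of the large group and the rest; the window table then decides between
  window and explicit list of the small group.\<close>

lemma sem_select:
  assumes ke: "val s ke = bit_rank c B p" and p: "p < m" "B ! p = c"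
  shows "sem w D (select_prog (select_base c) r ke) s = ((fst s)(r := p), snd s)"
proof -
  define k where "k = bit_rank c B p"
  define g q j where "g = k div K1" and "q = k div K2" and "j = k mod K2"
  define h where "h = select_base c"
  note ke = ke[folded k_def]
  have kp: "k \<le> p" unfolding k_def by (rule bit_rank_le)
  then have lim: "k < 2 ^ w" using p addr by simp
  have sk: "bit_select c B k = p" unfolding k_def using p by (rule bit_select_bit_rank)
  have mono: "bit_select c B x \<le> bit_select c B y" if "x \<le> y" for x y using bit_select_mono that by (rule monoD)
  have gq0: "g = q div b" unfolding g_def q_def K1 by (simp add: div_mult2_eq mult.commute[of b])
  have gk: "g * K1 \<le> k" "k < (g + 1) * K1" "q * K2 + j = k" "j < K2" "q * K2 \<le> k"
  proof -
    show "g * K1 \<le> k" "q * K2 \<le> k" "q * K2 + j = k" unfolding g_def q_def j_def by simp_all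
    show "j < K2" unfolding j_def using pos by simp
    show "k < (g + 1) * K1" unfolding g_def using dividend_less_div_times[of K1 k] pos by simp
  qed
  have gq: "q * K2 div K1 = g"
    using pos unfolding gq0 K1 by (simp add: mult.commute[of b])
  have jb: "j < b" using gk pos by simp
  have gm: "g \<le> m div K1" "q \<le> m div K2" unfolding g_def q_def using kp p by (auto intro: div_le_mono)
  have vg: "val s (Bin Div ke word_K1) = g" unfolding g_def by (rule val_div[OF ke val_scalars(3) lim])
  have vq: "val s (Bin Div ke word_K2) = q" unfolding q_def by (rule val_div[OF ke val_scalars(2) lim])
  have vj: "val s (Bin Mod ke word_K2) = j" unfolding j_def by (rule val_mod[OF ke val_scalars(2) lim])
  define G where "G = bit_select c B (g * K1)"
  have vG: "val s (arr h (Bin Div ke word_K1)) = G"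
    unfolding h_def using val_arr[OF stored_select(1) vg] gm
    by (simp add: select_super_def G_def del: upt_Suc)
  have vg1: "val s (Bin Add (Bin Div ke word_K1) (Const 1)) = g + 1"
    using stored_length[OF stored_select(1)[of c]] gm one_less
    by (intro val_add[OF vg val_const]) (auto simp: select_super_def)
  have vG1: "val s (arr h (Bin Add (Bin Div ke word_K1) (Const 1))) = bit_select c B ((g + 1) * K1)"
    unfolding h_def using val_arr[OF stored_select(1) vg1] gm
    by (simp add: select_super_def del: upt_Suc)
  have Gp: "G \<le> p" using mono[OF gk(1)] sk by (simp add: G_def)
  have pG1: "p \<le> bit_select c B ((g + 1) * K1)" using mono[of k "(g + 1) * K1"] gk sk by simp
  have G1: "bit_select c B ((g + 1) * K1) < 2 ^ w" using bit_select_le[of c B "(g + 1) * K1"] addr by simp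
  have cond: "val s (Bin Less (Bin Sub (arr h (Bin Add (Bin Div ke word_K1) (Const 1)))
      (arr h (Bin Div ke word_K1))) word_KK) = of_bool (bit_select c B ((g + 1) * K1) - G < K1 * K1)"
    by (rule val_less[OF val_sub[OF vG1 vG G1] val_scalars(6)]) (use Gp pG1 in simp)
  show ?thesis
  proof (cases "bit_select c B ((g + 1) * K1) - G < K1 * K1")
    case False
    then have wd: "wide (bit_select c B) K1 K1 (k div K1)"
      using Gp pG1 by (simp add: wide_def G_def g_def)
    have vkm: "val s (Bin Mod ke word_K1) = k mod K1" by (rule val_mod[OF ke val_scalars(3) lim])
    have vGd: "val s (Bin Div (arr h (Bin Div ke word_K1)) word_K1) = G div K1"
      using Gp p addr by (intro val_div[OF vG val_scalars(3)]) simp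
    have sl: "slot (bit_select c B) K1 K1 k = G div K1 + k mod K1" by (simp add: slot_def G_def g_def)
    have "G div K1 \<le> m div K1" using Gp p by (intro div_le_mono) simp
    moreover have "k mod K1 < K1" using pos by simp
    ultimately have i: "G div K1 + k mod K1 < length (select_super_explicit K1 c B)"
      by (simp add: select_super_explicit_def)
    have vi: "val s (Bin Add (Bin Div (arr h (Bin Div ke word_K1)) word_K1) (Bin Mod ke word_K1)) = G div K1 + k mod K1"
      using i stored_length[OF stored_select(2)[of c]] by (intro val_add[OF vGd vkm]) simp
    have "val s (arr (h + 1) (Bin Add (Bin Div (arr h (Bin Div ke word_K1)) word_K1) (Bin Mod ke word_K1))) = 
        select_super_explicit K1 c B ! (G div K1 + k mod K1)"
      unfolding h_def by (rule val_arr[OF stored_select(2) vi[unfolded h_def] i])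
    also have "\<dots> = explicit_slots (bit_select c B) K1 K1 (bit_select c B) (slot (bit_select c B) K1 K1 k)"
      using i unfolding sl select_super_explicit_def by (subst nth_map) (auto simp del: upt_Suc)
    also have "\<dots> = p" using explicit_slots_slot[OF bit_select_mono wd pos(4) pos(4)] sk by simp
    finally show ?thesis using cond False
      by (simp add: select_prog_def h_def[symmetric] del: eval_expr.simps)
  next
    case True
    define s2 where "s2 = bit_select c B (q * K2)"
    have s2p: "s2 \<le> p" using mono[OF gk(5)] sk by (simp add: s2_def)
    have Gs2: "G \<le> s2" using mono[of "g * K1" "q * K2"] gq div_times_less_eq_dividend[of "q * K2" K1]
      by (simp add: s2_def G_def)
    \<comment> \<open>The group of \<open>K1\<close> elements is narrow, so the offset from its
      start fits into an \<open>f\<close>-bit field.\<close>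
    have near: "p - G < 2 ^ f" using True pG1 KK_le by linarith
    have "q * f \<le> q * K2" using pos by (intro mult_left_mono) auto
    then have ql: "q * f < 2 ^ w" using gk lim by linarith
    have sb: "select_block f K1 K2 c B ! q = s2 - G"
      using gm near s2p unfolding select_block_def
      by (subst nth_map) (auto simp: gq s2_def G_def take_bit_nat_eq_self simp del: upt_Suc)
    have "val s (read_bits (h + 2) (Bin Mul (Bin Div ke word_K2) word_f) word_f) = select_block f K1 K2 c B ! q"
      unfolding h_def using gm near s2p ql sb
      by (intro val_fields[OF stored_select(3) vq]) (simp_all add: select_block_def del: upt_Suc)
    then have vs2: "val s (select_start h ke) = s2"
      unfolding select_start_def using Gs2 s2p p addr by (subst val_add[OF vG]) (auto simp: sb simp del: eval_expr.simps)
    let ?W = "bits_at (bit_fun B) s2 b"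
    define T where "T = (LEAST t. b \<le> t \<or> j < card {u. u \<le> t \<and> bit ?W u = c})"
    have vT: "val s (select_offset h ke) = T"
      unfolding select_offset_def h_def T_def
      by (subst val_window_entry[OF stored_select(5)[unfolded select_table_def] vs2[unfolded h_def] _ vj jb])
        (use s2p p jb in auto)
    have cs2: "bit_rank c B s2 = q * K2"
    proof -
      have "k < bit_rank c B (Suc p)" using p by (simp add: bit_rank_Suc k_def)
      also have "\<dots> \<le> bit_rank c B m" using p by (intro bit_rank_mono) simp
      finally show ?thesis unfolding s2_def using gk by (intro bit_rank_bit_select) simp
    qed
    \<comment> \<open>Only offsets up to \<open>p\<close> are covered: beyond the end of
      \<open>B\<close> the window is padded with zeros, which would be counted as elements for
      \<open>c = False\<close>.\<close>
    have win: "q * K2 + card {u. u \<le> t \<and> bit ?W u = c} = bit_rank c B (Suc (s2 + t))" if "s2 + t \<le> p" "t < b" for t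
    proof -
      have "{u. u \<le> t \<and> bit ?W u = c} = {u. u < Suc t \<and> s2 + u < m \<and> B ! (s2 + u) = c}"
        using that p by (auto simp: bit_bits_at bit_fun_def)
      then show ?thesis using bit_rank_add[of c B s2 "Suc t"] cs2 by simp
    qed
    have small: "\<not> j < card {u. u \<le> t \<and> bit ?W u = c}" if "s2 + t < p" "t < b" for t
    proof -
      have "bit_rank c B (Suc (s2 + t)) \<le> k" unfolding k_def using that by (intro bit_rank_mono) simp
      then show ?thesis using win[of t] that gk(3) by simp
    qed
    have vcond: "val s (Bin Less (select_offset h ke) word_b) = of_bool (T < b)"
      by (rule val_less[OF vT val_scalars(1)])
    show ?thesis
    proof (cases "p - s2 < b")
      case near2: True
      have "T = p - s2" unfolding T_def
      proof (rule Least_equality)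
        have "bit_rank c B (Suc p) = k + 1" using p by (simp add: bit_rank_Suc k_def)
        then show "b \<le> p - s2 \<or> j < card {u. u \<le> p - s2 \<and> bit ?W u = c}"
          using win[of "p - s2"] near2 s2p gk(3) by simp
      next
        fix t assume "b \<le> t \<or> j < card {u. u \<le> t \<and> bit ?W u = c}"
        then show "p - s2 \<le> t" using small[of t] near2 by (cases "t < b"; cases "s2 + t < p") auto
      qed
      moreover have "val s (Bin Add (select_start h ke) (select_offset h ke)) = s2 + T"
        by (rule val_add[OF vs2 vT]) (use calculation s2p p addr in auto)
      ultimately show ?thesis using cond True vcond near2 s2p
        by (simp add: select_prog_def h_def[symmetric] del: eval_expr.simps)
    next
      case far: False
      have "T = b" unfolding T_def
      proof (rule Least_equality)
        fix t assume "b \<le> t \<or> j < card {u. u \<le> t \<and> bit ?W u = c}"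
        then show "b \<le> t" using small[of t] far by (cases "t < b") auto
      qed simp
      \<comment> \<open>No width is tested for the small group: missing the window already means
        \<open>p - s2 \<ge> b \<ge> K2 * K2\<close>, so the group is wide and its slots are
        valid.\<close>
      have "p \<le> bit_select c B ((q + 1) * K2)" using mono[of k "(q + 1) * K2"] gk sk by simp
      then have wd: "wide (bit_select c B) K2 K2 (k div K2)"
        using far K2_le s2p by (simp add: wide_def s2_def q_def)
      have sl: "slot (bit_select c B) K2 K2 k = s2 div K2 + j" by (simp add: slot_def s2_def q_def j_def)
      let ?xs = "select_block_explicit f K1 K2 c B"
      have "s2 div K2 \<le> m div K2" using s2p p by (intro div_le_mono) simp
      then have i: "s2 div K2 + j < length ?xs"
        using gk by (simp add: select_block_explicit_def)
      have xs: "?xs ! (s2 div K2 + j) = p - G"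
      proof -
        have "?xs ! (s2 div K2 + j) = explicit_slots (bit_select c B) K2 K2 (\<lambda>k. take_bit f (bit_select c B k - bit_select c B (k div K1 * K1))) (slot (bit_select c B) K2 K2 k)"
          using i unfolding sl select_block_explicit_def by (subst nth_map) (auto simp del: upt_Suc)
        also have "\<dots> = p - G"
          using explicit_slots_slot[OF bit_select_mono wd pos(2) pos(2)] sk near by (simp add: G_def g_def take_bit_nat_eq_self)
        finally show ?thesis .
      qed
      have vd: "val s (Bin Div (select_start h ke) word_K2) = s2 div K2"
        using s2p p addr by (intro val_div[OF vs2 val_scalars(2)]) simp
      have vi: "val s (Bin Add (Bin Div (select_start h ke) word_K2) (Bin Mod ke word_K2)) = s2 div K2 + j"
        using i stored_length[OF stored_select(4)[of c]] s2p p(1) addr' gk(4) pos(6) div_le_dividend[of s2 K2]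
        by (intro val_add[OF vd vj]) linarith
      \<comment> \<open>The bit address of the slot must itself be a word; \<open>f \<le> K2\<close>
        and \<open>f * K2 \<le> b\<close> bound it by \<open>s2 + b\<close>.\<close>
      have "(s2 div K2 + j) * f \<le> s2 div K2 * K2 + K2 * f"
        using gk pos unfolding add_mult_distrib by (intro add_mono mult_mono) auto
      also have "\<dots> \<le> s2 + b"
        using pos(9) by (intro add_mono) (auto simp: mult.commute)
      finally have lim': "(s2 div K2 + j) * f < 2 ^ w" using s2p p(1) addr' by linarith
      have "val s (read_bits (h + 3)
              (Bin Mul (Bin Add (Bin Div (select_start h ke) word_K2) (Bin Mod ke word_K2)) word_f) word_f) = ?xs ! (s2 div K2 + j)"
        unfolding h_def using i xs near lim'
        by (intro val_fields[OF stored_select(4) vi[unfolded h_def]]) auto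
      then have "val s (Bin Add (arr h (Bin Div ke word_K1))
            (read_bits (h + 3)
              (Bin Mul (Bin Add (Bin Div (select_start h ke) word_K2) (Bin Mod ke word_K2)) word_f) word_f)) = p"
        using xs Gp p addr by (subst val_add[OF vG]) (auto simp del: eval_expr.simps)
      then show ?thesis using cond True vcond \<open>T = b\<close>
        by (simp add: select_prog_def h_def[symmetric] del: eval_expr.simps)
    qed
  qed
qed

end

section \<open>Merge trees\<close>

datatype mtree = Lf nat | Nd mtree mtree

fun leaves :: "mtree \<Rightarrow> nat set" where
  "leaves (Lf a) = {a}"
| "leaves (Nd l r) = leaves l \<union> leaves r"

fun distinct_leaves :: "mtree \<Rightarrow> bool" where
  "distinct_leaves (Lf a) = True"
| "distinct_leaves (Nd l r) = (distinct_leaves l \<and> distinct_leaves r \<and> leaves l \<inter> leaves r = {})"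

fun leaf_depth :: "mtree \<Rightarrow> nat \<Rightarrow> nat" where
  "leaf_depth (Lf a) x = 0"
| "leaf_depth (Nd l r) x = Suc (if x \<in> leaves l then leaf_depth l x else leaf_depth r x)"

fun subtree_list :: "mtree \<Rightarrow> mtree list" where
  "subtree_list (Lf a) = [Lf a]"
| "subtree_list (Nd l r) = Nd l r # subtree_list l @ subtree_list r"

lemma finite_leaves [simp]: "finite (leaves t)"
  by (induction t) auto

lemma leaves_nonempty: "leaves t \<noteq> {}"
  by (induction t) auto

text \<open>Greedily collecting the heaviest elements first hits \<open>2 ^ - e\<close> exactly, because all
  partial sums are multiples of the last weight added.\<close>

lemma kraft_fill:
  fixes len :: "nat \<Rightarrow> nat"
  assumes "finite A" "\<And>a. a \<in> A \<Longrightarrow> e \<le> len a"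
  shows "\<exists>A'\<subseteq>A. (\<Sum>a\<in>A'. (1/2::real) ^ len a) \<le> (1/2) ^ e \<and> (A' = A \<or> (\<Sum>a\<in>A'. (1/2::real) ^ len a) = (1/2) ^ e)"
  using assms
proof (induction rule: finite_ranking_induct[where f = len])
  case empty
  then show ?case by simp
next
  case (insert x S)
  obtain A' where A': "A' \<subseteq> S" "(\<Sum>a\<in>A'. (1/2::real) ^ len a) \<le> (1/2) ^ e"
      "A' = S \<or> (\<Sum>a\<in>A'. (1/2::real) ^ len a) = (1/2) ^ e"
    using insert by auto
  show ?case
  proof (cases "(\<Sum>a\<in>A'. (1/2::real) ^ len a) = (1/2) ^ e \<or> x \<in> S")
    case True
    then show ?thesis using A' by (intro exI[of _ A']) auto
  next
    case False
    then have lt: "(\<Sum>a\<in>S. (1/2::real) ^ len a) < (1/2) ^ e" and "x \<notin> S" using A' by auto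
    \<comment> \<open>Elements enter in the order of \<open>len\<close>, so \<open>len x\<close> is
      the largest length so far. Multiplying by \<open>2 ^ len x\<close> turns all terms into
      integers, and a strict inequality of integers leaves room for the term of
      \<open>x\<close>.\<close>
    have pw: "(1/2::real) ^ k * 2 ^ len x = real (2 ^ (len x - k))" if "k \<le> len x" for k
    proof -
      have "2 ^ len x = (2::real) ^ (len x - k) * 2 ^ k" using that by (simp flip: power_add)
      then show ?thesis by (simp add: power_one_over)
    qed
    have "(\<Sum>a\<in>S. (1/2::real) ^ len a) * 2 ^ len x < (1/2) ^ e * 2 ^ len x"
      using lt by simp
    moreover have "(\<Sum>a\<in>S. (1/2::real) ^ len a) * 2 ^ len x = real (\<Sum>a\<in>S. 2 ^ (len x - len a))"
      unfolding sum_distrib_right of_nat_sum using insert pw by (intro sum.cong) auto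
    moreover have "(1/2::real) ^ e * 2 ^ len x = real (2 ^ (len x - e))"
      using insert pw by auto
    ultimately have "(\<Sum>a\<in>S. 2 ^ (len x - len a)) + 1 \<le> (2::nat) ^ (len x - e)"
      by (metis Suc_eq_plus1 Suc_leI of_nat_less_iff)
    then have "real (\<Sum>a\<in>S. 2 ^ (len x - len a)) + 1 \<le> real (2 ^ (len x - e))"
      by (metis of_nat_1 of_nat_add of_nat_mono)
    then have "((\<Sum>a\<in>S. (1/2::real) ^ len a) + (1/2) ^ len x) * 2 ^ len x \<le> (1/2) ^ e * 2 ^ len x"
      using \<open>(\<Sum>a\<in>S. (1/2::real) ^ len a) * 2 ^ len x = _\<close> \<open>(1/2::real) ^ e * 2 ^ len x = _\<close>
      by (simp add: distrib_right power_one_over)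
    then have "(\<Sum>a\<in>S. (1/2::real) ^ len a) + (1/2) ^ len x \<le> (1/2) ^ e"
      by simp
    then show ?thesis using insert \<open>x \<notin> S\<close> by (intro exI[of _ "insert x S"]) (auto simp: add.commute)
  qed
qed

text \<open>The existence half of Kraft's inequality. The exponent \<open>d\<close> is the depth
  already used up: both parts of a split must have weight at most
  \<open>(1/2) ^ Suc d\<close>.\<close>

lemma kraft_tree:
  fixes len :: "nat \<Rightarrow> nat"
  assumes "finite A" "A \<noteq> {}" "(\<Sum>a\<in>A. (1/2::real) ^ len a) \<le> (1/2) ^ d"
  shows "\<exists>t. distinct_leaves t \<and> leaves t = A \<and> (\<forall>a\<in>A. leaf_depth t a + d \<le> len a)"
  using assms
proof (induction A arbitrary: d rule: finite_psubset_induct)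
  case (psubset A)
  have fin: "finite A" by fact
  show ?case
  proof (cases "\<exists>a. A = {a}")
    case True
    then obtain a where a: "A = {a}" by auto
    then have "d \<le> len a" using psubset.prems by simp
    then show ?thesis using a by (intro exI[of _ "Lf a"]) auto
  next
    case False
    let ?s = "\<lambda>A. \<Sum>a\<in>A. (1/2::real) ^ len a"
    have s_mono: "?s X \<le> ?s Y" if "X \<subseteq> Y" "Y \<subseteq> A" for X Y
      using that fin by (intro sum_mono2) (auto intro: finite_subset)
    \<comment> \<open>Two positive terms fit below \<open>(1/2) ^ d\<close> only if each of them is
      strictly smaller; this permits filling up to half of the budget.\<close>
    have big: "Suc d \<le> len a" if "a \<in> A" for a
    proof -
      have "\<exists>a'\<in>A. a' \<noteq> a"
      proof (rule ccontr)
        assume "\<not> ?thesis"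
        with that have "A = {a}" by (intro set_eqI) (metis singleton_iff)
        with False show False by metis
      qed
      then obtain a' where a': "a' \<in> A" "a' \<noteq> a" by blast
      have "(1/2::real) ^ len a < ?s {a, a'}" using a' by simp
      also have "\<dots> \<le> (1/2) ^ d" using s_mono[of "{a,a'}" A] that a'(1) psubset.prems(2) by (meson bot_least insert_subset order_refl order_trans)
      finally have "d < len a" by (simp add: power_strict_decreasing_iff)
      then show ?thesis by simp
    qed
    obtain A1 where A1: "A1 \<subseteq> A" "A1 \<noteq> {}" "A1 \<noteq> A" "?s A1 \<le> (1/2) ^ Suc d" "?s (A - A1) \<le> (1/2) ^ Suc d"
    proof -
      obtain A' where A': "A' \<subseteq> A" "?s A' \<le> (1/2) ^ Suc d" "A' = A \<or> ?s A' = (1/2) ^ Suc d"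
        using kraft_fill[OF fin, of "Suc d" len] big by blast
      \<comment> \<open>Either everything fits into half of the budget and any proper split will do,
        or one half is filled exactly and at most the other half remains.\<close>
      show thesis
      proof (cases "A' = A")
        case True
        obtain a where a: "a \<in> A" using psubset.prems by auto
        have le: "?s A \<le> (1/2) ^ Suc d" using A'(2) True by simp
        show thesis
        proof (rule that)
          show "{a} \<subseteq> A" "{a} \<noteq> {}" using a by simp_all
          show "{a} \<noteq> A" using False by metis
          have "?s {a} \<le> ?s A" by (rule s_mono) (use a in simp_all)
          with le show "?s {a} \<le> (1/2) ^ Suc d" by (rule order_trans[rotated])
          have "?s (A - {a}) \<le> ?s A" by (rule s_mono) simp_all
          with le show "?s (A - {a}) \<le> (1/2) ^ Suc d" by (rule order_trans[rotated])
        qed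
      next
        case F: False
        then have "?s A' = (1/2) ^ Suc d" using A' by simp
        moreover have "?s A = ?s A' + ?s (A - A')"
          using fin A' by (simp add: sum.subset_diff)
        moreover have "A' \<noteq> {}" using calculation by auto
        ultimately show thesis using that[of A'] F A' psubset.prems by simp
      qed
    qed
    obtain t1 where t1: "distinct_leaves t1" "leaves t1 = A1" "\<forall>a\<in>A1. leaf_depth t1 a + Suc d \<le> len a"
      using psubset.IH[of A1 "Suc d"] A1 by blast
    obtain t2 where t2: "distinct_leaves t2" "leaves t2 = A - A1" "\<forall>a\<in>A-A1. leaf_depth t2 a + Suc d \<le> len a"
      using psubset.IH[of "A - A1" "Suc d"] A1 by blast
    show ?thesis using t1 t2 A1 by (intro exI[of _ "Nd t1 t2"]) auto
  qed
qed

section \<open>Nodes represented by their subtrees\<close>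

lemma self_in_subtree_list: "s \<in> set (subtree_list s)"
  by (cases s) auto

lemma subtree_list_nth_0: "subtree_list t ! 0 = t" and subtree_list_nonempty [simp]: "subtree_list t \<noteq> []"
  by (cases t; simp)+

lemma subtree_list_leaves: "s \<in> set (subtree_list t) \<Longrightarrow> leaves s \<subseteq> leaves t"
  by (induction t) auto

lemma subtree_list_disjoint:
  assumes "leaves l \<inter> leaves r = {}" "s \<in> set (subtree_list l)"
  shows "s \<notin> set (subtree_list r)"
proof -
  obtain a where "a \<in> leaves s" using leaves_nonempty[of s] by blast
  then show ?thesis using assms subtree_list_leaves[of s l] subtree_list_leaves[of s r] by blast
qed

lemma subtree_list_distinct_leaves: "s \<in> set (subtree_list t) \<Longrightarrow> distinct_leaves t \<Longrightarrow> distinct_leaves s"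
  by (induction t) auto

lemma subtree_list_size: "s \<in> set (subtree_list t) \<Longrightarrow> size s \<le> size t"
  by (induction t) auto

lemma subtree_list_trans: "s \<in> set (subtree_list t) \<Longrightarrow> x \<in> set (subtree_list s) \<Longrightarrow> x \<in> set (subtree_list t)"
  by (induction t) auto

lemma subtree_list_children: 
  assumes "Nd l r \<in> set (subtree_list t)"
  shows "l \<in> set (subtree_list t)" "r \<in> set (subtree_list t)"
  using assms self_in_subtree_list by (auto intro: subtree_list_trans)

lemma leaf_in_subtree_list: "Lf a \<in> set (subtree_list t) \<longleftrightarrow> a \<in> leaves t"
  by (induction t) auto

lemma length_subtree_list: "distinct_leaves t \<Longrightarrow> length (subtree_list t) + 1 = 2 * card (leaves t)"
  by (induction t) (auto simp: card_Un_disjoint)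

text \<open>A node is represented by its subtree as a value, so equal subtrees at different places
  would be confused. Disjoint nonempty leaf sets rule this out between the two sides of a node, and
  sizes rule it out between a node and its descendants.\<close>

lemma distinct_subtree_list: "distinct_leaves t \<Longrightarrow> distinct (subtree_list t)"
proof (induction t)
  case (Nd l r)
  have "s \<notin> set (subtree_list r)" if "s \<in> set (subtree_list l)" for s
    using subtree_list_disjoint[OF _ that, of r] Nd.prems by auto
  moreover have "Nd l r \<notin> set (subtree_list l)" "Nd l r \<notin> set (subtree_list r)"
    using subtree_list_size[of "Nd l r"] by fastforce+
  ultimately show ?case using Nd by auto
qed simp

definition child :: "mtree \<Rightarrow> mtree \<Rightarrow> bool" where
  "child s p \<longleftrightarrow> (\<exists>l r. p = Nd l r \<and> (s = l \<or> s = r))"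

lemma child_size: "child s p \<Longrightarrow> size s < size p"
  by (auto simp: child_def)

lemma child_subtree_list: "child s p \<Longrightarrow> p \<in> set (subtree_list t) \<Longrightarrow> s \<in> set (subtree_list t)"
  by (auto simp: child_def dest: subtree_list_children)

text \<open>If the root is one parent and another lies inside a child of the root, then size
  excludes that \<open>s\<close> is this child, and disjointness of the leaves excludes that it is
  the sibling.\<close>

lemma child_unique:
  assumes "distinct_leaves t" "p \<in> set (subtree_list t)" "p' \<in> set (subtree_list t)" "child s p" "child s p'"
  shows "p = p'"
  using assms
proof (induction t)
  case (Lf a) then show ?case by (auto simp: child_def)
next
  case (Nd l r)
  have no: False if "child s (Nd l r)" "q \<in> set (subtree_list l) \<union> set (subtree_list r)" "child s q" for q
  proof -
    have sz: "size s < size q" using that(3) by (rule child_size)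
    have "s \<in> set (subtree_list l) \<union> set (subtree_list r)" using that child_subtree_list by blast
    have *: "x \<in> set (subtree_list l) \<Longrightarrow> x \<notin> set (subtree_list r)" for x
      using subtree_list_disjoint[of l r x] Nd.prems by auto
    show False using that sz * self_in_subtree_list[of l] self_in_subtree_list[of r] child_subtree_list[OF that(3)]
        subtree_list_size[of q l] subtree_list_size[of q r]
      by (auto simp: child_def)
  qed
  have two: False if "q \<in> set (subtree_list l)" "q' \<in> set (subtree_list r)" "child s q" "child s q'" for q q'
    using child_subtree_list[OF that(3,1)] child_subtree_list[OF that(4,2)] subtree_list_disjoint[of l r s] Nd.prems by auto
  show ?case using Nd no two by (simp only: subtree_list.simps list.set set_append insert_iff Un_iff distinct_leaves.simps) metis
qed

section \<open>Bit vectors at the nodes\<close>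

definition node_index :: "(nat \<Rightarrow> nat) \<Rightarrow> mtree \<Rightarrow> nat \<Rightarrow> nat" where
  "node_index rn s j = card {j'. j' < j \<and> rn j' \<in> leaves s}"

text \<open>Values occur in increasing order, so for a value \<open>j\<close> routed through node
  \<open>s\<close>, \<open>node_index rn s j\<close> is the place of its bit in the vector of
  \<open>s\<close>.\<close>

fun node_bits :: "nat \<Rightarrow> (nat \<Rightarrow> nat) \<Rightarrow> mtree \<Rightarrow> bool list" where
  "node_bits n rn (Lf a) = []"
| "node_bits n rn (Nd l r) = map (\<lambda>j. rn j \<in> leaves r) (filter (\<lambda>j. rn j \<in> leaves l \<union> leaves r) [0..<n])"

lemma length_filter_upt: "length (filter P [0..<j]) = card {j'. j' < j \<and> P j'}"
proof -
  have "length (filter P [0..<j]) = card (set (filter P [0..<j]))"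
    by (rule distinct_card[symmetric]) simp
  also have "set (filter P [0..<j]) = {j'. j' < j \<and> P j'}" by auto
  finally show ?thesis .
qed

lemma node_bits_split:
  assumes "j < n" "rn j \<in> leaves (Nd l r)"
  defines "xs \<equiv> filter (\<lambda>j. rn j \<in> leaves (Nd l r)) [0..<j]"
  shows "length xs = node_index rn (Nd l r) j"
    "\<exists>zs. node_bits n rn (Nd l r) = map (\<lambda>j. rn j \<in> leaves r) xs @ (rn j \<in> leaves r) # zs"
proof -
  show "length xs = node_index rn (Nd l r) j" by (simp add: xs_def length_filter_upt node_index_def)
  have "[0..<n] = [0..<j] @ j # [Suc j..<n]"
    using assms upt_add_eq_append[of 0 j "n - j"] by (simp add: upt_conv_Cons)
  then have "node_bits n rn (Nd l r) = map (\<lambda>j. rn j \<in> leaves r) xs @ (rn j \<in> leaves r) #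
     map (\<lambda>j. rn j \<in> leaves r) (filter (\<lambda>j. rn j \<in> leaves (Nd l r)) [Suc j..<n])"
    using assms(2) by (simp add: xs_def)
  then show "\<exists>zs. node_bits n rn (Nd l r) = map (\<lambda>j. rn j \<in> leaves r) xs @ (rn j \<in> leaves r) # zs"
    by blast
qed

text \<open>The step of a wavelet tree: among the values before \<open>j\<close> at the node, those
  with bit \<open>True\<close> are the ones before \<open>j\<close> in the right child. So rank
  leads from the index at a node to the index at a child, and select leads back.\<close>

lemma node_bits_nth:
  assumes "j < n" "rn j \<in> leaves (Nd l r)" "leaves l \<inter> leaves r = {}"
  defines "x \<equiv> node_index rn (Nd l r) j" and "Bs \<equiv> node_bits n rn (Nd l r)"
  shows "x < length Bs" "Bs ! x = (rn j \<in> leaves r)"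
    "bit_rank True Bs x = node_index rn r j" "bit_rank False Bs x = node_index rn l j"
proof -
  let ?xs = "filter (\<lambda>j. rn j \<in> leaves (Nd l r)) [0..<j]"
  obtain zs where zs: "Bs = map (\<lambda>j. rn j \<in> leaves r) ?xs @ (rn j \<in> leaves r) # zs"
    using node_bits_split(2)[of j n rn l r] assms(1,2) by (auto simp: Bs_def)
  have len: "length ?xs = x" using node_bits_split(1)[of j n rn l r] assms(1,2) by (simp add: x_def)
  show "x < length Bs" "Bs ! x = (rn j \<in> leaves r)"
    using zs len by (auto simp: nth_append)
  have tk: "take x Bs = map (\<lambda>j. rn j \<in> leaves r) ?xs"
    using zs len by simp
  have "bit_rank True Bs x = length (filter (\<lambda>j. rn j \<in> leaves r) [0..<j])"
    unfolding bit_rank_def tk by (simp add: filter_map o_def) (intro arg_cong[where f = length] filter_cong, auto)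
  then show "bit_rank True Bs x = node_index rn r j" by (simp add: length_filter_upt node_index_def)
  have "bit_rank False Bs x = length (filter (\<lambda>j. rn j \<in> leaves l) [0..<j])"
    unfolding bit_rank_def tk using assms(3)
    by (simp add: filter_map o_def) (intro arg_cong[where f = length] filter_cong, auto)
  then show "bit_rank False Bs x = node_index rn l j" by (simp add: length_filter_upt node_index_def)
qed

definition run_size :: "nat \<Rightarrow> (nat \<Rightarrow> nat) \<Rightarrow> nat \<Rightarrow> nat" where
  "run_size n rn a = card {j. j < n \<and> rn j = a}"

lemma sum_run_size: "finite A \<Longrightarrow> (\<Sum>a\<in>A. run_size n rn a) = card {j. j < n \<and> rn j \<in> A}"
proof (induction rule: finite_induct)
  case (insert x F)
  have "{j. j < n \<and> rn j \<in> insert x F} = {j. j < n \<and> rn j = x} \<union> {j. j < n \<and> rn j \<in> F}" by auto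
  then show ?case using insert by (simp add: run_size_def, subst card_Un_disjoint) auto
qed simp

text \<open>Each value contributes one bit to every inner node above its leaf.\<close>

lemma length_tree_bits:
  "distinct_leaves t \<Longrightarrow> length (concat (map (node_bits n rn) (subtree_list t))) = (\<Sum>a\<in>leaves t. run_size n rn a * leaf_depth t a)"
proof (induction t)
  case (Nd l r)
  have "length (node_bits n rn (Nd l r)) = (\<Sum>a\<in>leaves l \<union> leaves r. run_size n rn a)"
    by (simp add: length_filter_upt sum_run_size)
  also have "\<dots> = (\<Sum>a\<in>leaves l. run_size n rn a) + (\<Sum>a\<in>leaves r. run_size n rn a)"
    using Nd.prems by (intro sum.union_disjoint) auto
  finally have 1: "length (node_bits n rn (Nd l r)) = \<dots>" .
  have "(\<Sum>a\<in>leaves l \<union> leaves r. run_size n rn a * leaf_depth (Nd l r) a) =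
      (\<Sum>a\<in>leaves l. run_size n rn a * leaf_depth (Nd l r) a) + (\<Sum>a\<in>leaves r. run_size n rn a * leaf_depth (Nd l r) a)"
    using Nd.prems by (intro sum.union_disjoint) auto
  also have "(\<Sum>a\<in>leaves l. run_size n rn a * leaf_depth (Nd l r) a) = (\<Sum>a\<in>leaves l. run_size n rn a + run_size n rn a * leaf_depth l a)"
    by (intro sum.cong) auto
  also have "(\<Sum>a\<in>leaves r. run_size n rn a * leaf_depth (Nd l r) a) = (\<Sum>a\<in>leaves r. run_size n rn a + run_size n rn a * leaf_depth r a)"
    using Nd.prems by (intro sum.cong) auto
  finally show ?case using Nd 1 by (simp del: node_bits.simps leaf_depth.simps add: sum.distrib)
qed simp

text \<open>Node \<open>v\<close> of a tree is the \<open>v\<close>-th subtree in preorder; the root is node 0.\<close>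

definition node_id :: "mtree list \<Rightarrow> mtree \<Rightarrow> nat" where
  "node_id ts s = (THE i. i < length ts \<and> ts ! i = s)"

lemma node_id:
  assumes "distinct ts" "s \<in> set ts"
  shows "node_id ts s < length ts" "ts ! node_id ts s = s"
proof -
  obtain i where i: "i < length ts" "ts ! i = s" using assms by (auto simp: in_set_conv_nth)
  have "node_id ts s = i" unfolding node_id_def using i assms by (intro the_equality) (auto simp: nth_eq_iff_index_eq)
  with i show "node_id ts s < length ts" "ts ! node_id ts s = s" by auto
qed

definition offset :: "('a \<Rightarrow> bool list) \<Rightarrow> 'a list \<Rightarrow> nat \<Rightarrow> nat" where
  "offset f ts v = length (concat (map f (take v ts)))"

lemma concat_split:
  "v < length ts \<Longrightarrow> concat (map f ts) = concat (map f (take v ts)) @ f (ts ! v) @ concat (map f (drop (Suc v) ts))"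
  by (subst id_take_nth_drop[of v ts]) auto

text \<open>The vectors of all nodes are concatenated. A rank inside a node is a global rank minus
  the global rank at the offset of the node, so one directory serves all nodes.\<close>

lemma concat_nth_offset:
  assumes "v < length ts" "x < length (f (ts ! v))"
  shows "offset f ts v + x < length (concat (map f ts))" "concat (map f ts) ! (offset f ts v + x) = f (ts ! v) ! x"
    "bit_rank c (concat (map f ts)) (offset f ts v + x) = bit_rank c (concat (map f ts)) (offset f ts v) + bit_rank c (f (ts ! v)) x"
  using assms unfolding concat_split[OF assms(1), of f]
  by (auto simp: offset_def nth_append bit_rank_def)

lemma offset_le: "offset f ts v \<le> length (concat (map f ts))"
proof -
  have "concat (map f ts) = concat (map f (take v ts)) @ concat (map f (drop v ts))"
    by (metis append_take_drop_id concat_append map_append)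
  then show ?thesis by (simp add: offset_def)
qed

section \<open>Weight-balanced search trees\<close>

fun key_depth :: "nat tree \<Rightarrow> nat \<Rightarrow> nat" where
  "key_depth Leaf a = 0"
| "key_depth (Node l k r) a = (if a = k then 0 else if a < k then Suc (key_depth l a) else Suc (key_depth r a))"

fun root_key :: "nat tree \<Rightarrow> nat" where
  "root_key Leaf = 0"
| "root_key (Node l k r) = k"

text \<open>Search nodes are addressed by their keys. A missing child gets the key 0, which a search
  for a key of the tree never follows.\<close>

fun lchild :: "nat tree \<Rightarrow> nat \<Rightarrow> nat" where
  "lchild Leaf a = 0"
| "lchild (Node l k r) a = (if a = k then root_key l else if a < k then lchild l a else lchild r a)"

fun rchild :: "nat tree \<Rightarrow> nat \<Rightarrow> nat" where
  "rchild Leaf a = 0"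
| "rchild (Node l k r) a = (if a = k then root_key r else if a < k then rchild l a else rchild r a)"

lemma root_key_in: "root_key t \<in> insert 0 (set_tree t)"
  by (cases t) auto

lemma lchild_in: "lchild t a \<in> insert 0 (set_tree t)"
proof (induction t)
  case (Node l k r) then show ?case using root_key_in[of l] by auto
qed simp

lemma rchild_in: "rchild t a \<in> insert 0 (set_tree t)"
proof (induction t)
  case (Node l k r) then show ?case using root_key_in[of r] by auto
qed simp

text \<open>The root is a weighted median, the first key at which the prefix sums reach half of the
  total. Neither side exceeds half of the total, so the weight halves at every level.\<close>

lemma weight_balanced_tree:
  fixes q :: "nat \<Rightarrow> real"
  assumes "\<And>a. 0 < q a"
  shows "\<exists>t. inorder t = [lo..<hi] \<and> (\<forall>a\<in>{lo..<hi}. 2 ^ key_depth t a * q a \<le> (\<Sum>x\<in>{lo..<hi}. q x))"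
proof (induction "hi - lo" arbitrary: lo hi rule: less_induct)
  case less
  show ?case
  proof (cases "lo < hi")
    case False
    then show ?thesis by (intro exI[of _ Leaf]) auto
  next
    case True
    define W where "W = (\<Sum>x\<in>{lo..<hi}. q x)"
    define k where "k = (LEAST k. W / 2 \<le> (\<Sum>x\<in>{lo..<Suc k}. q x))"
    have "0 \<le> W" unfolding W_def using assms by (intro sum_nonneg) (simp add: less_imp_le)
    have ex: "W / 2 \<le> (\<Sum>x\<in>{lo..<Suc (hi - 1)}. q x)"
      using True \<open>0 \<le> W\<close> by (simp add: W_def)
    have k1: "W / 2 \<le> (\<Sum>x\<in>{lo..<Suc k}. q x)" unfolding k_def using ex by (rule LeastI)
    have k2: "k \<le> hi - 1" unfolding k_def using ex by (rule Least_le)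
    have "0 < W" unfolding W_def using True assms by (intro sum_pos) auto
    have k3: "lo \<le> k"
    proof (rule ccontr)
      assume "\<not> lo \<le> k"
      then have "(\<Sum>x\<in>{lo..<Suc k}. q x) = 0" by simp
      with k1 \<open>0 < W\<close> show False by simp
    qed
    have left: "(\<Sum>x\<in>{lo..<k}. q x) \<le> W / 2"
    proof (cases "k = lo")
      case False
      then have "k - 1 < k" "Suc (k - 1) = k" using k3 by auto
      then show ?thesis using not_less_Least[of "k - 1" "\<lambda>k. W / 2 \<le> (\<Sum>x\<in>{lo..<Suc k}. q x)"]
        unfolding k_def by (metis linear)
    qed (use \<open>0 < W\<close> in auto)
    have "W = (\<Sum>x\<in>{lo..<Suc k}. q x) + (\<Sum>x\<in>{Suc k..<hi}. q x)"
      unfolding W_def using k2 k3 True by (subst sum.atLeastLessThan_concat) auto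
    then have right: "(\<Sum>x\<in>{Suc k..<hi}. q x) \<le> W / 2" using k1 by simp
    obtain l where l: "inorder l = [lo..<k]" "\<forall>a\<in>{lo..<k}. 2 ^ key_depth l a * q a \<le> (\<Sum>x\<in>{lo..<k}. q x)"
      using less[of k lo] True k2 k3 by fastforce
    obtain r where r: "inorder r = [Suc k..<hi]" "\<forall>a\<in>{Suc k..<hi}. 2 ^ key_depth r a * q a \<le> (\<Sum>x\<in>{Suc k..<hi}. q x)"
      using less[of hi "Suc k"] True k2 k3 by fastforce
    have "inorder (Node l k r) = [lo..<hi]"
      using l r k2 k3 True upt_add_eq_append[of lo k "hi - k"] by (simp add: upt_conv_Cons)
    moreover have "2 ^ key_depth (Node l k r) a * q a \<le> W" if a: "a \<in> {lo..<hi}" for a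
    proof -
      consider "a = k" | "a \<in> {lo..<k}" | "a \<in> {Suc k..<hi}" using a by (cases a k rule: linorder_cases) auto
      then show ?thesis
      proof cases
        case 1
        have "q k \<le> W" unfolding W_def using a 1 assms
          by (intro member_le_sum) (auto simp: less_imp_le)
        then show ?thesis using 1 by simp
      next
        case 2
        then show ?thesis using l left by fastforce
      next
        case 3
        then show ?thesis using r right by fastforce
      qed
    qed
    ultimately show ?thesis unfolding W_def by blast
  qed
qed

section \<open>The query programs\<close>

definition parent_of :: "mtree list \<Rightarrow> nat \<Rightarrow> nat" where
  "parent_of ts v = (if v = 0 then 0 else THE u. u < length ts \<and> child (ts ! v) (ts ! u))"

definition is_right :: "mtree list \<Rightarrow> nat \<Rightarrow> bool" where
  "is_right ts v = (case ts ! parent_of ts v of Lf a \<Rightarrow> False | Nd l r \<Rightarrow> ts ! v = r)"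

definition tree_bits :: "nat \<Rightarrow> (nat \<Rightarrow> nat) \<Rightarrow> mtree \<Rightarrow> bool list" where
  "tree_bits n rn t = concat (map (node_bits n rn) (subtree_list t))"

text \<open>Offset and rank at the parent are stored with the child, so a step of the climb reads
  only entries of the current node. The run starts have \<open>\<rho> + 1\<close> entries because
  the end of a run is read as the start of the next.\<close>

definition tree_arrays :: "nat \<Rightarrow> (nat \<Rightarrow> nat) \<Rightarrow> mtree \<Rightarrow> (nat \<Rightarrow> nat) \<Rightarrow> nat tree \<Rightarrow> nat \<Rightarrow> nat list list" where
  "tree_arrays n rn t st bt \<rho> =
    (let ts = subtree_list t; B = tree_bits n rn t; f = node_bits n rn in
     [map (\<lambda>v. case ts ! v of Lf a \<Rightarrow> 0 | Nd l r \<Rightarrow> node_id ts l) [0..<length ts],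
      map (\<lambda>v. case ts ! v of Lf a \<Rightarrow> 0 | Nd l r \<Rightarrow> node_id ts r) [0..<length ts],
      map (offset f ts) [0..<length ts],
      map (\<lambda>v. bit_rank True B (offset f ts v)) [0..<length ts],
      map (\<lambda>v. case ts ! v of Lf a \<Rightarrow> st a | Nd l r \<Rightarrow> 0) [0..<length ts],
      map (parent_of ts) [0..<length ts],
      map (\<lambda>v. of_bool (is_right ts v)) [0..<length ts],
      map (\<lambda>v. bit_rank (is_right ts v) B (offset f ts (parent_of ts v))) [0..<length ts],
      map (\<lambda>v. offset f ts (parent_of ts v)) [0..<length ts],
      map (\<lambda>a. node_id ts (Lf a)) [0..<\<rho>],
      map st [0..<\<rho> + 1],
      map (lchild bt) [0..<\<rho>],
      map (rchild bt) [0..<\<rho>]])"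

text \<open>Register 2 holds the current node or run, register 1 the position inside it.\<close>

definition down_body :: prog where
  "down_body = Seq (Assign 3 (Bin Add (arr 24 (Reg 2)) (Reg 1)))
     (Seq (Assign 4 (Bin Sub (rank_expr (Reg 3)) (arr 25 (Reg 2))))
       (Cond (read_bits 8 (Reg 3) (Const 1))
         (Seq (Assign 1 (Reg 4)) (Assign 2 (arr 23 (Reg 2))))
         (Seq (Assign 1 (Bin Sub (Reg 1) (Reg 4))) (Assign 2 (arr 22 (Reg 2))))))"

text \<open>The root is node 0 and is the right child of no node, so the entry 0 marks a
  leaf.\<close>

definition down_loop :: prog where
  "down_loop = While (arr 23 (Reg 2)) down_body"

definition up_body :: prog where
  "up_body = Seq (Assign 3 (Bin Add (arr 29 (Reg 2)) (Reg 1)))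
     (Seq (Cond (arr 28 (Reg 2)) (select_prog 17 4 (Reg 3)) (select_prog 12 4 (Reg 3)))
       (Seq (Assign 1 (Bin Sub (Reg 4) (arr 30 (Reg 2)))) (Assign 2 (arr 27 (Reg 2)))))"

definition up_loop :: prog where
  "up_loop = While (Reg 2) up_body"

definition search_loop :: prog where
  "search_loop =
     While (Bin Or (Bin Less (Reg 1) (arr 32 (Reg 2)))
                   (Bin Equal (Bin Less (Reg 1) (arr 32 (Bin Add (Reg 2) (Const 1)))) (Const 0)))
       (Cond (Bin Less (Reg 1) (arr 32 (Reg 2)))
         (Assign 2 (arr 33 (Reg 2)))
         (Assign 2 (arr 34 (Reg 2))))"

text \<open>Register 2 starts at 0, which is already the number of the root.\<close>

definition bwd_main :: prog where
  "bwd_main = Seq (Assign 1 (Bin Sub (Reg 0) (Const 1)))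
     (Seq down_loop (Assign 0 (Bin Add (Bin Add (arr 26 (Reg 2)) (Reg 1)) (Const 1))))"

definition fwd_main :: prog where
  "fwd_main = Seq (Seq (Assign 1 (Bin Sub (Reg 0) (Const 1))) (Assign 2 (Data (Const 7))))
     (Seq search_loop
       (Seq (Seq (Assign 1 (Bin Sub (Reg 1) (arr 32 (Reg 2)))) (Assign 2 (arr 31 (Reg 2))))
         (Seq up_loop (Assign 0 (Bin Add (Reg 1) (Const 1))))))"

definition down_cost :: nat where
  "down_cost = expr_cost (arr 23 (Reg 2)) + 1 + max_cost down_body"

definition up_cost :: nat where
  "up_cost = 2 + max_cost up_body"

definition search_cost :: nat where
  "search_cost = (case search_loop of While c p \<Rightarrow> expr_cost c + 1 + max_cost p | _ \<Rightarrow> 0)"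

definition query_cost :: nat where
  "query_cost = max_cost bwd_main + max_cost fwd_main + down_cost + up_cost + search_cost"

lemma exec_while_step:
  assumes "while_free p" "eval_expr w D s c \<noteq> 0" "exec w D (While c p) (sem w D p s) u s'"
  shows "\<exists>t. exec w D (While c p) s t s' \<and> t \<le> expr_cost c + 1 + max_cost p + u"
proof -
  obtain t where "t \<le> max_cost p" "exec w D p s t (sem w D p s)"
    using exec_sem[OF assms(1)] by blast
  then show ?thesis using exec.WhileTrue[OF assms(2) _ assms(3)] 
    by (intro exI[of _ "expr_cost c + 1 + t + u"]) auto
qed

lemma exec_seq_le:
  assumes "\<exists>t. exec w D p s t s' \<and> t \<le> T" "\<exists>t. exec w D q s' t s'' \<and> t \<le> U"
  shows "\<exists>t. exec w D (Seq p q) s t s'' \<and> t \<le> T + U"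
  using assms by (blast intro: exec.Seq add_mono)

lemma while_free_bodies: "while_free down_body" "while_free up_body"
  by (simp_all add: down_body_def up_body_def select_prog_def)

section \<open>Correctness of descent, climb and search\<close>

locale perm_index = rank_select +
  fixes n :: nat and rn :: "nat \<Rightarrow> nat" and t :: mtree and st :: "nat \<Rightarrow> nat"
    and bt :: "nat tree" and \<rho> :: nat
  assumes B: "B = tree_bits n rn t"
    and distinct_leaves_t: "distinct_leaves t" and leaves_t: "leaves t = {..<\<rho>}"
    and rn: "\<And>j. j < n \<Longrightarrow> rn j < \<rho>"
    and bt: "inorder bt = [0..<\<rho>]"
    and D7: "7 < length D" "D ! 7 = root_key bt"
    and st: "mono st" "st \<rho> = n"
    and n_less: "n + 1 < 2 ^ w"
    and stored_tree: "\<And>j. j < 13 \<Longrightarrow> stored (22 + j) (tree_arrays n rn t st bt \<rho> ! j)"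
begin

abbreviation "ts \<equiv> subtree_list t"
abbreviation "id_of \<equiv> node_id ts"
abbreviation "offs \<equiv> offset (node_bits n rn) ts"

lemmas id_of = node_id[OF distinct_subtree_list[OF distinct_leaves_t]]

lemma id_root: "id_of t = 0"
proof -
  have "ts ! id_of t = ts ! 0" "id_of t < length ts" using id_of[OF self_in_subtree_list] subtree_list_nth_0 by auto
  then show ?thesis using distinct_subtree_list[OF distinct_leaves_t] by (subst (asm) nth_eq_iff_index_eq) auto
qed

lemma id_inject: "s \<in> set ts \<Longrightarrow> s' \<in> set ts \<Longrightarrow> id_of s = id_of s' \<longleftrightarrow> s = s'"
  using id_of by metis

lemma
  assumes "val s e = v" "v < length ts"
  shows val_left: "val s (arr 22 e) = (case ts ! v of Lf a \<Rightarrow> 0 | Nd l r \<Rightarrow> id_of l)"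
    and val_right: "val s (arr 23 e) = (case ts ! v of Lf a \<Rightarrow> 0 | Nd l r \<Rightarrow> id_of r)"
    and val_offset: "val s (arr 24 e) = offs v"
    and val_offset_rank: "val s (arr 25 e) = bit_rank True B (offs v)"
    and val_leaf_start: "val s (arr 26 e) = (case ts ! v of Lf a \<Rightarrow> st a | Nd l r \<Rightarrow> 0)"
    and val_parent: "val s (arr 27 e) = parent_of ts v"
    and val_side: "val s (arr 28 e) = of_bool (is_right ts v)"
    and val_up_rank: "val s (arr 29 e) = bit_rank (is_right ts v) B (offs (parent_of ts v))"
    and val_up_offset: "val s (arr 30 e) = offs (parent_of ts v)"
  using assms val_arr[OF stored_tree[of 0], of s e v] val_arr[OF stored_tree[of 1], of s e v]
    val_arr[OF stored_tree[of 2], of s e v] val_arr[OF stored_tree[of 3], of s e v]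
    val_arr[OF stored_tree[of 4], of s e v] val_arr[OF stored_tree[of 5], of s e v]
    val_arr[OF stored_tree[of 6], of s e v] val_arr[OF stored_tree[of 7], of s e v]
    val_arr[OF stored_tree[of 8], of s e v]
  by (simp_all add: tree_arrays_def Let_def nth_Cons' B del: upt_Suc)

lemma
  assumes "val s e = v"
  shows val_leaf: "v < \<rho> \<Longrightarrow> val s (arr 31 e) = id_of (Lf v)"
    and val_start: "v \<le> \<rho> \<Longrightarrow> val s (arr 32 e) = st v"
    and val_lchild: "v < \<rho> \<Longrightarrow> val s (arr 33 e) = lchild bt v"
    and val_rchild: "v < \<rho> \<Longrightarrow> val s (arr 34 e) = rchild bt v"
  using assms val_arr[OF stored_tree[of 9], of s e v] val_arr[OF stored_tree[of 10], of s e v]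
    val_arr[OF stored_tree[of 11], of s e v] val_arr[OF stored_tree[of 12], of s e v]
  by (simp_all add: tree_arrays_def Let_def nth_Cons' B del: upt_Suc)

lemma node_pos:
  assumes "Nd l r \<in> set ts" "j < n" "rn j \<in> leaves (Nd l r)"
  defines "p \<equiv> offs (id_of (Nd l r)) + node_index rn (Nd l r) j"
  shows "p < length B" "B ! p = (rn j \<in> leaves r)"
    "bit_rank True B p = bit_rank True B (offs (id_of (Nd l r))) + node_index rn r j"
    "bit_rank False B p = bit_rank False B (offs (id_of (Nd l r))) + node_index rn l j"
proof -
  have "leaves l \<inter> leaves r = {}" using subtree_list_distinct_leaves[OF assms(1) distinct_leaves_t] by simp
  note nb = node_bits_nth[of j n rn l r, OF assms(2,3) this]
  note v = id_of[OF assms(1)]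
  note c = concat_nth_offset[OF v(1), of "node_index rn (Nd l r) j" "node_bits n rn", unfolded v(2), OF nb(1)]
  show "p < length B" "B ! p = (rn j \<in> leaves r)"
    "bit_rank True B p = bit_rank True B (offs (id_of (Nd l r))) + node_index rn r j"
    "bit_rank False B p = bit_rank False B (offs (id_of (Nd l r))) + node_index rn l j"
    using c nb unfolding p_def B tree_bits_def by simp_all
qed

lemma node_index_add:
  assumes "leaves l \<inter> leaves r = {}"
  shows "node_index rn (Nd l r) j = node_index rn l j + node_index rn r j"
proof -
  have "{j'. j' < j \<and> rn j' \<in> leaves (Nd l r)} = {j'. j' < j \<and> rn j' \<in> leaves l} \<union> {j'. j' < j \<and> rn j' \<in> leaves r}"
    by auto
  then show ?thesis unfolding node_index_def using assms by (simp, subst card_Un_disjoint) auto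
qed

text \<open>Register 1 holds the number of smaller values at the current node. The rank of ones
  gives this number for the right child; subtracting it from the old index gives the number for the
  left child, so a directory for ones suffices.\<close>

lemma down_step:
  assumes s: "Nd l r \<in> set ts" and j: "j < n" "rn j \<in> leaves (Nd l r)"
    and R: "fst S 2 = id_of (Nd l r)" "fst S 1 = node_index rn (Nd l r) j"
  defines "c \<equiv> if rn j \<in> leaves r then r else l"
  shows "fst (sem w D down_body S) 2 = id_of c" "fst (sem w D down_body S) 1 = node_index rn c j"
proof -
  define v where "v = id_of (Nd l r)"
  have v: "v < length ts" "ts ! v = Nd l r" using id_of[OF s] by (auto simp: v_def)
  define p where "p = offs v + node_index rn (Nd l r) j"
  note np = node_pos[OF s j, folded v_def, folded p_def]
  have dj: "leaves l \<inter> leaves r = {}" using subtree_list_distinct_leaves[OF s distinct_leaves_t] by simp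
  have R2: "val S (Reg 2) = v" using R by (simp add: v_def)
  have e1: "val S (Bin Add (arr 24 (Reg 2)) (Reg 1)) = p"
    unfolding p_def by (rule val_add[OF val_offset[OF R2 v(1)]]) (use R np addr' in \<open>auto simp: p_def\<close>)
  define S1 where "S1 = ((fst S)(3 := p), snd S)"
  have S1: "sem w D (Assign 3 (Bin Add (arr 24 (Reg 2)) (Reg 1))) S = S1"
    using e1 by (simp add: S1_def del: eval_expr.simps)
  have R1: "val S1 (Reg 2) = v" "val S1 (Reg 3) = p" using R2 by (auto simp: S1_def)
  have "bit_rank True B p \<le> m" by (rule bit_rank_le_length)
  then have "bit_rank True B p < 2 ^ w" using addr' by linarith
  then have e2: "val S1 (Bin Sub (rank_expr (Reg 3)) (arr 25 (Reg 2))) = node_index rn r j"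
    by (subst val_sub[OF val_rank[OF R1(2) np(1)] val_offset_rank[OF R1(1) v(1)]]) (use np in auto)
  define S2 where "S2 = ((fst S1)(4 := node_index rn r j), snd S1)"
  have S2: "sem w D (Assign 4 (Bin Sub (rank_expr (Reg 3)) (arr 25 (Reg 2)))) S1 = S2"
    using e2 by (simp add: S2_def del: eval_expr.simps)
  have R2: "val S2 (Reg 2) = v" "val S2 (Reg 3) = p" "val S2 (Reg 1) = node_index rn (Nd l r) j" "val S2 (Reg 4) = node_index rn r j"
    using R1 R by (auto simp: S2_def S1_def)
  have e3: "val S2 (read_bits 8 (Reg 3) (Const 1)) = of_bool (rn j \<in> leaves r)"
    using val_bit[OF R2(2) np(1)] np by simp
  have e4: "val S2 (Bin Sub (Reg 1) (Reg 4)) = node_index rn l j"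
  proof (subst val_sub[OF R2(3) R2(4)])
    show "node_index rn (Nd l r) j < 2 ^ w" using np(1) addr' by (simp add: p_def)
  qed (auto simp: node_index_add[OF dj])
  have e5: "val S' (arr 23 (Reg 2)) = id_of r" "val S' (arr 22 (Reg 2)) = id_of l" if "val S' (Reg 2) = v" for S'
    using val_right[OF that v(1)] val_left[OF that v(1)] v by simp_all
  have "sem w D down_body S = (if rn j \<in> leaves r then ((fst S2)(1 := node_index rn r j, 2 := id_of r), snd S2)
      else ((fst S2)(1 := node_index rn l j, 2 := id_of l), snd S2))"
    using e3 e4 R2 e5 unfolding down_body_def sem.simps(4,5) S1 S2 
    by (simp del: eval_expr.simps(1,3-5))
  then show "fst (sem w D down_body S) 2 = id_of c" "fst (sem w D down_body S) 1 = node_index rn c j"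
    by (auto simp: c_def)
qed

lemma down_correct:
  assumes "s \<in> set ts" "j < n" "rn j \<in> leaves s" "fst S 2 = id_of s" "fst S 1 = node_index rn s j"
  shows "\<exists>u S'. exec w D down_loop S u S' \<and> u \<le> (leaf_depth s (rn j) + 1) * down_cost \<and>
     fst S' 2 = id_of (Lf (rn j)) \<and> fst S' 1 = node_index rn (Lf (rn j)) j"
  using assms
proof (induction s arbitrary: S)
  case (Lf a)
  then have v: "val S (Reg 2) = id_of (Lf a)" by simp
  have "val S (arr 23 (Reg 2)) = 0"
    using val_right[OF v] id_of[OF Lf.prems(1)] by simp
  then have "exec w D down_loop S (expr_cost (arr 23 (Reg 2)) + 1) S"
    unfolding down_loop_def by (rule exec.WhileFalse)
  then show ?case using Lf
    by (intro exI[of _ "expr_cost (arr 23 (Reg 2)) + 1"] exI[of _ S]) (auto simp: down_cost_def)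
next
  case (Nd l r)
  define c where "c = (if rn j \<in> leaves r then r else l)"
  define S1 where "S1 = sem w D down_body S"
  note lr = subtree_list_children[OF Nd.prems(1)]
  note S1 = down_step[OF Nd.prems, folded S1_def c_def]
  have c: "c \<in> {l, r}" "rn j \<in> leaves c" "c \<in> set ts" "leaf_depth (Nd l r) (rn j) = Suc (leaf_depth c (rn j))"
    using Nd.prems lr subtree_list_distinct_leaves[OF Nd.prems(1) distinct_leaves_t] by (auto simp: c_def)
  have "\<exists>u S'. exec w D down_loop S1 u S' \<and> u \<le> (leaf_depth c (rn j) + 1) * down_cost \<and>
     fst S' 2 = id_of (Lf (rn j)) \<and> fst S' 1 = node_index rn (Lf (rn j)) j"
    using c(1) Nd.IH[of S1] c(2,3) S1 Nd.prems(2) by auto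
  then obtain u S' where u: "exec w D down_loop S1 u S'" "u \<le> (leaf_depth c (rn j) + 1) * down_cost" 
     "fst S' 2 = id_of (Lf (rn j)) \<and> fst S' 1 = node_index rn (Lf (rn j)) j" by blast
  have v: "val S (Reg 2) = id_of (Nd l r)" using Nd.prems by simp
  have "id_of r \<noteq> id_of t"
  proof
    assume "id_of r = id_of t"
    then have "r = t" using id_inject[OF lr(2) self_in_subtree_list] by simp
    then show False using subtree_list_size[OF Nd.prems(1)] by simp
  qed
  then have "val S (arr 23 (Reg 2)) \<noteq> 0"
    using val_right[OF v] id_of[OF Nd.prems(1)] id_root by simp
  from exec_while_step[OF while_free_bodies(1) this u(1)[unfolded down_loop_def S1_def]]
  obtain u' where "exec w D down_loop S u' S'" "u' \<le> down_cost + u"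
    unfolding down_loop_def down_cost_def by blast
  then show ?case using u c(4) by (intro exI[of _ u'] exI[of _ S']) auto
qed

lemma parent_of_child:
  assumes "p \<in> set ts" "child s p"
  shows "parent_of ts (id_of s) = id_of p"
proof -
  have s: "s \<in> set ts" using child_subtree_list[OF assms(2,1)] .
  have "size s < size t" using child_size[OF assms(2)] subtree_list_size[OF assms(1)] by simp
  then have "s \<noteq> t" by auto
  then have "id_of s \<noteq> 0" using id_inject[OF s self_in_subtree_list] id_root by simp
  moreover have "(THE u. u < length ts \<and> child (ts ! id_of s) (ts ! u)) = id_of p"
  proof (rule the_equality)
    show "id_of p < length ts \<and> child (ts ! id_of s) (ts ! id_of p)"
      using id_of[OF s] id_of[OF assms(1)] assms(2) by simp
  next
    fix u assume u: "u < length ts \<and> child (ts ! id_of s) (ts ! u)"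
    then have "ts ! u = p"
      using child_unique[OF distinct_leaves_t _ assms(1) _ assms(2)] id_of[OF s] by auto
    then show "u = id_of p"
      using u id_of[OF assms(1)] distinct_subtree_list[OF distinct_leaves_t] by (metis nth_eq_iff_index_eq)
  qed
  ultimately show ?thesis by (simp add: parent_of_def)
qed

text \<open>The bit of \<open>j\<close> at the parent is preceded in \<open>B\<close> by
  \<open>bit_rank c B q\<close> bits equal to \<open>c\<close>, a number computable from the index
  at the child; selecting that element recovers the position \<open>q\<close>.\<close>

lemma up_step:
  assumes p: "Nd l r \<in> set ts" and j: "j < n" "rn j \<in> leaves s" and s: "s = l \<or> s = r"
    and R: "fst S 2 = id_of s" "fst S 1 = node_index rn s j"
  shows "fst (sem w D up_body S) 2 = id_of (Nd l r)" "fst (sem w D up_body S) 1 = node_index rn (Nd l r) j"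
proof -
  define u v where "u = id_of (Nd l r)" and "v = id_of s"
  have ch: "child s (Nd l r)" using s by (auto simp: child_def)
  have sts: "s \<in> set ts" using child_subtree_list[OF ch p] .
  have v: "v < length ts" "ts ! v = s" "parent_of ts v = u"
    using id_of[OF sts] parent_of_child[OF p ch] by (auto simp: u_def v_def)
  have u: "u < length ts" "ts ! u = Nd l r" using id_of[OF p] by (auto simp: u_def)
  have jp: "rn j \<in> leaves (Nd l r)" using s j by auto
  have dj: "leaves l \<inter> leaves r = {}" using subtree_list_distinct_leaves[OF p distinct_leaves_t] by simp
  define c where "c = (rn j \<in> leaves r)"
  have c: "is_right ts v = c" "s = (if c then r else l)"
    using s j dj leaves_nonempty[of l] u v by (auto simp: is_right_def c_def)
  define q where "q = offs u + node_index rn (Nd l r) j"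
  note np = node_pos[OF p j(1) jp, folded u_def, folded q_def]
  have Bq: "B ! q = c" using np by (simp add: c_def)
  have cq: "bit_rank c B q = bit_rank c B (offs u) + node_index rn s j" using np c by (cases c) auto
  have R2: "val S (Reg 2) = v" using R by (simp add: v_def)
  have "bit_rank c B q \<le> m" by (rule bit_rank_le_length)
  then have "bit_rank c B q < 2 ^ w" using addr' by linarith
  then have e1: "val S (Bin Add (arr 29 (Reg 2)) (Reg 1)) = bit_rank c B q"
    using R cq by (subst val_add[OF val_up_rank[OF R2 v(1)]]) (auto simp: v c)
  define S1 where "S1 = ((fst S)(3 := bit_rank c B q), snd S)"
  have S1: "sem w D (Assign 3 (Bin Add (arr 29 (Reg 2)) (Reg 1))) S = S1"
    using e1 by (simp add: S1_def del: eval_expr.simps)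
  have R1: "val S1 (Reg 2) = v" "val S1 (Reg 3) = bit_rank c B q" using R2 by (auto simp: S1_def)
  define S2 where "S2 = ((fst S1)(4 := q), snd S1)"
  have "sem w D (Cond (arr 28 (Reg 2)) (select_prog 17 4 (Reg 3)) (select_prog 12 4 (Reg 3))) S1 =
     sem w D (select_prog (select_base c) 4 (Reg 3)) S1"
    using val_side[OF R1(1) v(1)] c by (cases c) (simp_all add: select_base_def)
  also have "\<dots> = S2" unfolding S2_def by (rule sem_select[OF R1(2) np(1) Bq])
  finally have S2: "sem w D (Cond (arr 28 (Reg 2)) (select_prog 17 4 (Reg 3)) (select_prog 12 4 (Reg 3))) S1 = S2" .
  have R2: "val S2 (Reg 2) = v" "val S2 (Reg 4) = q" using R1 by (auto simp: S2_def)
  have e3: "val S2 (Bin Sub (Reg 4) (arr 30 (Reg 2))) = node_index rn (Nd l r) j"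
    using np(1) addr' by (subst val_sub[OF R2(2) val_up_offset[OF R2(1) v(1)]]) (auto simp: v q_def)
  have e4: "val S' (arr 27 (Reg 2)) = u" if "val S' (Reg 2) = v" for S'
    using val_parent[OF that v(1)] v by simp
  have "sem w D up_body S = ((fst S2)(1 := node_index rn (Nd l r) j, 2 := u), snd S2)"
    using e3 R2 e4 unfolding up_body_def sem.simps(4) S1 S2 by (simp del: eval_expr.simps(1,3-5))
  then show "fst (sem w D up_body S) 2 = id_of (Nd l r)" "fst (sem w D up_body S) 1 = node_index rn (Nd l r) j"
    by (auto simp: u_def)
qed

text \<open>Stated in continuation-passing form: the climb ends at the root, whereas the induction
  descends.\<close>

lemma up_correct:
  assumes "s \<in> set ts" "j < n" "rn j \<in> leaves s" 
    and "fst S 2 = id_of (Lf (rn j))" "fst S 1 = node_index rn (Lf (rn j)) j"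
    and "\<And>S'. fst S' 2 = id_of s \<Longrightarrow> fst S' 1 = node_index rn s j \<Longrightarrow>
      \<exists>u S''. exec w D up_loop S' u S'' \<and> u \<le> T \<and> Q S''"
  shows "\<exists>u S''. exec w D up_loop S u S'' \<and> u \<le> T + leaf_depth s (rn j) * up_cost \<and> Q S''"
  using assms
proof (induction s arbitrary: T)
  case (Lf a)
  then show ?case by auto
next
  case (Nd l r)
  define c where "c = (if rn j \<in> leaves r then r else l)"
  note lr = subtree_list_children[OF Nd.prems(1)]
  have c: "c = l \<or> c = r" "rn j \<in> leaves c" "c \<in> set ts" "leaf_depth (Nd l r) (rn j) = Suc (leaf_depth c (rn j))"
    using Nd.prems(3) lr subtree_list_distinct_leaves[OF Nd.prems(1) distinct_leaves_t] by (auto simp: c_def)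
  have step: "\<exists>u S''. exec w D up_loop S' u S'' \<and> u \<le> T + up_cost \<and> Q S''"
    if S': "fst S' 2 = id_of c" "fst S' 1 = node_index rn c j" for S'
  proof -
    note S1 = up_step[OF Nd.prems(1,2) c(2,1) S']
    obtain u S'' where u: "exec w D up_loop (sem w D up_body S') u S''" "u \<le> T" "Q S''"
      using Nd.prems(6)[OF S1] by blast
    have "c \<noteq> t" using c(1) subtree_list_size[OF Nd.prems(1)] by auto
    then have "val S' (Reg 2) \<noteq> 0"
      using S' id_inject[OF c(3) self_in_subtree_list] id_root by simp
    from exec_while_step[OF while_free_bodies(2) this u(1)[unfolded up_loop_def]]
    obtain u' where "exec w D up_loop S' u' S''" "u' \<le> up_cost + u"
      unfolding up_loop_def up_cost_def by auto
    then show ?thesis using u by (intro exI[of _ u'] exI[of _ S'']) auto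
  qed
  have "\<exists>u S''. exec w D up_loop S u S'' \<and> u \<le> (T + up_cost) + leaf_depth c (rn j) * up_cost \<and> Q S''"
    using c(1)
  proof
    assume l: "c = l"
    show ?thesis unfolding l by (rule Nd.IH(1)) (use Nd.prems(2,4,5) c step l in auto)
  next
    assume r: "c = r"
    show ?thesis unfolding r by (rule Nd.IH(2)) (use Nd.prems(2,4,5) c step r in auto)
  qed
  then show ?case using c(4) by (simp add: add.assoc)
qed

lemma leaves_root: "j < n \<Longrightarrow> rn j \<in> leaves t"
  using rn leaves_t by auto

lemma node_index_root: "j < n \<Longrightarrow> node_index rn t j = j"
proof -
  assume "j < n"
  then have "{j'. j' < j \<and> rn j' \<in> leaves t} = {..<j}" using leaves_root by auto
  then show ?thesis by (simp add: node_index_def)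
qed

lemma up_correct_root:
  assumes "j < n" "fst S 2 = id_of (Lf (rn j))" "fst S 1 = node_index rn (Lf (rn j)) j"
  shows "\<exists>u S''. exec w D up_loop S u S'' \<and> u \<le> (leaf_depth t (rn j) + 1) * up_cost \<and> fst S'' 1 = j"
proof -
  have "\<exists>u S''. exec w D up_loop S u S'' \<and> u \<le> up_cost + leaf_depth t (rn j) * up_cost \<and> fst S'' 1 = j"
  proof (rule up_correct[OF self_in_subtree_list assms(1) leaves_root[OF assms(1)] assms(2,3)])
    fix S' :: state assume S': "fst S' 2 = id_of t" "fst S' 1 = node_index rn t j"
    have "exec w D up_loop S' (expr_cost (Reg 2) + 1) S'"
      unfolding up_loop_def using S' id_root by (intro exec.WhileFalse) simp
    then show "\<exists>u S''. exec w D up_loop S' u S'' \<and> u \<le> up_cost \<and> fst S'' 1 = j"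
      using S' node_index_root[OF assms(1)] by (intro exI[of _ "expr_cost (Reg 2) + 1"] exI[of _ S']) (auto simp: up_cost_def)
  qed
  then show ?thesis by simp
qed

lemma val_or_bool:
  assumes "val s x = of_bool P" "val s y = of_bool Q"
  shows "val s (Bin Or x y) = of_bool (P \<or> Q)"
  using assms w_ge by (cases P; cases Q) simp_all

text \<open>The stored child arrays belong to the whole tree \<open>bt\<close>, while the induction
  runs over its subtrees \<open>s\<close>; the agreement on the keys of \<open>s\<close> is carried
  along.\<close>

lemma search_correct:
  assumes "bst s" "\<forall>x\<in>set_tree s. lchild bt x = lchild s x \<and> rchild bt x = rchild s x \<and> x < \<rho>"
    and "a \<in> set_tree s" "st a \<le> i" "i < st (Suc a)" "fst S 2 = root_key s" "fst S 1 = i"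
  shows "\<exists>u S'. exec w D search_loop S u S' \<and> u \<le> (key_depth s a + 1) * search_cost \<and> fst S' 2 = a \<and> fst S' 1 = i"
  using assms
proof (induction s arbitrary: S)
  case (Node l k r)
  have k: "k < \<rho>" "lchild bt k = root_key l" "rchild bt k = root_key r" using Node.prems by auto
  have S: "val S (Reg 1) = i" "val S (Reg 2) = k" using Node.prems by auto
  have "\<rho> + 1 < 2 ^ w"
    using stored_length[OF stored_tree[of 10]] by (simp add: tree_arrays_def Let_def)
  then have k1: "val S (Bin Add (Reg 2) (Const 1)) = k + 1"
    using S(2) one_less k by (intro val_add[OF _ val_const]) auto
  let ?c1 = "Bin Less (Reg 1) (arr 32 (Reg 2))"
  let ?c2 = "Bin Equal (Bin Less (Reg 1) (arr 32 (Bin Add (Reg 2) (Const 1)))) (Const 0)"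
  have c1: "val S ?c1 = of_bool (i < st k)"
    using k by (intro val_less[OF S(1) val_start[OF S(2)]]) simp
  have c2: "val S ?c2 = of_bool (\<not> i < st (k + 1))"
    using k by (subst val_equal[OF val_less[OF S(1) val_start[OF k1]] val_const]) auto
  note c = val_or_bool[OF c1 c2]
  let ?body = "Cond ?c1 (Assign 2 (arr 33 (Reg 2))) (Assign 2 (arr 34 (Reg 2)))"
  have sc: "search_cost = expr_cost (Bin Or ?c1 ?c2) + 1 + max_cost ?body"
    by (simp only: search_cost_def search_loop_def prog.case)
  consider "a = k" | "a \<in> set_tree l" "a < k" | "a \<in> set_tree r" "k < a"
    using Node.prems by auto
  then show ?case
  proof cases
    case 1
    then have "val S (Bin Or ?c1 ?c2) = 0" using c Node.prems by (simp del: eval_expr.simps)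
    then have "exec w D search_loop S (expr_cost (Bin Or ?c1 ?c2) + 1) S"
      unfolding search_loop_def by (rule exec.WhileFalse)
    then show ?thesis using 1 S sc by (intro exI[of _ "expr_cost (Bin Or ?c1 ?c2) + 1"] exI[of _ S]) auto
  next
    case 2
    have "i < st k" using monoD[OF st(1), of "Suc a" k] 2 Node.prems(5) by simp
    then have nz: "val S (Bin Or ?c1 ?c2) \<noteq> 0" and sm: "sem w D ?body S = ((fst S)(2 := root_key l), snd S)"
      using c c1 val_lchild[OF S(2) k(1)] k(2) by (simp_all del: eval_expr.simps)
    have "\<exists>u S'. exec w D search_loop (sem w D ?body S) u S' \<and> u \<le> (key_depth l a + 1) * search_cost \<and> fst S' 2 = a \<and> fst S' 1 = i"
      unfolding sm using Node.prems 2 by (intro Node.IH) (auto simp: bst_iff_sorted_wrt_less)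
    then obtain u S' where u: "exec w D search_loop (sem w D ?body S) u S'" "u \<le> (key_depth l a + 1) * search_cost"
      "fst S' 2 = a" "fst S' 1 = i" by blast
    obtain u' where "exec w D search_loop S u' S'" "u' \<le> search_cost + u"
      using exec_while_step[OF _ nz u(1)[unfolded search_loop_def]] unfolding search_loop_def sc by auto
    then show ?thesis using u 2 by (intro exI[of _ u'] exI[of _ S']) auto
  next
    case 3
    have i: "st (Suc k) \<le> i" using monoD[OF st(1), of "Suc k" a] 3 Node.prems(4) by simp
    then have "st k \<le> i" using monoD[OF st(1), of k "Suc k"] by simp
    then have nz: "val S (Bin Or ?c1 ?c2) \<noteq> 0" and sm: "sem w D ?body S = ((fst S)(2 := root_key r), snd S)"
      using i c c1 val_rchild[OF S(2) k(1)] k(3) by (simp_all del: eval_expr.simps)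
    have "\<exists>u S'. exec w D search_loop (sem w D ?body S) u S' \<and> u \<le> (key_depth r a + 1) * search_cost \<and> fst S' 2 = a \<and> fst S' 1 = i"
      unfolding sm using Node.prems 3 by (intro Node.IH) (auto simp: bst_iff_sorted_wrt_less)
    then obtain u S' where u: "exec w D search_loop (sem w D ?body S) u S'" "u \<le> (key_depth r a + 1) * search_cost"
      "fst S' 2 = a" "fst S' 1 = i" by blast
    obtain u' where "exec w D search_loop S u' S'" "u' \<le> search_cost + u"
      using exec_while_step[OF _ nz u(1)[unfolded search_loop_def]] unfolding search_loop_def sc by auto
    then show ?thesis using u 3 by (intro exI[of _ u'] exI[of _ S']) auto
  qed
qed simp

text \<open>Here \<open>rn\<close> is any assignment of values to runs. That the start of the run
  plus the index at the leaf is the position of the value is a property of increasing runs, supplied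
  where this lemma is applied.\<close>

lemma bwd_correct:
  assumes j: "j < n" and res: "st (rn j) + node_index rn (Lf (rn j)) j < n"
    and S: "fst S 0 = Suc j" "fst S 2 = 0"
  shows "\<exists>u S'. exec w D bwd_main S u S' \<and> u \<le> query_cost * (leaf_depth t (rn j) + 1) \<and>
    fst S' 0 = Suc (st (rn j) + node_index rn (Lf (rn j)) j)"
proof -
  let ?p0 = "Assign 1 (Bin Sub (Reg 0) (Const 1))"
  let ?p2 = "Assign 0 (Bin Add (Bin Add (arr 26 (Reg 2)) (Reg 1)) (Const 1))"
  define S1 where "S1 = sem w D ?p0 S"
  have "val S (Bin Sub (Reg 0) (Const 1)) = Suc j - 1"
    using S j n_less one_less by (intro val_sub[OF _ val_const]) auto
  then have S1: "fst S1 1 = j" "fst S1 2 = 0" using S by (simp_all add: S1_def del: eval_expr.simps)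
  obtain u S2 where u: "exec w D down_loop S1 u S2" "u \<le> (leaf_depth t (rn j) + 1) * down_cost"
     "fst S2 2 = id_of (Lf (rn j))" "fst S2 1 = node_index rn (Lf (rn j)) j"
    using down_correct[OF self_in_subtree_list j leaves_root[OF j], of S1] S1 id_root node_index_root[OF j] by auto
  have lf: "Lf (rn j) \<in> set ts" using leaf_in_subtree_list leaves_root[OF j] by blast
  have "val S2 (arr 26 (Reg 2)) = st (rn j)"
    using val_leaf_start[of S2 "Reg 2"] u id_of[OF lf] by simp
  then have "val S2 (Bin Add (Bin Add (arr 26 (Reg 2)) (Reg 1)) (Const 1)) = st (rn j) + node_index rn (Lf (rn j)) j + 1"
    using u res n_less one_less by (intro val_add[OF val_add val_const]) auto
  then have S3: "fst (sem w D ?p2 S2) 0 = Suc (st (rn j) + node_index rn (Lf (rn j)) j)"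
    by (simp del: eval_expr.simps)
  have "\<exists>v. exec w D bwd_main S v (sem w D ?p2 S2) \<and> v \<le> max_cost ?p0 + ((leaf_depth t (rn j) + 1) * down_cost + max_cost ?p2)"
    unfolding bwd_main_def
    using exec_sem[of ?p0 w D S] exec_sem[of ?p2 w D S2] u unfolding S1_def[symmetric]
    by (intro exec_seq_le[where s' = S1] exec_seq_le[where s' = S2]) (simp only: while_free.simps; blast)+
  moreover have "max_cost ?p0 + ((leaf_depth t (rn j) + 1) * down_cost + max_cost ?p2) \<le> query_cost * (leaf_depth t (rn j) + 1)"
    unfolding query_cost_def bwd_main_def by (simp add: algebra_simps)
  ultimately show ?thesis using S3 le_trans by blast
qed

lemma fwd_correct:
  assumes j: "j < n" and i: "i < st (Suc (rn j))" and pos: "st (rn j) + node_index rn (Lf (rn j)) j = i"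
    and "i < n" and S: "fst S 0 = Suc i"
  shows "\<exists>u S'. exec w D fwd_main S u S' \<and> u \<le> query_cost * (leaf_depth t (rn j) + key_depth bt (rn j) + 1) \<and> fst S' 0 = Suc j"
proof -
  let ?a = "rn j"
  let ?p0 = "Seq (Assign 1 (Bin Sub (Reg 0) (Const 1))) (Assign 2 (Data (Const 7)))"
  let ?p1 = "Seq (Assign 1 (Bin Sub (Reg 1) (arr 32 (Reg 2)))) (Assign 2 (arr 31 (Reg 2)))"
  let ?p2 = "Assign 0 (Bin Add (Reg 1) (Const 1))"
  define S1 where "S1 = sem w D ?p0 S"
  have "val S (Bin Sub (Reg 0) (Const 1)) = Suc i - 1"
    using S \<open>i < n\<close> n_less one_less by (intro val_sub[OF _ val_const]) auto
  then have S1: "fst S1 1 = i" "fst S1 2 = root_key bt"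
    using val_data_const[OF D7(1)] D7 by (simp_all add: S1_def del: eval_expr.simps)
  have set_bt: "set_tree bt = {..<\<rho>}"
    using arg_cong[OF bt, of set] by (simp add: atLeast0LessThan)
  have "bst bt" unfolding bst_iff_sorted_wrt_less bt by simp
  obtain u1 S2 where u1: "exec w D search_loop S1 u1 S2" "u1 \<le> (key_depth bt ?a + 1) * search_cost" 
    "fst S2 2 = ?a" "fst S2 1 = i"
    using search_correct[OF \<open>bst bt\<close>, of ?a i S1] S1 set_bt rn[OF j] pos i by auto
  define S3 where "S3 = sem w D ?p1 S2"
  have "val S2 (arr 32 (Reg 2)) = st ?a" using val_start[of S2 "Reg 2" ?a] u1 rn[OF j] by simp
  then have "val S2 (Bin Sub (Reg 1) (arr 32 (Reg 2))) = i - st ?a"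
    using u1 pos \<open>i < n\<close> n_less by (intro val_sub) auto
  moreover have "val S' (arr 31 (Reg 2)) = id_of (Lf ?a)" if "fst S' 2 = ?a" for S'
    using val_leaf[of S' "Reg 2" ?a] that rn[OF j] by simp
  ultimately have S3: "fst S3 1 = node_index rn (Lf ?a) j" "fst S3 2 = id_of (Lf ?a)"
    using pos u1 by (auto simp: S3_def simp del: eval_expr.simps)
  obtain u2 S4 where u2: "exec w D up_loop S3 u2 S4" "u2 \<le> (leaf_depth t ?a + 1) * up_cost" "fst S4 1 = j"
    using up_correct_root[OF j S3(2,1)] by blast
  have "val S4 (Bin Add (Reg 1) (Const 1)) = j + 1"
    using u2 j n_less one_less by (intro val_add[OF _ val_const]) auto
  then have S5: "fst (sem w D ?p2 S4) 0 = Suc j"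
    by (simp del: eval_expr.simps)
  have "\<exists>v. exec w D fwd_main S v (sem w D ?p2 S4) \<and>
     v \<le> max_cost ?p0 + ((key_depth bt ?a + 1) * search_cost + (max_cost ?p1 + ((leaf_depth t ?a + 1) * up_cost + max_cost ?p2)))"
    unfolding fwd_main_def
    using exec_sem[of ?p0 w D S] exec_sem[of ?p1 w D S2] exec_sem[of ?p2 w D S4] u1 u2
    unfolding S1_def[symmetric] S3_def[symmetric]
    by (intro exec_seq_le[where s' = S1] exec_seq_le[where s' = S2] exec_seq_le[where s' = S3]
        exec_seq_le[where s' = S4]) (simp only: while_free.simps; blast)+
  moreover have "max_cost ?p0 + ((key_depth bt ?a + 1) * search_cost + (max_cost ?p1 + ((leaf_depth t ?a + 1) * up_cost + max_cost ?p2)))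
     \<le> query_cost * (leaf_depth t ?a + key_depth bt ?a + 1)"
    unfolding query_cost_def fwd_main_def by (simp add: algebra_simps)
  ultimately show ?thesis using S5 le_trans by blast
qed

end

section \<open>The encoding\<close>

definition select_arrays :: "nat \<Rightarrow> nat \<Rightarrow> nat \<Rightarrow> nat \<Rightarrow> nat \<Rightarrow> bool \<Rightarrow> bool list \<Rightarrow> nat list list" where
  "select_arrays w b f K1 K2 c B =
     [select_super K1 c B, select_super_explicit K1 c B,
      pack_fields w f (select_block f K1 K2 c B), pack_fields w f (select_block_explicit f K1 K2 c B),
      select_table c b]"

definition bit_arrays :: "nat \<Rightarrow> nat \<Rightarrow> nat \<Rightarrow> nat \<Rightarrow> nat \<Rightarrow> bool list \<Rightarrow> nat list list" where
  "bit_arrays w b f K1 K2 B =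
     [pack w (length B + b) (bit_fun B), rank_super b B, pack_fields w f (rank_block f b B), rank_table b]
     @ select_arrays w b f K1 K2 False B @ select_arrays w b f K1 K2 True B"

text \<open>Each array is reached through a header word holding its absolute address, so programs
  can name arrays by fixed numbers although the lengths vary with \<open>n\<close>.\<close>

definition layout :: "nat list \<Rightarrow> nat list list \<Rightarrow> nat list" where
  "layout hs As = hs @ map (\<lambda>j. length hs + length As + length (concat (take j As))) [0..<length As] @ concat As"

lemma length_layout: "length (layout hs As) = length hs + length As + length (concat As)"
  by (simp add: layout_def)

lemma layout_header: "j < length hs \<Longrightarrow> layout hs As ! j = hs ! j"
  by (simp add: layout_def nth_append)

lemma layout_base:
  "j < length As \<Longrightarrow> layout hs As ! (length hs + j) = length hs + length As + length (concat (take j As))"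
  by (simp add: layout_def nth_append)

lemma concat_take_le:
  assumes "j < length As"
  shows "length (concat (take j As)) + length (As ! j) \<le> length (concat As)"
proof -
  have "concat As = concat (take j As) @ As ! j @ concat (drop (Suc j) As)"
    using concat_split[OF assms, of id] by simp
  then show ?thesis by simp
qed

lemma layout_entry:
  assumes "j < length As" "i < length (As ! j)"
  shows "layout hs As ! (length hs + length As + length (concat (take j As)) + i) = As ! j ! i"
proof -
  have "concat As = concat (take j As) @ As ! j @ concat (drop (Suc j) As)"
    using concat_split[OF assms(1), of id] by simp
  then have "concat As ! (length (concat (take j As)) + i) = As ! j ! i"
    using assms(2) by (simp add: nth_append)
  then show ?thesis by (simp add: layout_def nth_append)
qed

lemma words_layout:
  assumes "words w hs" "\<And>A. A \<in> set As \<Longrightarrow> words w A" "length (layout hs As) < 2 ^ w"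
  shows "words w (layout hs As)"
proof -
  have "length hs + length As + length (concat (take j As)) < 2 ^ w" if "j < length As" for j
    using concat_take_le[OF that] assms(3) by (simp add: length_layout)
  then show ?thesis using assms(1,2) by (auto simp: words_def layout_def)
qed

lemma words_map: "(\<And>i. i < k \<Longrightarrow> g i < 2 ^ w) \<Longrightarrow> words w (map g [0..<k])"
  by (auto simp: words_def)

lemma words_pack: "words w (pack w len \<beta>)"
  unfolding pack_def by (intro words_map bits_at_less)

lemma words_bit_arrays:
  assumes "length B < 2 ^ w" "0 < b" "b < 2 ^ w" "A \<in> set (bit_arrays w b f K1 K2 B)"
  shows "words w A"
proof -
  have c: "bit_rank c B x < 2 ^ w" "bit_select c B x < 2 ^ w" for c x
    using bit_rank_le_length[of c B x] bit_select_le[of c B x] assms by linarith+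
  have cd: "card {t. t < i mod b \<and> bit (i div b) t} < 2 ^ w" for i
  proof -
    have "card {t. t < i mod b \<and> bit (i div b) t} \<le> card {..<i mod b}" by (intro card_mono) auto
    moreover have "i mod b < b" using assms(2) by simp
    ultimately show ?thesis using assms(3) by simp
  qed
  have lt: "(LEAST t. b \<le> t \<or> i mod b < card {u. u \<le> t \<and> bit (i div b) u = c}) < 2 ^ w" for i c
    using assms(3) by (rule le_less_trans[rotated]) (rule Least_le, simp)
  show ?thesis using assms(4)
    unfolding bit_arrays_def select_arrays_def
    by (auto simp only: set_append list.set Un_iff insert_iff empty_iff words_pack pack_fields_def
          rank_super_def rank_table_def select_super_def select_super_explicit_def select_table_def explicit_slots_def
        intro!: words_map c cd lt)
qed

lemma parent_exists: "s \<in> set (subtree_list t) \<Longrightarrow> s = t \<or> (\<exists>p\<in>set (subtree_list t). child s p)"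
  by (induction t) (auto simp: child_def)

lemma parent_of_less:
  assumes "distinct_leaves t" "v < length (subtree_list t)"
  shows "parent_of (subtree_list t) v < length (subtree_list t)"
proof (cases "v = 0")
  case False
  let ?ts = "subtree_list t"
  have "?ts ! v \<noteq> t"
    using False assms distinct_subtree_list[OF assms(1)] subtree_list_nth_0[of t] nth_eq_iff_index_eq[of ?ts v 0] by fastforce
  then obtain p where p: "p \<in> set ?ts" "child (?ts ! v) p"
    using parent_exists[of "?ts ! v" t] assms(2) by auto
  then obtain u where u: "u < length ?ts" "?ts ! u = p" by (auto simp: in_set_conv_nth)
  have "(THE u. u < length ?ts \<and> child (?ts ! v) (?ts ! u)) = u"
  proof (rule the_equality)
    fix u' assume u': "u' < length ?ts \<and> child (?ts ! v) (?ts ! u')"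
    then have "?ts ! u' = p" using child_unique[OF assms(1) _ p(1) _ p(2)] by auto
    then show "u' = u" using u u' distinct_subtree_list[OF assms(1)] by (metis nth_eq_iff_index_eq)
  qed (use u p in auto)
  then show ?thesis using u False by (simp add: parent_of_def)
qed (use assms in \<open>simp add: parent_of_def\<close>)

lemma words_tree_arrays:
  assumes "distinct_leaves t" "leaves t = {..<\<rho>}" "inorder bt = [0..<\<rho>]" "length (tree_bits n rn t) < 2 ^ w"
    and "length (subtree_list t) < 2 ^ w" "\<And>a. a \<le> \<rho> \<Longrightarrow> st a < 2 ^ w" "\<rho> < 2 ^ w"
    and "A \<in> set (tree_arrays n rn t st bt \<rho>)"
  shows "words w A"
proof -
  let ?ts = "subtree_list t"
  have id: "node_id ?ts s < 2 ^ w" if "s \<in> set ?ts" for s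
    using node_id(1)[OF distinct_subtree_list[OF assms(1)] that] assms(5) by simp
  have c: "bit_rank c (tree_bits n rn t) x < 2 ^ w" for c x
    using bit_rank_le_length[of c _ x] assms(4) le_less_trans by blast
  have o: "offset (node_bits n rn) ?ts x < 2 ^ w" for x
    using offset_le[of "node_bits n rn" ?ts x] assms(4) by (simp add: tree_bits_def)
  have set_bt: "set_tree bt = {..<\<rho>}" using arg_cong[OF assms(3), of set] by (simp add: atLeast0LessThan)
  have k0: "x < 2 ^ w" if "x \<in> insert 0 (set_tree bt)" for x
  proof -
    have "x = 0 \<or> x < \<rho>" using that by (simp add: set_bt)
    then show ?thesis using less_trans[of x \<rho>] assms(7) by (metis zero_less_numeral zero_less_power)
  qed
  have k: "lchild bt a < 2 ^ w" "rchild bt a < 2 ^ w" for a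
    by (rule k0, rule lchild_in) (rule k0, rule rchild_in)
  have nd: "(case ?ts ! v of Lf a \<Rightarrow> 0 | Nd l r \<Rightarrow> node_id ?ts l) < 2 ^ w"
     "(case ?ts ! v of Lf a \<Rightarrow> 0 | Nd l r \<Rightarrow> node_id ?ts r) < 2 ^ w"
     "(case ?ts ! v of Lf a \<Rightarrow> st a | Nd l r \<Rightarrow> 0) < 2 ^ w" if "v < length ?ts" for v
  proof -
    have v: "?ts ! v \<in> set ?ts" using that by simp
    have "(case ?ts ! v of Lf a \<Rightarrow> 0 | Nd l r \<Rightarrow> node_id ?ts l) < 2 ^ w \<and>
       (case ?ts ! v of Lf a \<Rightarrow> 0 | Nd l r \<Rightarrow> node_id ?ts r) < 2 ^ w \<and>
       (case ?ts ! v of Lf a \<Rightarrow> st a | Nd l r \<Rightarrow> 0) < 2 ^ w"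
    proof (cases "?ts ! v")
      case (Lf a)
      then have "a \<in> leaves t" using v leaf_in_subtree_list by metis
      then have "a \<le> \<rho>" by (simp add: assms(2))
      from assms(6)[OF this] show ?thesis by (simp add: Lf)
    next
      case (Nd l r)
      note lr = subtree_list_children[OF v[unfolded Nd]]
      show ?thesis using id[OF lr(1)] id[OF lr(2)] by (simp add: Nd)
    qed
    then show "(case ?ts ! v of Lf a \<Rightarrow> 0 | Nd l r \<Rightarrow> node_id ?ts l) < 2 ^ w"
      "(case ?ts ! v of Lf a \<Rightarrow> 0 | Nd l r \<Rightarrow> node_id ?ts r) < 2 ^ w"
      "(case ?ts ! v of Lf a \<Rightarrow> st a | Nd l r \<Rightarrow> 0) < 2 ^ w"
      by blast+
  qed
  have par: "parent_of ?ts v < 2 ^ w" if "v < length ?ts" for v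
    using parent_of_less[OF assms(1) that] assms(5) by simp
  have side: "(of_bool (is_right ?ts v) :: nat) < 2 ^ w" if "v < length ?ts" for v
    using assms(5) that by (auto simp: of_bool_def intro: le_less_trans)
  have leaf: "node_id ?ts (Lf a) < 2 ^ w" if "a < \<rho>" for a
    using that assms(2) leaf_in_subtree_list by (intro id) auto
  have start: "st a < 2 ^ w" if "a < \<rho> + 1" for a using assms(6) that by simp
  show ?thesis using assms(8)
    unfolding tree_arrays_def Let_def
    by (simp only: list.set insert_iff empty_iff)
      (elim disjE FalseE; simp only:; intro words_map; rule nd c o k par side leaf start; assumption?)
qed

definition encode :: "nat \<Rightarrow> nat \<Rightarrow> nat \<Rightarrow> nat \<Rightarrow> (nat \<Rightarrow> nat) \<Rightarrow> mtree \<Rightarrow> (nat \<Rightarrow> nat) \<Rightarrow> nat tree \<Rightarrow> nat \<Rightarrow> nat list" where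
  "encode w b f n rn t st bt \<rho> =
    (let K2 = f * f; K1 = b * K2 in
     layout [w, b, K2, K1, f, b * b, K1 * K1, root_key bt]
       (bit_arrays w b f K1 K2 (tree_bits n rn t) @ tree_arrays n rn t st bt \<rho>))"

lemma length_bit_arrays: "length (bit_arrays w b f K1 K2 B) = 14"
  by (simp add: bit_arrays_def select_arrays_def)

lemma length_tree_arrays: "length (tree_arrays n rn t st bt \<rho>) = 13"
  by (simp add: tree_arrays_def Let_def)

lemma perm_index_encode:
  fixes f b w n rn t
  defines "B \<equiv> tree_bits n rn t"
  assumes "f * f * (f * f) \<le> b" "b * b * b \<le> 2 ^ f" "1 \<le> f" "b < w" "8 \<le> w"
    and addr: "2 * (length B + b) < 2 ^ w" and len: "length (encode w b f n rn t st bt \<rho>) < 2 ^ w"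
    and "distinct_leaves t" "leaves t = {..<\<rho>}" "\<And>j. j < n \<Longrightarrow> rn j < \<rho>" "inorder bt = [0..<\<rho>]"
    and "mono st" "st \<rho> = n" "n + 1 < 2 ^ w"
  shows "perm_index w (encode w b f n rn t st bt \<rho>) b f (b * (f * f)) (f * f) B n rn t st bt \<rho>"
proof -
  let ?K2 = "f * f"
  let ?K1 = "b * ?K2"
  define hs where "hs = [w, b, ?K2, ?K1, f, b * b, ?K1 * ?K1, root_key bt]"
  define As where "As = bit_arrays w b f ?K1 ?K2 B @ tree_arrays n rn t st bt \<rho>"
  define D where "D = layout hs As"
  have D: "D = encode w b f n rn t st bt \<rho>"
    by (simp add: D_def encode_def hs_def As_def B_def Let_def)
  have lhs: "length hs = 8" and lAs: "length As = 27"
    by (simp_all add: hs_def As_def length_bit_arrays length_tree_arrays)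
  have lenD: "length D < 2 ^ w" using len by (simp add: D)
  have subtree_list_len: "length (subtree_list t) \<le> length D"
  proof -
    have "length (As ! 14) = length (subtree_list t)"
      by (simp add: As_def nth_append length_bit_arrays tree_arrays_def Let_def)
    then show ?thesis using concat_take_le[of 14 As] lAs by (simp add: D_def length_layout)
  qed
  have \<rho>_len: "\<rho> \<le> length D"
  proof -
    have "length (As ! 23) = \<rho>"
      by (simp add: As_def nth_append length_bit_arrays tree_arrays_def Let_def)
    then show ?thesis using concat_take_le[of 23 As] lAs by (simp add: D_def length_layout)
  qed
  have fb: "?K2 \<le> b" "f \<le> b" "1 \<le> b"
  proof -
    have "?K2 \<le> ?K2 * ?K2" "f \<le> ?K2" using assms(4) by simp_all
    then show "?K2 \<le> b" "f \<le> b" "1 \<le> b" using assms(2,4) by linarith+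
  qed
  have w2: "(2::nat) ^ f < 2 ^ w" using fb assms by simp
  have KK: "?K1 * ?K1 \<le> 2 ^ f"
  proof -
    have "?K1 * ?K1 = b * b * (?K2 * ?K2)" by simp
    also have "\<dots> \<le> b * b * b" using assms(2) by (intro mult_left_mono) auto
    also note assms(3)
    finally show ?thesis .
  qed
  have bb: "b * b \<le> 2 ^ f" using order_trans[OF _ assms(3), of "b * b"] fb by simp
  have K1le: "?K1 \<le> ?K1 * ?K1" using fb assms(4) by simp
  have bw: "b < 2 ^ w" using assms less_exp[of w] by simp
  have set_bt: "set_tree bt = {..<\<rho>}" using arg_cong[OF assms(12), of set] by (simp add: atLeast0LessThan)
  have "root_key bt = 0 \<or> root_key bt < \<rho>" using root_key_in[of bt] by (simp add: set_bt)
  then have rk: "root_key bt < 2 ^ w" using lenD \<rho>_len by (metis le_trans less_imp_le_nat linorder_not_le zero_less_numeral zero_less_power)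
  have "?K1 * ?K1 < 2 ^ w" "b * b < 2 ^ w" "?K1 < 2 ^ w" "?K2 < 2 ^ w" "f < 2 ^ w"
    using le_less_trans[OF KK w2] le_less_trans[OF bb w2] K1le fb(1,2) bw by linarith+
  then have "words w hs"
    using bw less_exp[of w] rk unfolding hs_def words_def by (simp del: mult.assoc)
  moreover have "words w A" if "A \<in> set As" for A
  proof -
    have "st a < 2 ^ w" if "a \<le> \<rho>" for a
      using monoD[OF assms(13) that] assms(14,15) by simp
    then show ?thesis using that words_bit_arrays[of B w b A f ?K1 ?K2] addr bw fb(3)
        words_tree_arrays[of t \<rho> bt n rn w st A] assms lenD subtree_list_len \<rho>_len
      unfolding As_def B_def by (auto simp del: mult.assoc)
  qed
  ultimately have words: "words w D" using lenD unfolding D_def by (intro words_layout)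
  have hdr: "D ! j = hs ! j" if "j < 8" for j
    using that layout_header[of j hs As] lhs by (simp add: D_def)
  interpret ram w D
  proof
    show "D \<noteq> []" using lhs by (auto simp: D_def layout_def)
    show "D ! 0 = w" using hdr[of 0] by (simp add: hs_def)
  qed (use words lenD assms(6) in auto)
  have st: "stored (8 + j) (As ! j)" if "j < 27" for j
    using that lhs lAs concat_take_le[of j As] layout_base[of j As hs] layout_entry[of j As _ hs]
    unfolding stored_def unfolding D_def by (simp add: length_layout)
  have st_bit_select: "stored (select_base c + j) (select_arrays w b f ?K1 ?K2 c B ! j)" if "j < 5" for c j
  proof (cases c)
    case True
    have "As ! (9 + j) = select_arrays w b f ?K1 ?K2 True B ! j"
      using that by (simp add: As_def bit_arrays_def nth_append select_arrays_def nth_Cons')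
    with st[of "9 + j"] True that show ?thesis by (simp add: select_base_def)
  next
    case False
    have "As ! (4 + j) = select_arrays w b f ?K1 ?K2 False B ! j"
      using that by (simp add: As_def bit_arrays_def nth_append select_arrays_def nth_Cons')
    with st[of "4 + j"] False that show ?thesis by (simp add: select_base_def)
  qed
  have st_tree: "stored (22 + j) (tree_arrays n rn t st bt \<rho> ! j)" if "j < 13" for j
  proof -
    have "As ! (14 + j) = tree_arrays n rn t st bt \<rho> ! j"
      by (simp add: As_def nth_append length_bit_arrays)
    with st[of "14 + j"] that show ?thesis by simp
  qed
  have As: "As ! 0 = pack w (length B + b) (bit_fun B)" "As ! 1 = rank_super b B"
    "As ! 2 = pack_fields w f (rank_block f b B)" "As ! 3 = rank_table b"
    by (simp_all add: As_def bit_arrays_def)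
  have "perm_index w D b f ?K1 ?K2 B n rn t st bt \<rho>"
  proof unfold_locales
    show "D ! 1 = b" "D ! 2 = ?K2" "D ! 3 = ?K1" "D ! 4 = f" "D ! 5 = b * b" "D ! 6 = ?K1 * ?K1" "D ! 7 = root_key bt"
      by (subst hdr; simp add: hs_def)+
    show "7 \<le> length D" "7 < length D" using lhs by (simp_all add: D_def length_layout)
    show "stored 8 (pack w (length B + b) (bit_fun B))" "stored 9 (rank_super b B)"
      "stored 10 (pack_fields w f (rank_block f b B))" "stored 11 (rank_table b)"
      using st[of 0] st[of 1] st[of 2] st[of 3] As by simp_all
    show "stored (select_base c) (select_super ?K1 c B)"
      "stored (select_base c + 1) (select_super_explicit ?K1 c B)"
      "stored (select_base c + 2) (pack_fields w f (select_block f ?K1 ?K2 c B))"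
      "stored (select_base c + 3) (pack_fields w f (select_block_explicit f ?K1 ?K2 c B))"
      "stored (select_base c + 4) (select_table c b)" for c
      using st_bit_select[of 0 c] st_bit_select[of 1 c] st_bit_select[of 2 c] st_bit_select[of 3 c] st_bit_select[of 4 c]
      by (simp_all add: select_arrays_def)
  qed (use assms st_tree in \<open>simp_all add: B_def\<close>)
  then show ?thesis by (simp add: D)
qed

text \<open>Nine arrays over the \<open>2 * \<rho> - 1\<close> nodes and four over the runs give
  \<open>22 * \<rho>\<close>; the 9 on the left avoids the subtraction. The final 64 covers the
  header, the extra words of packed arrays and the extra entries.\<close>

lemma length_encode:
  assumes "distinct_leaves t" "leaves t = {..<\<rho>}" and m: "m = length (tree_bits n rn t)"
    and "K2 = f * f" "K1 = b * K2"
  shows "length (encode w b f n rn t st bt \<rho>) + 9 \<le>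
    (m + b) div w + m div (b * b) + (m div b + 1) * f div w + 3 * (2 ^ b * b) +
    4 * (m div K1) + 2 * K1 + 2 * ((m div K2 + 1) * f div w) + 2 * ((m div K2 + K2 + 1) * f div w) + 22 * \<rho> + 64"
proof -
  have "length (subtree_list t) + 1 = 2 * \<rho>" using length_subtree_list[OF assms(1)] assms(2) by simp
  then show ?thesis using assms(3-5)
    by (simp add: encode_def Let_def length_layout bit_arrays_def select_arrays_def tree_arrays_def pack_fields_def
       pack_def rank_super_def rank_block_def rank_table_def select_super_def select_super_explicit_def
       select_block_def select_block_explicit_def select_table_def del: upt_Suc)
qed

section \<open>Runs and entropy\<close>

text \<open>Telescoping: prefix sums of the run lengths are the run boundaries.\<close>

lemma sum_list_take_differences:
  fixes ds :: "nat list"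
  assumes "sorted (a # ds @ [n])" "k \<le> length ds + 1"
  shows "a + sum_list (take k (map2 (-) (ds @ [n]) (a # ds))) = (a # ds @ [n]) ! k"
  using assms
proof (induction ds arbitrary: a k)
  case Nil
  then show ?case by (cases k) auto
next
  case (Cons d ds)
  show ?case
  proof (cases k)
    case (Suc k')
    have "d + sum_list (take k' (map2 (-) (ds @ [n]) (d # ds))) = (d # ds @ [n]) ! k'"
      using Cons.prems Suc by (intro Cons.IH) auto
    then show ?thesis using Suc Cons.prems by simp
  qed simp
qed

definition run_start :: "nat \<Rightarrow> (nat \<Rightarrow> nat) \<Rightarrow> nat \<Rightarrow> nat" where
  "run_start n \<pi> a = sum_list (take a (run_lengths n \<pi>))"

definition run_of :: "nat \<Rightarrow> (nat \<Rightarrow> nat) \<Rightarrow> nat \<Rightarrow> nat" where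
  "run_of n \<pi> i = (LEAST a. i < run_start n \<pi> (Suc a))"

definition value_run :: "nat \<Rightarrow> (nat \<Rightarrow> nat) \<Rightarrow> nat \<Rightarrow> nat" where
  "value_run n \<pi> j = run_of n \<pi> (inv \<pi> (Suc j) - 1)"

section \<open>Runs as increasing intervals of positions\<close>

text \<open>Positions and values are counted from 0 from here on.\<close>

locale runs =
  fixes n :: nat and \<pi> :: "nat \<Rightarrow> nat"
  assumes n_pos: "1 \<le> n" and perm: "\<pi> permutes {1..n}"
begin

abbreviation "R \<equiv> run_lengths n \<pi>"
abbreviation "\<rho> \<equiv> num_runs n \<pi>"
abbreviation "st \<equiv> run_start n \<pi>"
abbreviation "rn \<equiv> value_run n \<pi>"

definition "P i = \<pi> (Suc i) - 1"
definition "Q j = inv \<pi> (Suc j) - 1"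

lemma in_range: "i < n \<Longrightarrow> 1 \<le> \<pi> (Suc i) \<and> \<pi> (Suc i) \<le> n"
  using permutes_in_image[OF perm, of "Suc i"] by auto

lemma in_range_inv: "j < n \<Longrightarrow> 1 \<le> inv \<pi> (Suc j) \<and> inv \<pi> (Suc j) \<le> n"
  using permutes_in_image[OF permutes_inv[OF perm], of "Suc j"] by auto

lemma Suc_P: "i < n \<Longrightarrow> Suc (P i) = \<pi> (Suc i)" and P_less: "i < n \<Longrightarrow> P i < n"
  using in_range[of i] by (auto simp: P_def)

lemma Suc_Q: "j < n \<Longrightarrow> Suc (Q j) = inv \<pi> (Suc j)" and Q_less: "j < n \<Longrightarrow> Q j < n"
  using in_range_inv[of j] by (auto simp: Q_def)

lemma Q_P: "i < n \<Longrightarrow> Q (P i) = i"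
  using Suc_P permutes_inverses(2)[OF perm] by (simp add: Q_def)

lemma P_Q: "j < n \<Longrightarrow> P (Q j) = j"
  using Suc_Q permutes_inverses(1)[OF perm] by (simp add: P_def)

lemma st_mono: "mono st"
proof (rule monoI)
  fix a a' :: nat assume "a \<le> a'"
  then have "take a' R = take a R @ take (a' - a) (drop a R)"
    using take_add[of a "a' - a" R] by simp
  then show "st a \<le> st a'" by (simp add: run_start_def)
qed

lemma st_0: "st 0 = 0" and st_\<rho>: "st \<rho> = n"
  by (simp_all add: run_start_def sum_list_run_lengths length_run_lengths[symmetric])

lemma st_Suc: "a < \<rho> \<Longrightarrow> st (Suc a) = st a + R ! a"
  by (simp add: run_start_def take_Suc_conv_app_nth length_run_lengths)

text \<open>With sentinels 0 and \<open>n\<close>, entry \<open>a\<close> is the 0-based start of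
  run \<open>a\<close>, and the last entry closes the last run.\<close>

definition "breaks = 0 # sorted_list_of_set (down_steps n \<pi>) @ [n]"

lemma breaks_strict: "sorted_wrt (<) breaks"
  using n_pos unfolding breaks_def by (auto simp: sorted_wrt_append) (auto simp: down_steps_def)

lemma st_breaks: "a \<le> \<rho> \<Longrightarrow> st a = breaks ! a"
proof -
  assume a: "a \<le> \<rho>"
  have "sorted breaks" using breaks_strict strict_sorted_imp_sorted by blast
  then have "0 + sum_list (take a R) = breaks ! a"
    unfolding run_lengths_def Let_def breaks_def using a
    by (intro sum_list_take_differences) (auto simp: num_runs_def)
  then show ?thesis by (simp add: run_start_def)
qed

lemma length_breaks: "length breaks = Suc \<rho>"
  by (simp add: breaks_def num_runs_def)

lemma R_pos: "a < \<rho> \<Longrightarrow> 1 \<le> R ! a"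
  using sorted_wrt_nth_less[OF breaks_strict, of a "Suc a"] st_breaks[of a] st_breaks[of "Suc a"] st_Suc[of a]
  by (simp add: length_breaks)

text \<open>A down step at the 1-based position \<open>p\<close> ends a run just before the 0-based
  position \<open>p\<close>, so \<open>p\<close> is an entry of \<open>breaks\<close>; none lies
  strictly between two consecutive entries.\<close>

lemma no_down_step:
  assumes "a < \<rho>" "st a < p" "p < st (Suc a)"
  shows "p \<notin> down_steps n \<pi>"
proof
  assume p: "p \<in> down_steps n \<pi>"
  then obtain k where k: "k < card (down_steps n \<pi>)" "sorted_list_of_set (down_steps n \<pi>) ! k = p"
    by (metis finite_down_steps in_set_conv_nth length_sorted_list_of_set set_sorted_list_of_set)
  then have kp: "breaks ! Suc k = p" "Suc k < length breaks"
    by (auto simp: breaks_def nth_append)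
  have 1: "breaks ! a < p" "p < breaks ! Suc a" using assms st_breaks[of a] st_breaks[of "Suc a"] by auto
  have "\<not> Suc k \<le> a"
  proof
    assume "Suc k \<le> a"
    then have "breaks ! Suc k \<le> breaks ! a"
      using sorted_wrt_nth_less[OF breaks_strict, of "Suc k" a] assms(1) length_breaks
      by (cases "Suc k = a") auto
    then show False using 1 kp by simp
  qed
  moreover have "\<not> a < Suc k"
  proof
    assume "a < Suc k"
    then have "breaks ! Suc a \<le> breaks ! Suc k"
      using sorted_wrt_nth_less[OF breaks_strict, of "Suc a" "Suc k"] kp(2)
      by (cases "a = k") auto
    then show False using 1 kp by simp
  qed
  ultimately show False by simp
qed

lemma P_increasing:
  assumes "a < \<rho>" "st a \<le> i" "i < i'" "i' < st (Suc a)"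
  shows "P i < P i'"
proof -
  have n: "st (Suc a) \<le> n" using monoD[OF st_mono, of "Suc a" \<rho>] assms(1) st_\<rho> by simp
  have "P i < P (i + Suc d)" if "i + Suc d < st (Suc a)" for d
    using that
  proof (induction d)
    case 0
    then have "Suc i \<notin> down_steps n \<pi>" using assms by (intro no_down_step) auto
    then have "\<pi> (Suc i) \<le> \<pi> (Suc (Suc i))" using 0 n by (simp add: down_steps_def)
    moreover have "\<pi> (Suc i) \<noteq> \<pi> (Suc (Suc i))" using permutes_inj[OF perm] by (simp add: inj_eq)
    ultimately show ?case using Suc_P[of i] Suc_P[of "Suc i"] 0 n by simp
  next
    case (Suc d)
    let ?k = "i + Suc d"
    have "Suc ?k \<notin> down_steps n \<pi>" using assms Suc.prems by (intro no_down_step) auto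
    then have "\<pi> (Suc ?k) \<le> \<pi> (Suc (Suc ?k))" using Suc.prems n by (simp add: down_steps_def)
    moreover have "\<pi> (Suc ?k) \<noteq> \<pi> (Suc (Suc ?k))" using permutes_inj[OF perm] by (simp add: inj_eq)
    ultimately have "P ?k < P (Suc ?k)" using Suc_P[of ?k] Suc_P[of "Suc ?k"] Suc.prems n by simp
    then show ?case using Suc by simp
  qed
  from this[of "i' - Suc i"] show ?thesis using assms by simp
qed

lemma run_of:
  assumes "i < n"
  shows "run_of n \<pi> i < \<rho>" "st (run_of n \<pi> i) \<le> i" "i < st (Suc (run_of n \<pi> i))"
proof -
  have \<rho>: "Suc (\<rho> - 1) = \<rho>" by (simp add: num_runs_def)
  then have ex: "i < st (Suc (\<rho> - 1))" using assms st_\<rho> by simp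
  show "i < st (Suc (run_of n \<pi> i))" unfolding run_of_def using ex by (rule LeastI)
  have "run_of n \<pi> i \<le> \<rho> - 1" unfolding run_of_def using ex by (rule Least_le)
  then show "run_of n \<pi> i < \<rho>" using \<rho> by simp
  show "st (run_of n \<pi> i) \<le> i"
  proof (cases "run_of n \<pi> i")
    case (Suc a)
    then have "\<not> i < st (Suc a)" using not_less_Least[of a "\<lambda>a. i < st (Suc a)"] by (simp add: run_of_def)
    then show ?thesis using Suc by simp
  qed (simp add: st_0)
qed

lemma run_of_eq: "st a \<le> i \<Longrightarrow> i < st (Suc a) \<Longrightarrow> run_of n \<pi> i = a"
proof -
  assume a: "st a \<le> i" "i < st (Suc a)"
  show ?thesis unfolding run_of_def
  proof (rule Least_equality[where P = "\<lambda>a. i < st (Suc a)", OF a(2)])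
    fix b assume "i < st (Suc b)"
    then show "a \<le> b" using a monoD[OF st_mono, of "Suc b" a] by (cases "a \<le> b") auto
  qed
qed

lemma rn_eq: "rn j = run_of n \<pi> (Q j)"
  by (simp add: value_run_def Q_def)

lemma rn_less: "j < n \<Longrightarrow> rn j < \<rho>"
  using run_of(1)[OF Q_less] by (simp add: rn_eq)

text \<open>Because a run is increasing, the smaller values in the run of \<open>j\<close> are
  exactly those at its earlier positions. This is the only place where the order inside runs enters
  the answer to a query.\<close>

lemma node_index_leaf:
  assumes "j < n"
  shows "st (rn j) + node_index rn (Lf (rn j)) j = Q j"
proof -
  define a i where "a = rn j" and "i = Q j"
  have i: "i < n" "P i = j" using assms Q_less P_Q by (auto simp: i_def)
  have a: "a < \<rho>" "st a \<le> i" "i < st (Suc a)"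
    using run_of[OF i(1)] by (auto simp: a_def i_def rn_eq)
  have "{j'. j' < j \<and> rn j' = a} = P ` {st a..<i}"
  proof (intro equalityI subsetI)
    fix j' assume "j' \<in> {j'. j' < j \<and> rn j' = a}"
    then have j': "j' < j" "rn j' = a" by auto
    then have q: "Q j' < n" "P (Q j') = j'" using assms Q_less P_Q by auto
    have r: "st a \<le> Q j'" "Q j' < st (Suc a)" using run_of[OF q(1)] j' by (auto simp: rn_eq)
    have "Q j' < i"
    proof (rule ccontr)
      assume "\<not> Q j' < i"
      then consider "Q j' = i" | "i < Q j'" by linarith
      then show False
      proof cases
        case 1
        then show False using q i j' by simp
      next
        case 2
        from P_increasing[OF a(1,2) 2 r(2)] show False using q i j' by simp
      qed
    qed
    then show "j' \<in> P ` {st a..<i}" using q r by (intro image_eqI[of _ _ "Q j'"]) auto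
  next
    fix j' assume "j' \<in> P ` {st a..<i}"
    then obtain i' where i': "st a \<le> i'" "i' < i" "j' = P i'" by auto
    then have "run_of n \<pi> i' = a" using a by (intro run_of_eq) auto
    moreover have "P i' < P i" using P_increasing[OF a(1) i'(1,2)] a by simp
    ultimately show "j' \<in> {j'. j' < j \<and> rn j' = a}" using i' i Q_P[of i'] by (simp add: rn_eq)
  qed
  moreover have "inj_on P {st a..<i}" using Q_P i by (intro inj_on_inverseI[of _ Q]) auto
  ultimately have "node_index rn (Lf a) j = i - st a" by (simp add: node_index_def card_image)
  then show ?thesis using a by (simp add: a_def i_def)
qed

lemma run_size: "a < \<rho> \<Longrightarrow> run_size n rn a = R ! a"
proof -
  assume a: "a < \<rho>"
  have n: "st (Suc a) \<le> n" using monoD[OF st_mono, of "Suc a" \<rho>] a st_\<rho> by simp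
  have "{j. j < n \<and> rn j = a} = P ` {st a..<st (Suc a)}"
  proof (intro equalityI subsetI)
    fix j assume "j \<in> {j. j < n \<and> rn j = a}"
    then show "j \<in> P ` {st a..<st (Suc a)}"
      using run_of[OF Q_less, of j] P_Q[of j] by (intro image_eqI[of _ _ "Q j"]) (auto simp: rn_eq)
  next
    fix j assume "j \<in> P ` {st a..<st (Suc a)}"
    then obtain i where i: "st a \<le> i" "i < st (Suc a)" "j = P i" by auto
    then show "j \<in> {j. j < n \<and> rn j = a}"
      using n run_of_eq[OF i(1,2)] P_less[of i] Q_P[of i] by (simp add: rn_eq)
  qed
  moreover have "inj_on P {st a..<st (Suc a)}" using Q_P n by (intro inj_on_inverseI[of _ Q]) auto
  ultimately show ?thesis using st_Suc[OF a] by (simp add: run_size_def card_image)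
qed

lemma sum_R: "(\<Sum>a<\<rho>. R ! a) = n"
  using sum_list_run_lengths[of n \<pi>] by (simp add: sum_list_sum_nth length_run_lengths atLeast0LessThan)

lemma \<rho>_bounds: "1 \<le> \<rho>" "\<rho> \<le> n"
proof -
  show "1 \<le> \<rho>" by (simp add: num_runs_def)
  have "(\<Sum>a<\<rho>. 1) \<le> (\<Sum>a<\<rho>. R ! a)" using R_pos by (intro sum_mono) auto
  then show "\<rho> \<le> n" by (simp add: sum_R)
qed

section \<open>Entropy and the mixed weights\<close>

abbreviation "H \<equiv> seq_entropy R"

lemma R_le: "a < \<rho> \<Longrightarrow> R ! a \<le> n"
  using member_le_sum[of a "{..<\<rho>}" "\<lambda>a. R ! a"] sum_R by simp

lemma H_sum: "real n * H = (\<Sum>a<\<rho>. real (R ! a) * log 2 (real n / real (R ! a)))"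
proof -
  have "H = (\<Sum>a<\<rho>. real (R ! a) / real n * log 2 (real n / real (R ! a)))"
    using sum_list_run_lengths[of n \<pi>]
    by (simp add: seq_entropy_def Let_def sum_list_sum_nth length_run_lengths atLeast0LessThan)
  then show ?thesis using n_pos by (simp add: sum_distrib_left)
qed

lemma H_nonneg: "0 \<le> H"
proof -
  have "0 \<le> real n * H" unfolding H_sum
  proof (intro sum_nonneg mult_nonneg_nonneg)
    fix a assume "a \<in> {..<\<rho>}"
    then have "1 \<le> R ! a" "R ! a \<le> n" using R_pos R_le by auto
    then show "0 \<le> log 2 (real n / real (R ! a))" by simp
  qed simp
  then show ?thesis using n_pos by (simp add: zero_le_mult_iff)
qed

text \<open>Mixing the run weights with the uniform weights costs only one bit per element and bounds all
  depths by \<open>log 2 \<rho> + 2\<close>.\<close>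

definition "weight a = (real (R ! a) / real n + 1 / real \<rho>) / 2"

lemma weight_pos: "0 < weight a"
proof -
  have "0 < 1 / real \<rho>" "0 \<le> real (R ! a) / real n" using \<rho>_bounds by auto
  then show ?thesis unfolding weight_def by (intro divide_pos_pos add_nonneg_pos) auto
qed

lemma sum_weight: "(\<Sum>a<\<rho>. weight a) = 1"
proof -
  have "(\<Sum>a<\<rho>. weight a) = ((\<Sum>a<\<rho>. real (R ! a)) / real n + (\<Sum>a<\<rho>. 1 / real \<rho>)) / 2"
    by (simp add: weight_def sum.distrib sum_divide_distrib add_divide_distrib)
  also have "(\<Sum>a<\<rho>. real (R ! a)) = real n" using sum_R by (metis of_nat_sum)
  finally show ?thesis using n_pos \<rho>_bounds by simp
qed

text \<open>Each upper bound comes from dropping one summand of the mixture; the factor 1/2 of the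
  mixture is the additive 1.\<close>

lemma log_weight:
  assumes "a < \<rho>"
  shows "0 \<le> log 2 (1 / weight a)" "log 2 (1 / weight a) \<le> 1 + log 2 (real n / real (R ! a))"
    "log 2 (1 / weight a) \<le> 1 + log 2 (real \<rho>)"
proof -
  have "weight a \<le> 1"
    using member_le_sum[of a "{..<\<rho>}" weight] sum_weight weight_pos assms by (simp add: less_imp_le)
  then show "0 \<le> log 2 (1 / weight a)" using weight_pos[of a] by simp
  have r: "1 \<le> R ! a" using R_pos[OF assms] .
  have "log 2 (1 / weight a) \<le> log 2 (2 * (real n / real (R ! a)))"
  proof -
    have "real (R ! a) / real n / 2 \<le> weight a" using \<rho>_bounds by (simp add: weight_def)
    then have "1 / weight a \<le> 1 / (real (R ! a) / real n / 2)"
      using r n_pos weight_pos[of a] by (intro divide_left_mono) auto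
    also have "\<dots> = 2 * (real n / real (R ! a))" by simp
    finally show ?thesis using weight_pos[of a] r n_pos by simp
  qed
  also have "\<dots> = 1 + log 2 (real n / real (R ! a))" using r n_pos by (subst log_mult) auto
  finally show "log 2 (1 / weight a) \<le> 1 + log 2 (real n / real (R ! a))" .
  have "log 2 (1 / weight a) \<le> log 2 (2 * real \<rho>)"
  proof -
    have "1 / real \<rho> / 2 \<le> weight a" using \<rho>_bounds by (simp add: weight_def)
    then have "1 / weight a \<le> 1 / (1 / real \<rho> / 2)"
      using \<rho>_bounds weight_pos[of a] by (intro divide_left_mono) auto
    also have "\<dots> = 2 * real \<rho>" by simp
    finally show ?thesis using weight_pos[of a] \<rho>_bounds by simp
  qed
  also have "\<dots> = 1 + log 2 (real \<rho>)" using \<rho>_bounds by (subst log_mult) auto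
  finally show "log 2 (1 / weight a) \<le> 1 + log 2 (real \<rho>)" .
qed

lemma merge_tree_exists:
  "\<exists>t. distinct_leaves t \<and> leaves t = {..<\<rho>} \<and> (\<forall>a<\<rho>. real (leaf_depth t a) \<le> 1 + log 2 (1 / weight a))"
proof -
  \<comment> \<open>The lengths of the Shannon code for \<open>weight\<close>: the Kraft sum is at
    most the sum of the weights, and rounding up loses less than one bit.\<close>
  define len where "len a = nat \<lceil>log 2 (1 / weight a)\<rceil>" for a
  have len: "log 2 (1 / weight a) \<le> real (len a)" "real (len a) \<le> 1 + log 2 (1 / weight a)" if "a < \<rho>" for a
    using log_weight(1)[OF that] unfolding len_def by linarith+
  have "(1/2::real) ^ len a \<le> weight a" if "a < \<rho>" for a
  proof -
    have "1 / weight a \<le> 2 powr real (len a)"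
      using len(1)[OF that] weight_pos[of a] by (simp add: log_le_iff)
    then show ?thesis using weight_pos[of a] by (simp add: powr_realpow power_one_over field_simps)
  qed
  then have "(\<Sum>a<\<rho>. (1/2::real) ^ len a) \<le> (\<Sum>a<\<rho>. weight a)" by (intro sum_mono) auto
  then have "(\<Sum>a<\<rho>. (1/2::real) ^ len a) \<le> (1/2) ^ 0" by (simp add: sum_weight)
  moreover have "0 \<in> {..<\<rho>}" using \<rho>_bounds by simp
  then have "{..<\<rho>} \<noteq> {}" by blast
  ultimately obtain t where t: "distinct_leaves t" "leaves t = {..<\<rho>}" "\<forall>a\<in>{..<\<rho>}. leaf_depth t a + 0 \<le> len a"
    using kraft_tree[of "{..<\<rho>}" len 0] by blast
  have "real (leaf_depth t a) \<le> 1 + log 2 (1 / weight a)" if "a < \<rho>" for a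
  proof -
    have "real (leaf_depth t a) \<le> real (len a)" using t(3) that by simp
    then show ?thesis using len(2)[OF that] by (rule order_trans)
  qed
  then show ?thesis using t by blast
qed

lemma search_tree_exists:
  "\<exists>bt. inorder bt = [0..<\<rho>] \<and> (\<forall>a<\<rho>. real (key_depth bt a) \<le> log 2 (1 / weight a))"
proof -
  obtain bt where bt: "inorder bt = [0..<\<rho>]" "\<forall>a\<in>{0..<\<rho>}. 2 ^ key_depth bt a * weight a \<le> (\<Sum>x\<in>{0..<\<rho>}. weight x)"
    using weight_balanced_tree[of weight 0 \<rho>] weight_pos by blast
  have "real (key_depth bt a) \<le> log 2 (1 / weight a)" if "a < \<rho>" for a
  proof -
    have "2 ^ key_depth bt a * weight a \<le> 1" using bt(2) that sum_weight by (simp add: atLeast0LessThan)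
    then have "2 powr real (key_depth bt a) \<le> 1 / weight a"
      using weight_pos[of a] by (simp add: powr_realpow field_simps)
    then show ?thesis using weight_pos[of a] by (simp add: le_log_iff)
  qed
  then show ?thesis using bt by blast
qed

text \<open>The 2 consists of one bit for rounding the code lengths and one bit for mixing the
  weights.\<close>

lemma length_bits_le:
  assumes "distinct_leaves t" "leaves t = {..<\<rho>}" "\<forall>a<\<rho>. real (leaf_depth t a) \<le> 1 + log 2 (1 / weight a)"
  shows "real (length (tree_bits n rn t)) \<le> real n * (2 + H)"
proof -
  have "real (length (tree_bits n rn t)) = (\<Sum>a<\<rho>. real (R ! a) * real (leaf_depth t a))"
    unfolding tree_bits_def length_tree_bits[OF assms(1)] assms(2) by (simp add: run_size)
  also have "\<dots> \<le> (\<Sum>a<\<rho>. real (R ! a) * (2 + log 2 (real n / real (R ! a))))"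
  proof (intro sum_mono mult_left_mono)
    fix a assume "a \<in> {..<\<rho>}"
    then show "real (leaf_depth t a) \<le> 2 + log 2 (real n / real (R ! a))"
      using assms(3) log_weight(2)[of a] by force
  qed simp
  also have "\<dots> = 2 * real (\<Sum>a<\<rho>. R ! a) + real n * H"
    unfolding H_sum by (simp add: sum.distrib distrib_left sum_distrib_left mult.commute)
  also have "\<dots> = real n * (2 + H)" by (simp add: sum_R algebra_simps)
  finally show ?thesis .
qed

text \<open>This serves to bound the whole encoding by a power of \<open>n\<close>, so that it can
  be addressed by words.\<close>

lemma H_le: "H \<le> log 2 (real n)"
proof -
  have "real n * H \<le> (\<Sum>a<\<rho>. real (R ! a) * log 2 (real n))"
    unfolding H_sum
  proof (intro sum_mono mult_left_mono)
    fix a assume "a \<in> {..<\<rho>}"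
    then have "1 \<le> R ! a" using R_pos by simp
    moreover from this have "real n / real (R ! a) \<le> real n" using n_pos by (simp add: divide_le_eq)
    ultimately show "log 2 (real n / real (R ! a)) \<le> log 2 (real n)" using n_pos by simp
  qed simp
  also have "\<dots> = real (\<Sum>a<\<rho>. R ! a) * log 2 (real n)" by (simp add: sum_distrib_right)
  finally show ?thesis using n_pos by (simp add: sum_R)
qed

text \<open>Run \<open>a\<close> is hit by \<open>R ! a\<close> positions, so the average is taken
  with the very weights of the entropy, and mixing adds 1 per position.\<close>

lemma average_weight:
  "(\<Sum>i<n. log 2 (1 / weight (run_of n \<pi> i))) \<le> real n * (1 + H)"
proof -
  have "(\<Sum>i<n. log 2 (1 / weight (run_of n \<pi> i))) = (\<Sum>a<\<rho>. \<Sum>i\<in>{i\<in>{..<n}. run_of n \<pi> i = a}. log 2 (1 / weight (run_of n \<pi> i)))"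
    using run_of(1) by (intro sum.group[symmetric]) auto
  also have "\<dots> = (\<Sum>a<\<rho>. real (R ! a) * log 2 (1 / weight a))"
  proof (intro sum.cong refl)
    fix a assume "a \<in> {..<\<rho>}"
    then have a: "a < \<rho>" by simp
    have n: "st (Suc a) \<le> n" using monoD[OF st_mono, of "Suc a" \<rho>] a st_\<rho> by simp
    have "{i\<in>{..<n}. run_of n \<pi> i = a} = {st a..<st (Suc a)}"
    proof (intro equalityI subsetI)
      fix i assume "i \<in> {i\<in>{..<n}. run_of n \<pi> i = a}"
      then show "i \<in> {st a..<st (Suc a)}" using run_of(2,3)[of i] by force
    next
      fix i assume "i \<in> {st a..<st (Suc a)}"
      then show "i \<in> {i\<in>{..<n}. run_of n \<pi> i = a}" using run_of_eq[of a i] n by simp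
    qed
    then have "card {i\<in>{..<n}. run_of n \<pi> i = a} = R ! a" using st_Suc[OF a] by simp
    then show "(\<Sum>i\<in>{i\<in>{..<n}. run_of n \<pi> i = a}. log 2 (1 / weight (run_of n \<pi> i))) = real (R ! a) * log 2 (1 / weight a)"
      by (subst sum.cong[OF refl, of _ _ "\<lambda>_. log 2 (1 / weight a)"]) auto
  qed
  also have "\<dots> \<le> (\<Sum>a<\<rho>. real (R ! a) * (1 + log 2 (real n / real (R ! a))))"
    using log_weight(2) by (intro sum_mono mult_left_mono) auto
  also have "\<dots> = real (\<Sum>a<\<rho>. R ! a) + real n * H"
    unfolding H_sum by (simp add: sum.distrib distrib_left)
  also have "\<dots> = real n * (1 + H)" by (simp add: sum_R algebra_simps)
  finally show ?thesis .
qed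

lemma average_weight_inv:
  "(\<Sum>j<n. log 2 (1 / weight (rn j))) \<le> real n * (1 + H)"
proof -
  have "bij_betw Q {..<n} {..<n}"
    by (rule bij_betwI[where g = P]) (auto simp: P_less Q_less P_Q Q_P)
  then have "(\<Sum>j<n. log 2 (1 / weight (run_of n \<pi> (Q j)))) = (\<Sum>i<n. log 2 (1 / weight (run_of n \<pi> i)))"
    by (rule sum.reindex_bij_betw)
  then show ?thesis using average_weight by (simp add: rn_eq)
qed

end

section \<open>Space\<close>

lemma real_less_two_power: "real x < 2 ^ w \<Longrightarrow> x < 2 ^ w"
  by (simp flip: of_nat_less_iff)

text \<open>Everything proportional to the number of stored bits must be a fraction O(1/f) of it.
  Word-sized entries occur once per \<open>b * b\<close> or \<open>b * (f * f)\<close> bits, and the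
  bound \<open>8 * K * b\<close> on \<open>w\<close> absorbs one factor \<open>b\<close>;
  \<open>f\<close>-bit entries occur once per at least \<open>f * f\<close> bits.\<close>

lemma encode_size:
  fixes K :: real
  defines "m n rn t \<equiv> length (tree_bits n rn t)"
  assumes "distinct_leaves t" "leaves t = {..<\<rho>}" "f * f * (f * f) \<le> b" "1 \<le> f" "b \<le> w" "real w \<le> 8 * K * real b" "1 \<le> K"
  shows "real (w * length (encode w b f n rn t st bt \<rho>))
    \<le> real (m n rn t) * (1 + (40 * K + 5) / real f) + 77 * real w ^ 3 * 2 ^ b + 22 * real \<rho> * real w"
proof -
  define M where "M = m n rn t"
  let ?K2 = "f * f" and ?K1 = "b * (f * f)"
  have "?K2 \<le> ?K2 * ?K2" "f \<le> ?K2" "f * ?K2 \<le> ?K2 * ?K2" using assms(5) by simp_all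
  then have fb: "?K2 \<le> b" "f \<le> b" "f * ?K2 \<le> b" "1 \<le> b" "1 \<le> w" using assms(4-6) by linarith+
  have rf: "1 \<le> real f" "1 \<le> real b" "1 \<le> real w" "real f \<le> real b" "real f * real f \<le> real b" "real b \<le> real w"
    using assms(5,6) fb by (simp_all flip: of_nat_mult)
  have len: "length (encode w b f n rn t st bt \<rho>) \<le>
    (M + b) div w + M div (b * b) + (M div b + 1) * f div w + 3 * (2 ^ b * b) +
    4 * (M div ?K1) + 2 * ?K1 + 2 * ((M div ?K2 + 1) * f div w) + 2 * ((M div ?K2 + ?K2 + 1) * f div w) + 22 * \<rho> + 64"
    using length_encode[OF assms(2,3), of M n rn ?K2 f ?K1 b w st bt] by (simp add: M_def m_def)
  have dv: "real w * real (x div w) \<le> real x" for x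
    by (simp flip: of_nat_mult)
  have 1: "real w * real ((M + b) div w) \<le> real M + real w" using dv[of "M + b"] rf by simp
  have 2: "real w * real (M div (b * b)) \<le> 8 * K * (real M / real f)"
  proof -
    have "real w * real (M div (b * b)) \<le> (8 * K * real b) * (real M / (real b * real b))"
      using assms(7,8) of_nat_div_le_of_nat[of M "b * b"] by (intro mult_mono) auto
    also have "\<dots> = 8 * K * (real M / real b)" using rf by (simp add: field_simps)
    also have "\<dots> \<le> 8 * K * (real M / real f)" using rf assms(8) by (intro mult_left_mono divide_left_mono) auto
    finally show ?thesis .
  qed
  have quot: "real (M div y) * real f \<le> real M / real f" if "f * f \<le> y" for y
  proof -
    have y: "real f * real f \<le> real y" using that by (simp flip: of_nat_mult)
    have ff: "1 \<le> real f * real f" using mult_mono[of 1 "real f" 1 "real f"] rf by simp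
    have "real (M div y) * real f \<le> real M / (real f * real f) * real f"
    proof (intro mult_right_mono)
      have "real (M div y) \<le> real M / real y" by (rule of_nat_div_le_of_nat)
      also have "\<dots> \<le> real M / (real f * real f)" using y ff by (intro divide_left_mono mult_pos_pos) (use rf in linarith)+
      finally show "real (M div y) \<le> real M / (real f * real f)" .
    qed simp
    also have "\<dots> = real M / real f" using rf by (simp add: field_simps)
    finally show ?thesis .
  qed
  have 3: "real w * real ((M div b + 1) * f div w) \<le> real M / real f + real w"
    using dv[of "(M div b + 1) * f"] quot[OF fb(1)] rf by (simp add: distrib_right)
  have 4: "real w * real (M div ?K1) \<le> 8 * K * (real M / real f)"
  proof -
    have "real w * real (M div ?K1) \<le> (8 * K * real b) * (real M / (real b * (real f * real f)))"
      using assms(7,8) of_nat_div_le_of_nat[of M ?K1] by (intro mult_mono) auto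
    also have "\<dots> = 8 * K * (real M / (real f * real f))" using rf by (simp add: field_simps)
    also have "\<dots> \<le> 8 * K * (real M / real f)"
      using rf assms(8) mult_left_mono[of 1 "real f" "real f"]
      by (intro mult_left_mono divide_left_mono) (auto intro!: mult_pos_pos)
    finally show ?thesis .
  qed
  have 5: "real w * real ((M div ?K2 + 1) * f div w) \<le> real M / real f + real w"
    using dv[of "(M div ?K2 + 1) * f"] quot[of ?K2] rf by (simp add: distrib_right)
  have K2f: "real ?K2 * real f \<le> real w"
    using fb(3) assms(6) by (simp add: mult.commute flip: of_nat_mult)
  have 6: "real w * real ((M div ?K2 + ?K2 + 1) * f div w) \<le> real M / real f + 2 * real w"
    using dv[of "(M div ?K2 + ?K2 + 1) * f"] quot[of ?K2] rf K2f by (simp add: distrib_right)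
  \<comment> \<open>A common bound for what does not grow with the bit vector: the tables of
    \<open>2 ^ b * b\<close> words, the slack of \<open>K1\<close> slots and single words.\<close>
  define Z where "Z = real w ^ 3 * 2 ^ b"
  have pw: "real w \<le> real w ^ 3" "real w ^ 2 \<le> real w ^ 3" using rf by (auto intro: self_le_power power_increasing)
  have pb: "(1::real) \<le> 2 ^ b" by simp
  have Zw: "real w ^ 3 \<le> Z" unfolding Z_def using mult_left_mono[OF pb, of "real w ^ 3"] by simp
  have 7: "real w * (2 ^ b * real b) \<le> Z"
  proof -
    have "real w * (2 ^ b * real b) \<le> real w * (2 ^ b * real w)" using rf by (intro mult_left_mono) auto
    also have "\<dots> = real w ^ 2 * 2 ^ b" by (simp add: power2_eq_square)
    also have "\<dots> \<le> Z" unfolding Z_def using pw by (intro mult_right_mono) auto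
    finally show ?thesis .
  qed
  have 8: "real w * real ?K1 \<le> Z"
  proof -
    have "real ?K1 \<le> real w * real w" unfolding of_nat_mult using rf by (intro mult_mono) (auto intro: order_trans)
    then have "real w * real ?K1 \<le> real w * (real w * real w)" by (intro mult_left_mono) auto
    also have "\<dots> = real w ^ 3" by (simp add: power3_eq_cube)
    finally show ?thesis using Zw by simp
  qed
  have "real (w * length (encode w b f n rn t st bt \<rho>)) \<le> real w * (real ((M + b) div w) + real (M div (b * b)) + real ((M div b + 1) * f div w) + 3 * (2 ^ b * real b) +
    4 * real (M div ?K1) + 2 * real ?K1 + 2 * real ((M div ?K2 + 1) * f div w) + 2 * real ((M div ?K2 + ?K2 + 1) * f div w) + 22 * real \<rho> + 64)"
    unfolding of_nat_mult[of w]
  proof (intro mult_left_mono)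
    show "real (length (encode w b f n rn t st bt \<rho>)) \<le> real ((M + b) div w) + real (M div (b * b)) + real ((M div b + 1) * f div w) + 3 * (2 ^ b * real b) +
    4 * real (M div ?K1) + 2 * real ?K1 + 2 * real ((M div ?K2 + 1) * f div w) + 2 * real ((M div ?K2 + ?K2 + 1) * f div w) + 22 * real \<rho> + 64"
      using of_nat_mono[OF len, where 'a = real] by (simp only: of_nat_add of_nat_mult of_nat_power of_nat_numeral)
  qed simp
  also have "\<dots> = real w * real ((M + b) div w) + real w * real (M div (b * b)) + real w * real ((M div b + 1) * f div w)
     + 3 * (real w * (2 ^ b * real b)) + 4 * (real w * real (M div ?K1)) + 2 * (real w * real ?K1) 
     + 2 * (real w * real ((M div ?K2 + 1) * f div w)) + 2 * (real w * real ((M div ?K2 + ?K2 + 1) * f div w))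
     + 22 * real \<rho> * real w + 64 * real w"
    by (simp only: algebra_simps)
  also have "\<dots> \<le> real M + real w + 8 * K * (real M / real f) + (real M / real f + real w) + 3 * Z
     + 4 * (8 * K * (real M / real f)) + 2 * Z + 2 * (real M / real f + real w) + 2 * (real M / real f + 2 * real w)
     + 22 * real \<rho> * real w + 64 * real w"
    using 1 2 3 4 5 6 7 8 by (intro add_mono mult_left_mono) auto
  \<comment> \<open>One rank and four select directories with word-sized entries give
    \<open>40 * K\<close>; the packed ones, one for rank and four for select, give 5.\<close>
  also have "\<dots> = real M + (40 * K + 5) * (real M / real f) + 5 * Z + 22 * real \<rho> * real w + 72 * real w"
    by (simp add: algebra_simps)
  \<comment> \<open>As \<open>real w \<le> Z\<close>, the coefficients 5 and 72 add up to
    77.\<close>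
  also have "\<dots> \<le> real M * (1 + (40 * K + 5) / real f) + 77 * Z + 22 * real \<rho> * real w"
  proof -
    have "real M * (1 + (40 * K + 5) / real f) = real M + (40 * K + 5) * (real M / real f)"
      by (simp add: algebra_simps add_divide_distrib)
    then show ?thesis using pw(1) Zw by linarith
  qed
  finally show ?thesis by (simp add: M_def Z_def)
qed

section \<open>Query times\<close>

definition timely :: "nat \<Rightarrow> nat list \<Rightarrow> prog \<Rightarrow> nat \<Rightarrow> (nat \<Rightarrow> nat) \<Rightarrow> real \<Rightarrow> real \<Rightarrow> real \<Rightarrow> bool" where
  "timely w D p n g C \<rho> H \<longleftrightarrow> (\<exists>T :: nat \<Rightarrow> nat.
     (\<forall>i\<in>{1..n}. computes w D p i (g i) (T i) \<and> real (T i) \<le> C * (1 + log 2 \<rho>)) \<and>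
     measure_pmf.expectation (pmf_of_set {1..n}) (\<lambda>i. real (T i)) \<le> C * (1 + H))"

text \<open>One quantity \<open>L i\<close> controls both bounds: its maximum gives the worst case
  and its sum the average. Both \<open>2 + 2 * (1 + log 2 \<rho>)\<close> and
  \<open>2 + 2 * (1 + H)\<close> are at most four times the claimed expressions, hence
  \<open>4 * c\<close>.\<close>

lemma timelyI:
  assumes n: "1 \<le> n" and c: "0 \<le> c" "4 * c \<le> C" and "0 \<le> H" and \<rho>: "1 \<le> \<rho>"
    and comp: "\<And>i. i < n \<Longrightarrow> \<exists>t. computes w D p (Suc i) (g (Suc i)) t \<and> real t \<le> c * (2 + 2 * L i)"
    and L: "\<And>i. i < n \<Longrightarrow> 0 \<le> L i" "\<And>i. i < n \<Longrightarrow> L i \<le> 1 + log 2 \<rho>"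
    and avg: "(\<Sum>i<n. L i) \<le> real n * (1 + H)"
  shows "timely w D p n g C \<rho> H"
proof -
  have "\<forall>i\<in>{..<n}. \<exists>t. computes w D p (Suc i) (g (Suc i)) t \<and> real t \<le> c * (2 + 2 * L i)"
    using comp by auto
  then obtain T where T: "\<And>i. i < n \<Longrightarrow> computes w D p (Suc i) (g (Suc i)) (T i)"
      "\<And>i. i < n \<Longrightarrow> real (T i) \<le> c * (2 + 2 * L i)"
    unfolding bchoice_iff by auto
  have "real (T i) \<le> C * (1 + log 2 \<rho>)" if "i < n" for i
  proof -
    have lr: "0 \<le> log 2 \<rho>" using \<rho> by simp
    have "real (T i) \<le> c * (2 + 2 * L i)" by (rule T(2)[OF that])
    also have "\<dots> \<le> c * (4 * (1 + log 2 \<rho>))"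
      using L(2)[OF that] c(1) lr by (intro mult_left_mono) auto
    also have "\<dots> = (4 * c) * (1 + log 2 \<rho>)" by simp
    also have "\<dots> \<le> C * (1 + log 2 \<rho>)" using c(2) lr by (intro mult_right_mono) auto
    finally show ?thesis .
  qed
  moreover have "measure_pmf.expectation (pmf_of_set {1..n}) (\<lambda>i. real (T (i - 1))) \<le> C * (1 + H)"
  proof -
    have "(\<Sum>i\<in>{1..n}. real (T (i - 1))) = (\<Sum>i<n. real (T i))"
      by (simp add: sum.atLeast1_atMost_eq)
    also have "\<dots> \<le> (\<Sum>i<n. c * (2 + 2 * L i))"
      using T(2) by (intro sum_mono) auto
    also have "\<dots> = c * (2 * real n + 2 * (\<Sum>i<n. L i))"
      by (simp add: sum_distrib_left[symmetric] sum.distrib)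
    also have "\<dots> \<le> c * (2 * real n + 2 * (real n * (1 + H)))"
      using avg c(1) by (intro mult_left_mono) auto
    also have "\<dots> \<le> c * (4 * (real n * (1 + H)))"
      using c(1) \<open>0 \<le> H\<close> by (intro mult_left_mono) (auto simp: algebra_simps)
    also have "\<dots> = ((4 * c) * (1 + H)) * real n" by simp
    also have "\<dots> \<le> (C * (1 + H)) * real n"
      using c(2) \<open>0 \<le> H\<close> by (intro mult_right_mono) auto
    finally have "(\<Sum>i\<in>{1..n}. real (T (i - 1))) / real n \<le> C * (1 + H)"
      using n by (simp only: pos_divide_le_eq of_nat_0_less_iff)
    then show ?thesis using n by (subst integral_pmf_of_set) auto
  qed
  moreover have "computes w D p i (g i) (T (i - 1))" if "i \<in> {1..n}" for i
    using T(1)[of "i - 1"] that by (cases i) auto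
  ultimately show ?thesis unfolding timely_def
    by (intro exI[of _ "\<lambda>i. T (i - 1)"]) auto
qed

section \<open>The two encodings: tabulated and tree-based\<close>

definition small_fwd :: prog where
  "small_fwd = Assign 0 (Data (Bin Add (Const 1) (Reg 0)))"

definition small_bwd :: prog where
  "small_bwd = Assign 0 (Data (Bin Add (Bin Add (Const 1) (Data (Const 1))) (Reg 0)))"

text \<open>Word 0 tells the encodings apart: it is 0 in the tabulated one and the positive word
  length in the other.\<close>

definition fwd_prog :: prog where "fwd_prog = Cond (Data (Const 0)) fwd_main small_fwd"
definition bwd_prog :: prog where "bwd_prog = Cond (Data (Const 0)) bwd_main small_bwd"

text \<open>The 3 pays for the test of word 0.\<close>

definition time_factor :: real where
  "time_factor = real (query_cost + max_cost small_fwd + max_cost small_bwd + 3)"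

definition small_encode :: "nat \<Rightarrow> (nat \<Rightarrow> nat) \<Rightarrow> nat list" where
  "small_encode n \<pi> = 0 # n # map \<pi> [1..<Suc n] @ map (inv \<pi>) [1..<Suc n]"

context runs
begin

lemma small_case:
  fixes w :: nat
  assumes w: "2 * n + 2 < 2 ^ w" and C: "4 * time_factor \<le> C"
  defines "D \<equiv> small_encode n \<pi>"
  shows "words w D" "length D = 2 * n + 2" "timely w D fwd_prog n \<pi> C (real \<rho>) H" "timely w D bwd_prog n (inv \<pi>) C (real \<rho>) H"
proof -
  show len: "length D = 2 * n + 2" by (simp add: D_def small_encode_def)
  have rng: "\<pi> (Suc i) < 2 ^ w" "inv \<pi> (Suc i) < 2 ^ w" if "i < n" for i
    using in_range[OF that] in_range_inv[OF that] w by linarith+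
  show "words w D"
  proof -
    have "x < 2 ^ w" if x: "x \<in> \<pi> ` {1..<Suc n} \<union> inv \<pi> ` {1..<Suc n}" for x
    proof -
      obtain i where "i \<in> {1..<Suc n}" "x = \<pi> i \<or> x = inv \<pi> i" using x by blast
      then show ?thesis using rng[of "i - 1"] by auto
    qed
    then show ?thesis using w unfolding words_def D_def small_encode_def by (auto simp del: upt_Suc)
  qed
  have D01: "D ! 0 = 0" "D ! 1 = n" by (simp_all add: D_def small_encode_def)
  have Df: "D ! (1 + Suc i) = \<pi> (Suc i)" if "i < n" for i
    using that by (simp add: D_def small_encode_def nth_append del: upt_Suc)
  have Db: "D ! (1 + n + Suc i) = inv \<pi> (Suc i)" if "i < n" for i
    using that by (simp add: D_def small_encode_def nth_append del: upt_Suc)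
  have tb[simp]: "take_bit w x = x" if "x \<le> 2 * n + 2" for x :: nat
    using that w by (simp add: take_bit_nat_eq_self)
  have wpos: "0 < w" using w by (cases w) auto
  have b0: "eval_expr w D s (Data (Const 0)) = 0" for s using len D01 by (simp add: Let_def)
  let ?S = "\<lambda>i. ((\<lambda>_. 0)(0 := take_bit w (Suc i)), \<lambda>_. 0) :: state"
  have zero: "(\<Sum>i<n. 0 :: real) \<le> real n * (1 + H)" using H_nonneg by simp
  have \<rho>1: "1 \<le> real \<rho>" using \<rho>_bounds by simp
  have log\<rho>: "0 \<le> 1 + log 2 (real \<rho>)" using \<rho>_bounds by simp
  have c: "0 \<le> time_factor" by (simp add: time_factor_def)
  show "timely w D fwd_prog n \<pi> C (real \<rho>) H"
  proof (rule timelyI[where L = "\<lambda>_. 0", OF n_pos c C H_nonneg \<rho>1 _ _ log\<rho> zero])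
    fix i assume i: "i < n"
    obtain t where t: "t \<le> max_cost small_fwd" "exec w D small_fwd (?S i) t (sem w D small_fwd (?S i))"
      using exec_sem[of small_fwd w D "?S i"] by (auto simp: small_fwd_def)
    have "exec w D fwd_prog (?S i) (expr_cost (Data (Const 0)) + 1 + t) (sem w D small_fwd (?S i))"
      unfolding fwd_prog_def by (rule exec.CondFalse[OF b0 t(2)])
    moreover have "fst (sem w D small_fwd (?S i)) 0 = \<pi> (Suc i)"
      using i len Df[OF i] by (simp add: small_fwd_def Let_def wpos)
    ultimately have "computes w D fwd_prog (Suc i) (\<pi> (Suc i)) (expr_cost (Data (Const 0)) + 1 + t)"
      unfolding computes_def by blast
    then show "\<exists>t. computes w D fwd_prog (Suc i) (\<pi> (Suc i)) t \<and> real t \<le> time_factor * (2 + 2 * 0)"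
      using t(1) by (intro exI[of _ "expr_cost (Data (Const 0)) + 1 + t"]) (auto simp: time_factor_def)
  qed simp
  show "timely w D bwd_prog n (inv \<pi>) C (real \<rho>) H"
  proof (rule timelyI[where L = "\<lambda>_. 0", OF n_pos c C H_nonneg \<rho>1 _ _ log\<rho> zero])
    fix i assume i: "i < n"
    obtain t where t: "t \<le> max_cost small_bwd" "exec w D small_bwd (?S i) t (sem w D small_bwd (?S i))"
      using exec_sem[of small_bwd w D "?S i"] by (auto simp: small_bwd_def)
    have "exec w D bwd_prog (?S i) (expr_cost (Data (Const 0)) + 1 + t) (sem w D small_bwd (?S i))"
      unfolding bwd_prog_def by (rule exec.CondFalse[OF b0 t(2)])
    moreover have "fst (sem w D small_bwd (?S i)) 0 = inv \<pi> (Suc i)"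
      using i len Db[OF i] D01 by (simp add: small_bwd_def Let_def wpos)
    ultimately have "computes w D bwd_prog (Suc i) (inv \<pi> (Suc i)) (expr_cost (Data (Const 0)) + 1 + t)"
      unfolding computes_def by blast
    then show "\<exists>t. computes w D bwd_prog (Suc i) (inv \<pi> (Suc i)) t \<and> real t \<le> time_factor * (2 + 2 * 0)"
      using t(1) by (intro exI[of _ "expr_cost (Data (Const 0)) + 1 + t"]) (auto simp: time_factor_def)
  qed simp
qed

text \<open>The requirements on the parameters appear as hypotheses on a single \<open>n\<close>;
  they are shown later to hold for all large \<open>n\<close>. With \<open>f = 3 * e\<close> the
  cube of \<open>b\<close> is exactly \<open>2 ^ f\<close>.\<close>

lemma large_case:
  fixes K \<epsilon> C :: real and w e :: nat
  defines "b \<equiv> 2 ^ e" and "f \<equiv> 3 * e"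
  assumes f: "1 \<le> f" "f * f * (f * f) \<le> b" and w: "b < w" "8 \<le> w" "real w \<le> 8 * K * real b"
      "real w \<le> K * log 2 (real n)" "1 \<le> K"
    and b: "2 ^ b \<le> real n powr (1 / 4)" and n: "real n ^ 8 \<le> 2 ^ w" "22 * K + 8 \<le> real n"
    and \<epsilon>: "\<epsilon> = (40 * K + 5) / real f + 77 * (K * log 2 (real n)) ^ 3 * real n powr (1 / 4) / real n" "\<epsilon> \<le> 1"
    and C: "4 * time_factor \<le> C" "22 * K \<le> C"
  shows "\<exists>D. words w D \<and>
    real (size_in_bits w D) \<le> real n * (2 + H) * (1 + \<epsilon>) + C * (real \<rho> * log 2 (real n)) \<and>
    timely w D fwd_prog n \<pi> C (real \<rho>) H \<and> timely w D bwd_prog n (inv \<pi>) C (real \<rho>) H"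
proof -
  obtain t where t: "distinct_leaves t" "leaves t = {..<\<rho>}" "\<forall>a<\<rho>. real (leaf_depth t a) \<le> 1 + log 2 (1 / weight a)"
    using merge_tree_exists by blast
  obtain bt where sbt: "inorder bt = [0..<\<rho>]" "\<forall>a<\<rho>. real (key_depth bt a) \<le> log 2 (1 / weight a)"
    using search_tree_exists by blast
  define B where "B = tree_bits n rn t"
  define D where "D = encode w b f n rn t st bt \<rho>"
  have n8: "8 \<le> real n" using n(2) w(5) by linarith
  have logn: "0 \<le> log 2 (real n)" using n8 by simp
  have m: "real (length B) \<le> real n * (2 + H)" unfolding B_def by (rule length_bits_le[OF t])
  have nH: "0 \<le> real n * (2 + H)" "real n \<le> real n * (2 + H)"
    using H_nonneg n8 mult_left_mono[of 1 "2 + H" "real n"] by auto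
  have size: "real (size_in_bits w D) \<le> real n * (2 + H) * (1 + \<epsilon>) + 22 * K * (real \<rho> * log 2 (real n))"
  proof -
    let ?x = "77 * (K * log 2 (real n)) ^ 3 * real n powr (1 / 4)"
    have "real (size_in_bits w D) \<le> real (length B) * (1 + (40 * K + 5) / real f) + 77 * real w ^ 3 * 2 ^ b + 22 * real \<rho> * real w"
      unfolding size_in_bits_def D_def B_def using encode_size[of t \<rho> f b w K n rn st bt] t f w by simp
    also have "real (length B) * (1 + (40 * K + 5) / real f) \<le> real n * (2 + H) * (1 + (40 * K + 5) / real f)"
      using m w(5) by (intro mult_right_mono) auto
    also have "77 * real w ^ 3 * 2 ^ b \<le> ?x"
      using w b logn by (intro mult_mono power_mono) auto
    \<comment> \<open>The table space is charged to \<open>\<epsilon>\<close> as a relative error;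
      replacing \<open>real n\<close> by \<open>real n * (2 + H)\<close> only enlarges it.\<close>
    also have "?x = real n * (?x / real n)" using n8 by simp
    also have "\<dots> \<le> real n * (2 + H) * (?x / real n)"
      using nH(2) w logn by (intro mult_right_mono) auto
    also have "22 * real \<rho> * real w \<le> 22 * real \<rho> * (K * log 2 (real n))"
      using w by (intro mult_left_mono) auto
    finally show ?thesis unfolding \<epsilon>(1) by (simp add: algebra_simps)
  qed
  have logn_le: "log 2 (real n) \<le> real n"
  proof -
    have "real n \<le> 2 powr real n" using less_exp[of n] by (simp add: powr_realpow less_imp_le flip: of_nat_less_iff)
    then show ?thesis using n8 by (simp add: log_le_iff)
  qed
  then have Hn: "2 + H \<le> 2 * real n" using H_le n8 by linarith
  have n2: "real n * (2 + H) \<le> 2 * real n ^ 2"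
    using mult_left_mono[OF Hn, of "real n"] by (simp add: power2_eq_square)
  have cube: "real n ^ 2 * real n = real n ^ 3" by (simp add: power2_eq_square power3_eq_cube)
  \<comment> \<open>The number of words is at most the number of bits. Its main part is at most
    \<open>4 * real n ^ 2\<close>, the node and run arrays take at most
    \<open>22 * K * real n ^ 2\<close>, and \<open>n\<close> exceeds
    \<open>22 * K + 4\<close>.\<close>
  have len: "real (length D) \<le> real n ^ 3"
  proof -
    have "real (length D) \<le> real (size_in_bits w D)"
      using w(2) unfolding size_in_bits_def by (cases w) simp_all
    also note size
    also have "real n * (2 + H) * (1 + \<epsilon>) \<le> (2 * real n ^ 2) * 2"
    proof -
      have "real n * (2 + H) * (1 + \<epsilon>) \<le> real n * (2 + H) * 2"
        using \<epsilon>(2) by (intro mult_left_mono nH(1)) simp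
      also have "\<dots> \<le> (2 * real n ^ 2) * 2" using n2 by (rule mult_right_mono) simp
      finally show ?thesis .
    qed
    also have "22 * K * (real \<rho> * log 2 (real n)) \<le> 22 * K * real n ^ 2"
      unfolding power2_eq_square using \<rho>_bounds logn_le logn w(5) by (intro mult_left_mono mult_mono) auto
    also have "(2 * real n ^ 2) * 2 + 22 * K * real n ^ 2 = real n ^ 2 * (22 * K + 4)" by (simp add: algebra_simps)
    also have "\<dots> \<le> real n ^ 2 * real n" using n(2) by (intro mult_left_mono) auto
    finally show ?thesis by (simp add: cube)
  qed
  have "real n ^ 3 < real n ^ 8" using n8 by (intro power_strict_increasing) auto
  then have n3: "real n ^ 3 < 2 ^ w" using n(1) by simp
  have lenD: "length D < 2 ^ w"
    using le_less_trans[OF len n3] by (rule real_less_two_power)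
  have sq: "8 * real n ^ 2 \<le> real n ^ 3" using mult_left_mono[OF n8, of "real n ^ 2"] by (simp add: cube)
  have lin: "8 * real n \<le> real n ^ 2" using mult_right_mono[OF n8, of "real n"] by (simp add: power2_eq_square)
  have addr: "2 * (length B + b) < 2 ^ w"
  proof -
    have "real b \<le> 2 ^ b" using less_exp[of b] by (simp add: less_imp_le flip: of_nat_less_iff)
    also note b
    also have "real n powr (1 / 4) \<le> real n powr 1" using n8 by (intro powr_mono) auto
    finally have "real b \<le> real n" using n8 by simp
    then have "real (2 * (length B + b)) \<le> 4 * real n ^ 2 + 2 * real n" using m n2 by simp
    also have "\<dots> \<le> real n ^ 3" using sq lin n8 by linarith
    also note n3
    finally show ?thesis by (rule real_less_two_power)
  qed
  have n1: "n + 1 < 2 ^ w"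
  proof -
    have "real (n + 1) \<le> real n ^ 3" using sq lin n8 by simp
    also note n3
    finally show ?thesis by (rule real_less_two_power)
  qed
  have \<rho>1: "1 \<le> real \<rho>" using \<rho>_bounds by simp
  interpret perm_index w D b f "b * (f * f)" "f * f" B n rn t st bt \<rho>
    unfolding D_def B_def
  proof (rule perm_index_encode)
    show "n + 1 < 2 ^ w" by (rule n1)
    show "b * b * b \<le> 2 ^ f" by (simp add: b_def f_def power_mult[symmetric] power_add[symmetric] mult.commute)
  qed (use f w t sbt addr lenD rn_less st_mono st_\<rho> in \<open>auto simp: D_def B_def\<close>)
  have c: "0 \<le> time_factor" by (simp add: time_factor_def)
  let ?S = "\<lambda>i. ((\<lambda>_. 0)(0 := take_bit w (Suc i)), \<lambda>_. 0) :: state"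
  have S: "fst (?S i) 0 = Suc i" "fst (?S i) 2 = 0" if "i < n" for i
    using that n1 by (simp_all add: take_bit_nat_eq_self)
  have w0: "val s (Data (Const 0)) \<noteq> 0" for s using val_word_length w(2) by simp
  \<comment> \<open>With \<open>L\<close> for \<open>log 2 (1 / weight a)\<close>, the leaf depth is
    at most \<open>1 + L\<close> and the key depth at most \<open>L\<close>. One more unit for the
    work outside the loops gives the \<open>2 + 2 * L\<close> expected by
    \<open>timelyI\<close>.\<close>
  have bound: "real (expr_cost (Data (Const 0)) + 1 + u) \<le> time_factor * (2 + 2 * log 2 (1 / weight a))"
    if "u \<le> query_cost * (leaf_depth t a + key_depth bt a + 1)" "a < \<rho>" for u a
  proof -
    have "real u \<le> real query_cost * real (leaf_depth t a + key_depth bt a + 1)"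
      using of_nat_mono[OF that(1), where 'a = real] by (simp only: of_nat_mult)
    moreover have "3 * 1 \<le> 3 * real (leaf_depth t a + key_depth bt a + 1)" by (intro mult_left_mono) auto
    moreover have "real (expr_cost (Data (Const 0)) + 1 + u) = 3 + real u" by simp
    ultimately have "real (expr_cost (Data (Const 0)) + 1 + u) \<le> (real query_cost + 3) * real (leaf_depth t a + key_depth bt a + 1)"
      unfolding distrib_right by linarith
    also have "\<dots> \<le> time_factor * real (leaf_depth t a + key_depth bt a + 1)"
      by (intro mult_right_mono) (simp_all add: time_factor_def)
    also have "\<dots> \<le> time_factor * (2 + 2 * log 2 (1 / weight a))"
      using t(3) sbt(2) that(2) c by (intro mult_left_mono) fastforce+
    finally show ?thesis .
  qed
  have fwd: "timely w D fwd_prog n \<pi> C (real \<rho>) H"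
  proof (rule timelyI[where L = "\<lambda>i. log 2 (1 / weight (run_of n \<pi> i))", OF n_pos c C(1) H_nonneg \<rho>1])
    fix i assume i: "i < n"
    show "0 \<le> log 2 (1 / weight (run_of n \<pi> i))" "log 2 (1 / weight (run_of n \<pi> i)) \<le> 1 + log 2 (real \<rho>)"
      using log_weight[OF run_of(1)[OF i]] by auto
    define j where "j = P i"
    have j: "j < n" "Q j = i" "rn j = run_of n \<pi> i" using P_less[OF i] Q_P[OF i] by (auto simp: j_def rn_eq)
    obtain u S' where u: "exec w D fwd_main (?S i) u S'" "u \<le> query_cost * (leaf_depth t (rn j) + key_depth bt (rn j) + 1)"
      "fst S' 0 = Suc j"
      using fwd_correct[OF j(1), of i "?S i"] run_of(3)[OF i] node_index_leaf[OF j(1)] i j S[OF i] by auto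
    have "exec w D fwd_prog (?S i) (expr_cost (Data (Const 0)) + 1 + u) S'"
      unfolding fwd_prog_def by (rule exec.CondTrue[OF w0 u(1)])
    moreover have "fst S' 0 = \<pi> (Suc i)" using u(3) Suc_P[OF i] by (simp add: j_def)
    ultimately have "computes w D fwd_prog (Suc i) (\<pi> (Suc i)) (expr_cost (Data (Const 0)) + 1 + u)"
      unfolding computes_def by blast
    then show "\<exists>u. computes w D fwd_prog (Suc i) (\<pi> (Suc i)) u \<and> real u \<le> time_factor * (2 + 2 * log 2 (1 / weight (run_of n \<pi> i)))"
      using bound[OF u(2) rn_less[OF j(1)]] j(3) by auto
  qed (rule average_weight)
  have bwd: "timely w D bwd_prog n (inv \<pi>) C (real \<rho>) H"
  proof (rule timelyI[where L = "\<lambda>j. log 2 (1 / weight (rn j))", OF n_pos c C(1) H_nonneg \<rho>1])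
    fix j assume j: "j < n"
    show "0 \<le> log 2 (1 / weight (rn j))" "log 2 (1 / weight (rn j)) \<le> 1 + log 2 (real \<rho>)"
      using log_weight[OF rn_less[OF j]] by auto
    obtain u S' where u: "exec w D bwd_main (?S j) u S'" "u \<le> query_cost * (leaf_depth t (rn j) + 1)"
      "fst S' 0 = Suc (Q j)"
      using bwd_correct[OF j _ S[OF j]] node_index_leaf[OF j] Q_less[OF j] by auto
    have le: "u \<le> query_cost * (leaf_depth t (rn j) + key_depth bt (rn j) + 1)"
      using u(2) by (rule order_trans) simp
    have "exec w D bwd_prog (?S j) (expr_cost (Data (Const 0)) + 1 + u) S'"
      unfolding bwd_prog_def by (rule exec.CondTrue[OF w0 u(1)])
    moreover have "fst S' 0 = inv \<pi> (Suc j)" using u(3) Suc_Q[OF j] by simp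
    ultimately have "computes w D bwd_prog (Suc j) (inv \<pi> (Suc j)) (expr_cost (Data (Const 0)) + 1 + u)"
      unfolding computes_def by blast
    then show "\<exists>u. computes w D bwd_prog (Suc j) (inv \<pi> (Suc j)) u \<and> real u \<le> time_factor * (2 + 2 * log 2 (1 / weight (rn j)))"
      using bound[OF le rn_less[OF j]] by auto
  qed (rule average_weight_inv)
  have "22 * K * (real \<rho> * log 2 (real n)) \<le> C * (real \<rho> * log 2 (real n))"
    using C(2) logn by (intro mult_right_mono) auto
  then show ?thesis using size fwd bwd words_D by (intro exI[of _ D]) auto
qed

end

section \<open>Asymptotics\<close>

text \<open>The exponent \<open>e\<close> of \<open>b\<close>: the largest power of two up to
  \<open>w n div (4 * k)\<close>. A power of two allows \<open>b^3 = 2 ^ f\<close>, and the divisor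
  4 yields \<open>2 ^ b <= n^(1/4)\<close> once \<open>w n <= k log n\<close>.\<close>

definition chunk :: "nat \<Rightarrow> (nat \<Rightarrow> nat) \<Rightarrow> nat \<Rightarrow> nat" where
  "chunk k w n = floor_log (w n div (4 * k))"

definition overhead :: "real \<Rightarrow> nat \<Rightarrow> nat \<Rightarrow> real" where
  "overhead K e n = (40 * K + 5) / real (3 * e) + 77 * (K * log 2 (real n)) ^ 3 * real n powr (1 / 4) / real n"

lemma chunk_at_top:
  assumes "word_length 8 w" "1 \<le> k"
  shows "filterlim (chunk k w) at_top sequentially"
  unfolding filterlim_at_top
proof
  fix Z :: nat
  have "eventually (\<lambda>n. real (2 ^ Z * (4 * k)) \<le> 8 * (1 + log 2 (real n))) sequentially"
    by real_asymp
  then show "eventually (\<lambda>n. Z \<le> chunk k w n) sequentially"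
    using eventually_ge_at_top[of 1]
  proof eventually_elim
    case (elim n)
    then have "real (2 ^ Z * (4 * k)) \<le> real (w n)"
      using assms(1) unfolding word_length_def by (meson order_trans)
    then have "2 ^ Z * (4 * k) \<le> w n" by (simp only: of_nat_le_iff)
    then have "2 ^ Z \<le> w n div (4 * k)" using assms(2) by (simp add: less_eq_div_iff_mult_less_eq)
    then have "floor_log (2 ^ Z) \<le> floor_log (w n div (4 * k))" by (rule floor_log_le_iff)
    then show ?case by (simp add: chunk_def)
  qed
qed

text \<open>The constant is rounded up to a natural number because \<open>chunk\<close> divides by
  it.\<close>

lemma word_length_upper:
  assumes "word_length 8 w"
  obtains k :: nat where "1 \<le> k" "eventually (\<lambda>n. real (w n) \<le> real k * log 2 (real n)) sequentially"
proof -
  have "(\<lambda>n. real (w n)) \<in> O(\<lambda>n. log 2 (real n))"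
    using assms unfolding word_length_def by (auto dest: bigthetaD1)
  then obtain c where c: "0 < c" "eventually (\<lambda>n. norm (real (w n)) \<le> c * norm (log 2 (real n))) sequentially"
    by (auto elim: landau_o.bigE)
  define k where "k = nat \<lceil>c\<rceil>"
  have k: "c \<le> real k" "1 \<le> k" using c(1) unfolding k_def by linarith+
  have "eventually (\<lambda>n. real (w n) \<le> real k * log 2 (real n)) sequentially"
    using c(2) eventually_ge_at_top[of 1]
  proof eventually_elim
    case (elim n)
    then have "real (w n) \<le> c * log 2 (real n)" by simp
    also have "\<dots> \<le> real k * log 2 (real n)" using k elim by (intro mult_right_mono) auto
    finally show ?case .
  qed
  then show thesis using that k by blast
qed

lemma overhead_tendsto:
  assumes "filterlim e at_top sequentially"
  shows "((\<lambda>n. overhead K (e n) n) \<longlongrightarrow> 0) sequentially"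
proof -
  have "filterlim (\<lambda>n. real (3 * e n)) at_top sequentially"
    using assms by (intro filterlim_compose[OF filterlim_real_sequentially] 
        filterlim_at_top_mono[OF assms]) (auto intro!: always_eventually)
  then have "((\<lambda>n. (40 * K + 5) / real (3 * e n)) \<longlongrightarrow> 0) sequentially"
    by (rule real_tendsto_divide_at_top[OF tendsto_const])
  moreover have "((\<lambda>n. 77 * (K * log 2 (real n)) ^ 3 * real n powr (1 / 4) / real n) \<longlongrightarrow> 0) sequentially"
  proof -
    have "((\<lambda>n. (77 * K ^ 3) * (log 2 (real n) ^ 3 * real n powr (1 / 4) / real n)) \<longlongrightarrow> (77 * K ^ 3) * 0) sequentially"
      by (intro tendsto_mult tendsto_const) real_asymp
    then show ?thesis by (simp add: power_mult_distrib mult.assoc)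
  qed
  ultimately show ?thesis unfolding overhead_def by (auto intro: tendsto_add_zero)
qed

text \<open>These are the requirements that hold only from some \<open>n\<close> on, depending on
  the function \<open>w\<close>. All other lengths are tabulated.\<close>

definition good_size :: "nat \<Rightarrow> (nat \<Rightarrow> nat) \<Rightarrow> nat \<Rightarrow> bool" where
  "good_size k w n \<longleftrightarrow> (let e = chunk k w n in
     1 \<le> e \<and> 3 * e * (3 * e) * (3 * e * (3 * e)) \<le> 2 ^ e \<and> real (w n) \<le> real k * log 2 (real n) \<and>
     22 * real k + 8 \<le> real n \<and> overhead (real k) e n \<le> 1)"

lemma eventually_good_size:
  assumes "word_length 8 w" "1 \<le> k" "eventually (\<lambda>n. real (w n) \<le> real k * log 2 (real n)) sequentially"
  shows "eventually (good_size k w) sequentially"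
proof -
  note lim = chunk_at_top[OF assms(1,2)]
  have "eventually (\<lambda>e. 3 * real e * (3 * real e) * (3 * real e * (3 * real e)) \<le> 2 ^ e) sequentially"
    by real_asymp
  then have "eventually (\<lambda>e::nat. 3 * e * (3 * e) * (3 * e * (3 * e)) \<le> 2 ^ e) sequentially"
  proof eventually_elim
    case (elim e)
    then have "real (3 * e * (3 * e) * (3 * e * (3 * e))) \<le> real (2 ^ e)" by simp
    then show ?case by (simp only: of_nat_le_iff)
  qed
  from eventually_compose_filterlim[OF this lim]
  have 1: "eventually (\<lambda>n. 3 * chunk k w n * (3 * chunk k w n) * (3 * chunk k w n * (3 * chunk k w n)) \<le> 2 ^ chunk k w n) sequentially" .
  have 2: "eventually (\<lambda>n. 1 \<le> chunk k w n) sequentially"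
    using lim unfolding filterlim_at_top by blast
  have 3: "eventually (\<lambda>n. overhead (real k) (chunk k w n) n < 1) sequentially"
    by (rule order_tendstoD(2)[OF overhead_tendsto[OF lim]]) simp
  have 4: "eventually (\<lambda>n. 22 * real k + 8 \<le> real n) sequentially" by real_asymp
  show ?thesis using 1 2 3 4 assms(3)
    by eventually_elim (simp add: good_size_def Let_def)
qed

text \<open>The constant 8 makes room for \<open>real n ^ 8\<close>, far above the addresses in use.
  The summand 1 in \<open>word_length\<close> contributes the factor 256, which carries the smallest
  lengths, \<open>n = 1\<close> included.\<close>

lemma word_length_lower:
  assumes "word_length 8 w" "1 \<le> n"
  shows "8 \<le> w n" "real n ^ 8 * 256 \<le> 2 ^ w n"
proof -
  have w: "8 * (1 + log 2 (real n)) \<le> real (w n)" using assms unfolding word_length_def by blast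
  have "0 \<le> log 2 (real n)" using assms(2) by simp
  then have "8 * 1 \<le> 8 * (1 + log 2 (real n))" by (intro mult_left_mono) auto
  from order_trans[OF this w] have "8 \<le> real (w n)" by simp
  then show "8 \<le> w n" by simp
  have "real n ^ 8 * 256 = (2 powr log 2 (real n)) ^ 8 * 2 powr 8" using assms(2) by simp
  also have "\<dots> = 2 powr (8 * (1 + log 2 (real n)))"
    by (simp add: powr_powr powr_add algebra_simps flip: powr_realpow)
  also have "\<dots> \<le> 2 powr real (w n)" using w by (intro powr_mono) auto
  finally show "real n ^ 8 * 256 \<le> 2 ^ w n" by (simp add: powr_realpow)
qed

lemma good_size_params:
  assumes w: "word_length 8 w" and k: "1 \<le> k" and "1 \<le> n" and good: "good_size k w n"
  defines "b \<equiv> 2 ^ chunk k w n"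
  shows "b < w n" "real (w n) \<le> 8 * real k * real b" "2 ^ b \<le> real n powr (1 / 4)"
proof -
  let ?x = "w n div (4 * k)"
  have "?x \<noteq> 0" using good unfolding good_size_def chunk_def Let_def by (metis floor_log_zero not_one_le_zero)
  then have b1: "b \<le> ?x" unfolding b_def chunk_def by (intro floor_log_exp2_le) simp
  then have "b * (4 * k) \<le> w n" using k by (simp add: less_eq_div_iff_mult_less_eq)
  then have b2: "4 * (b * k) \<le> w n" by (simp add: ac_simps)
  have bk: "b \<le> b * k" "1 \<le> b" using k by (simp_all add: b_def)
  then show "b < w n" using b2 by linarith
  have "?x < 2 * b" unfolding b_def chunk_def by (rule floor_log_exp2_gt)
  then have "w n < 2 * b * (4 * k)" using k by (simp add: div_less_iff_less_mult)
  then have "w n \<le> 8 * k * b" by (simp add: ac_simps)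
  then have "real (w n) \<le> real (8 * k * b)" by (simp only: of_nat_le_iff)
  then show "real (w n) \<le> 8 * real k * real b" by simp
  have "4 * (real b * real k) \<le> real k * log 2 (real n)"
    using of_nat_mono[OF b2, where 'a = real] good unfolding good_size_def Let_def by simp
  then have "real k * (4 * real b) \<le> real k * log 2 (real n)" by (simp add: ac_simps)
  then have "real b \<le> log 2 (real n) * (1 / 4)" using k by simp
  then have "2 powr real b \<le> 2 powr (log 2 (real n) * (1 / 4))" by (intro powr_mono) auto
  also have "\<dots> = real n powr (1 / 4)" using \<open>1 \<le> n\<close> by (simp only: powr_powr[symmetric]) simp
  finally show "2 ^ b \<le> real n powr (1 / 4)" by (simp add: powr_realpow)
qed

theorem theorem3p2:
  "\<exists>c>0. \<forall>w. word_length c w \<longrightarrow>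
     (\<exists>(enc :: nat \<Rightarrow> (nat \<Rightarrow> nat) \<Rightarrow> nat list) (fwd :: prog) (bwd :: prog)
       (\<epsilon> :: nat \<Rightarrow> real) (C :: real).
        \<epsilon> \<in> o(\<lambda>_. 1) \<and>
        (\<forall>(n::nat) \<pi>. n \<ge> 1 \<and> \<pi> permutes {1..n} \<longrightarrow>
           (let \<rho> = real (num_runs n \<pi>); H = seq_entropy (run_lengths n \<pi>); D = enc n \<pi> in
              words (w n) D \<and>
              real (size_in_bits (w n) D)
                \<le> real n * (2 + H) * (1 + \<epsilon> n) + C * (\<rho> * log 2 (real n)) \<and>
              (\<exists>T :: nat \<Rightarrow> nat.
                 (\<forall>i\<in>{1..n}. computes (w n) D fwd i (\<pi> i) (T i) \<and>
                              real (T i) \<le> C * (1 + log 2 \<rho>)) \<and>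
                 measure_pmf.expectation (pmf_of_set {1..n}) (\<lambda>i. real (T i)) \<le> C * (1 + H)) \<and>
              (\<exists>T :: nat \<Rightarrow> nat.
                 (\<forall>i\<in>{1..n}. computes (w n) D bwd i (inv \<pi> i) (T i) \<and>
                              real (T i) \<le> C * (1 + log 2 \<rho>)) \<and>
                 measure_pmf.expectation (pmf_of_set {1..n}) (\<lambda>i. real (T i)) \<le> C * (1 + H)))))"
proof (intro exI[of _ "8::real"] conjI allI impI)
  fix w :: "nat \<Rightarrow> nat" assume w: "word_length 8 w"
  obtain k where k: "1 \<le> k" "eventually (\<lambda>n. real (w n) \<le> real k * log 2 (real n)) sequentially"
    using word_length_upper[OF w] .
  \<comment> \<open>\<open>4 * time_factor\<close> serves the query times and
    \<open>22 * real k\<close> the arrays over nodes and runs.\<close>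
  define C where "C = 4 * time_factor + 22 * real k"
  have C: "4 * time_factor \<le> C" "22 * real k \<le> C" "0 \<le> C"
    by (simp_all add: C_def time_factor_def)
  define big where "big n = overhead (real k) (chunk k w n) n" for n
  \<comment> \<open>For the finitely many tabulated lengths the error term is the size of the table
    itself; changing finitely many values preserves the limit 0.\<close>
  define \<epsilon> where "\<epsilon> n = (if good_size k w n then big n else real (w n * (2 * n + 2)))" for n
  define spec where "spec n \<pi> D \<longleftrightarrow> words (w n) D \<and>
      real (size_in_bits (w n) D) \<le> real n * (2 + seq_entropy (run_lengths n \<pi>)) * (1 + \<epsilon> n)
        + C * (real (num_runs n \<pi>) * log 2 (real n)) \<and>
      timely (w n) D fwd_prog n \<pi> C (real (num_runs n \<pi>)) (seq_entropy (run_lengths n \<pi>)) \<and>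
      timely (w n) D bwd_prog n (inv \<pi>) C (real (num_runs n \<pi>)) (seq_entropy (run_lengths n \<pi>))"
    for n \<pi> D
  have ex: "\<exists>D. spec n \<pi> D" if "1 \<le> n" "\<pi> permutes {1..n}" for n \<pi>
  proof -
    interpret runs n \<pi> using that by unfold_locales
    note wl = word_length_lower[OF w that(1)]
    have "real n ^ 8 * 1 \<le> real n ^ 8 * 256" by (intro mult_left_mono) auto
    from order_trans[OF this wl(2)] have n8: "real n ^ 8 \<le> 2 ^ w n" by simp
    show ?thesis
    proof (cases "good_size k w n")
      case True
      note p = good_size_params[OF w k(1) that(1) True]
      show ?thesis unfolding spec_def \<epsilon>_def big_def using True
        by (simp only: if_True)
          (rule large_case[where K = "real k" and e = "chunk k w n"],
           use True p wl(1) n8 k(1) C in \<open>auto simp: good_size_def Let_def overhead_def\<close>)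
    next
      case False
      have lim: "2 * n + 2 < 2 ^ w n"
      proof -
        have "real n \<le> real n ^ 8" using that(1) by (intro self_le_power) auto
        moreover have "real (2 * n + 2) = 2 * real n + 2" "1 \<le> real n" using that(1) by simp_all
        ultimately have "real (2 * n + 2) < 2 ^ w n" using wl(2) by linarith
        then show ?thesis by (rule real_less_two_power)
      qed
      note s = small_case[OF lim C(1)]
      let ?x = "real (w n * (2 * n + 2))"
      \<comment> \<open>As \<open>real n * (2 + H)\<close> is at least 1, the relative error
        \<open>?x\<close> alone covers the whole table.\<close>
      have "1 * ?x \<le> real n * (2 + H) * (1 + ?x)"
      proof (intro mult_mono)
        have "1 * 1 \<le> real n * (2 + H)" using that(1) H_nonneg by (intro mult_mono) auto
        then show "1 \<le> real n * (2 + H)" by simp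
      qed (use that(1) H_nonneg in auto)
      moreover have "0 \<le> C * (real (num_runs n \<pi>) * log 2 (real n))" using C(3) that(1) by simp
      ultimately show ?thesis using s False unfolding spec_def \<epsilon>_def size_in_bits_def
        by (intro exI[of _ "small_encode n \<pi>"]) simp
    qed
  qed
  \<comment> \<open>The trees inside the encoding come from existence lemmas, so the scheme is fixed
    by choice for each permutation.\<close>
  define enc where "enc n \<pi> = (SOME D. spec n \<pi> D)" for n \<pi>
  have enc: "spec n \<pi> (enc n \<pi>)" if "1 \<le> n" "\<pi> permutes {1..n}" for n \<pi>
    unfolding enc_def using ex[OF that] by (rule someI_ex)
  have "(\<epsilon> \<longlongrightarrow> 0) sequentially"
  proof (rule Lim_transform_eventually)
    show "(big \<longlongrightarrow> 0) sequentially"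
      unfolding big_def by (rule overhead_tendsto[OF chunk_at_top[OF w k(1)]])
    show "eventually (\<lambda>n. big n = \<epsilon> n) sequentially"
      using eventually_good_size[OF w k] by eventually_elim (simp add: \<epsilon>_def)
  qed
  then have "\<epsilon> \<in> o(\<lambda>_. 1)" by (intro smalloI_tendsto) auto
  then show "\<exists>(enc :: nat \<Rightarrow> (nat \<Rightarrow> nat) \<Rightarrow> nat list) (fwd :: prog) (bwd :: prog)
       (\<epsilon> :: nat \<Rightarrow> real) (C :: real).
        \<epsilon> \<in> o(\<lambda>_. 1) \<and>
        (\<forall>(n::nat) \<pi>. n \<ge> 1 \<and> \<pi> permutes {1..n} \<longrightarrow>
           (let \<rho> = real (num_runs n \<pi>); H = seq_entropy (run_lengths n \<pi>); D = enc n \<pi> in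
              words (w n) D \<and>
              real (size_in_bits (w n) D)
                \<le> real n * (2 + H) * (1 + \<epsilon> n) + C * (\<rho> * log 2 (real n)) \<and>
              (\<exists>T :: nat \<Rightarrow> nat.
                 (\<forall>i\<in>{1..n}. computes (w n) D fwd i (\<pi> i) (T i) \<and>
                              real (T i) \<le> C * (1 + log 2 \<rho>)) \<and>
                 measure_pmf.expectation (pmf_of_set {1..n}) (\<lambda>i. real (T i)) \<le> C * (1 + H)) \<and>
              (\<exists>T :: nat \<Rightarrow> nat.
                 (\<forall>i\<in>{1..n}. computes (w n) D bwd i (inv \<pi> i) (T i) \<and>
                              real (T i) \<le> C * (1 + log 2 \<rho>)) \<and>
                 measure_pmf.expectation (pmf_of_set {1..n}) (\<lambda>i. real (T i)) \<le> C * (1 + H))))"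
    using enc unfolding spec_def timely_def Let_def
    by (intro exI[of _ enc] exI[of _ fwd_prog] exI[of _ bwd_prog] exI[of _ \<epsilon>] exI[of _ C]) blast
qed simp

end
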